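(* There exists a function $f\in L^2(S^2)$, $f\neq 0$, such that $$\|\widehat{f\sigma}\|_{L^4(\mathbb{R}^3)}=\mathcal{R}\,\|f\|_{L^2(S^2,\sigma)},\qquad \mathcal{R}=\sup_{0\ne g\in L^2(S^2)}\frac{\|\widehat{g\sigma}\|_{L^4(\mathbb{R}^3)}}{\|g\|_{L^2(S^2,\sigma)}}.$$ That is, there exists an extremizer in $L^2(S^2)$ for the inequality $\|\widehat{f\sigma}\|_{L^4(\mathbb{R}^3)}\le C\|f\|_{L^2(S^2,\sigma)}$.
   Context: $S^2\subset\mathbb{R}^3$ is the unit sphere with surface measure $\sigma$; $L^2(S^2)=L^2(S^2,\sigma)$ consists of complex-valued functions. For $f\in L^2(S^2)$, $\widehat{f\sigma}(\xi)=\int_{S^2} e^{-ix\cdot\xi}f(x)\,d\sigma(x)$ for $\xi\in\mathbb{R}^3$. By the Tomas--Stein theorem the supremum $\mathcal{R}$ is finite. *)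

theory Defs
  imports "HOL-Analysis.Analysis"
begin

text \<open>
  Surface measure on the unit sphere, in the polar-coordinates normalisation
  \<open>\<sigma>(A) = d \<cdot> Leb {t x | 0 < t \<le> 1, x \<in> A}\<close> for Borel \<open>A\<close> in the sphere of \<open>\<real>\<^sup>d\<close>,
  i.e. \<open>dy = r\<^bsup>d-1\<^esup> dr d\<sigma>(x)\<close> for \<open>y = r x\<close>. Here \<open>sgn y = y / |y|\<close> is the radial projection;
  the lemmas below confirm the cone formula and, for \<open>d = 3\<close>, the total mass \<open>4 \<pi>\<close>.
\<close>

definition sphere_measure :: "'a::euclidean_space measure" where
  "sphere_measure =
     scale_measure (of_nat DIM('a))
       (distr (restrict_space lborel (cball 0 1 - {0})) (restrict_space borel (sphere 0 1)) sgn)"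

lemma space_sphere_measure [simp]: "space sphere_measure = sphere 0 1"
  by (simp add: sphere_measure_def space_scale_measure space_restrict_space)

lemma sets_sphere_measure [simp, measurable_cong]:
  "sets sphere_measure = sets (restrict_space borel (sphere 0 1))"
  by (simp add: sphere_measure_def)

lemma sgn_measurable_sphere:
  "(sgn :: 'a::euclidean_space \<Rightarrow> 'a)
     \<in> restrict_space lborel (cball 0 1 - {0}) \<rightarrow>\<^sub>M restrict_space borel (sphere 0 1)"
proof (rule measurable_restrict_space2)
  show "(sgn :: 'a \<Rightarrow> 'a) \<in> space (restrict_space lborel (cball 0 1 - {0})) \<rightarrow> sphere 0 1"
    by (auto simp: space_restrict_space norm_sgn)
  have "(\<lambda>x::'a. x /\<^sub>R norm x) \<in> borel_measurable borel"
    by measurable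
  then have "(sgn :: 'a \<Rightarrow> 'a) \<in> borel_measurable borel"
    by (simp add: sgn_div_norm[abs_def])
  then show "(sgn :: 'a \<Rightarrow> 'a) \<in> borel_measurable (restrict_space lborel (cball 0 1 - {0}))"
    by (intro measurable_restrict_space1) simp
qed

lemma cone_eq_vimage_sgn:
  fixes A :: "'a::real_normed_vector set"
  assumes "A \<subseteq> sphere 0 1"
  shows "{t *\<^sub>R x |t x. 0 < t \<and> t \<le> 1 \<and> x \<in> A} = sgn -` A \<inter> (cball 0 1 - {0})"
proof (intro set_eqI iffI)
  fix y assume "y \<in> {t *\<^sub>R x |t x. 0 < t \<and> t \<le> 1 \<and> x \<in> A}"
  then obtain t x where tx: "y = t *\<^sub>R x" "0 < t" "t \<le> 1" "x \<in> A" by blast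
  then have "norm x = 1" using assms by auto
  with tx show "y \<in> sgn -` A \<inter> (cball 0 1 - {0})"
    by (auto simp: sgn_div_norm)
next
  fix y assume y: "y \<in> sgn -` A \<inter> (cball 0 1 - {0})"
  then have "y = norm y *\<^sub>R sgn y" "0 < norm y" "norm y \<le> 1" "sgn y \<in> A"
    by (auto simp: sgn_div_norm)
  then show "y \<in> {t *\<^sub>R x |t x. 0 < t \<and> t \<le> 1 \<and> x \<in> A}" by blast
qed

lemma emeasure_sphere_measure:
  fixes A :: "'a::euclidean_space set"
  assumes "A \<in> sets borel" "A \<subseteq> sphere 0 1"
  shows "emeasure sphere_measure A =
           of_nat DIM('a) * emeasure lborel {t *\<^sub>R x |t x. 0 < t \<and> t \<le> 1 \<and> x \<in> A}"
proof -
  have A: "A \<in> sets (restrict_space borel (sphere 0 1))"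
    using assms by (auto simp: sets_restrict_space_iff)
  have "emeasure (distr (restrict_space lborel (cball 0 1 - {0}))
          (restrict_space borel (sphere 0 1)) sgn) A
        = emeasure (restrict_space lborel (cball 0 1 - {0})) (sgn -` A \<inter> (cball 0 1 - {0}))"
    by (subst emeasure_distr[OF sgn_measurable_sphere A]) (simp add: space_restrict_space)
  also have "\<dots> = emeasure lborel (sgn -` A \<inter> (cball 0 1 - {0}))"
    by (subst emeasure_restrict_space) auto
  finally show ?thesis
    by (simp only: sphere_measure_def emeasure_scale_measure cone_eq_vimage_sgn[OF assms(2)])
qed

lemma emeasure_sphere_measure_R3:
  "emeasure sphere_measure (sphere 0 1 :: (real^3) set) = ennreal (4 * pi)"
proof -
  have "emeasure sphere_measure (sphere 0 1 :: (real^3) set)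
        = 3 * emeasure lborel (sgn -` sphere 0 1 \<inter> (cball 0 1 - {0}) :: (real^3) set)"
    by (subst emeasure_sphere_measure, simp, simp, subst cone_eq_vimage_sgn) auto
  also have "sgn -` sphere 0 1 \<inter> (cball 0 1 - {0}) = (cball 0 1 - {0} :: (real^3) set)"
    by (auto simp: norm_sgn)
  also have "emeasure lborel (cball 0 1 - {0} :: (real^3) set) = emeasure lborel (cball 0 1 :: (real^3) set)"
    by (rule emeasure_Diff_null_set) auto
  also have "3 * \<dots> = ennreal (4 * pi)"
    by (subst emeasure_cball) (auto simp: unit_ball_vol_3 ennreal_mult'[symmetric] simp flip: ennreal_numeral)
  finally show ?thesis .
qed

text \<open>\<open>L\<^sup>p\<close> norm for \<open>0 < p < \<infinity>\<close>, with value \<open>\<infinity>\<close> when the integral diverges.\<close>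

definition eLp_norm :: "real \<Rightarrow> 'a measure \<Rightarrow> ('a \<Rightarrow> complex) \<Rightarrow> ennreal" where
  "eLp_norm p M f =
     (let I = (\<integral>\<^sup>+ x. ennreal (norm (f x) powr p) \<partial>M)
      in if I = \<infinity> then \<infinity> else ennreal (enn2real I powr (1 / p)))"

text \<open>
  Elements of \<open>L\<^sup>2\<close> are represented by functions, so \<open>f \<noteq> 0\<close> in \<open>L\<^sup>2\<close> has to be expressed
  as \<open>f\<close> not vanishing almost everywhere.
\<close>

definition L2_space :: "'a measure \<Rightarrow> ('a \<Rightarrow> complex) set" where
  "L2_space M = {f \<in> borel_measurable M. eLp_norm 2 M f < \<infinity>}"

definition nonzero_L2 :: "'a measure \<Rightarrow> ('a \<Rightarrow> complex) set" where
  "nonzero_L2 M = {f \<in> L2_space M. \<not> (AE x in M. f x = 0)}"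

definition extension_op :: "('a::euclidean_space \<Rightarrow> complex) \<Rightarrow> 'a \<Rightarrow> complex" where
  "extension_op f \<xi> = (LINT x|sphere_measure. exp (- (\<i> * complex_of_real (x \<bullet> \<xi>))) * f x)"

text \<open>
  The supremum is taken in \<open>ennreal\<close>, so it is meaningful without presupposing its finiteness;
  the denominator is neither \<open>0\<close> nor \<open>\<infinity>\<close> on \<open>nonzero_L2\<close>.
\<close>

definition restriction_const :: ennreal where
  "restriction_const =
     (SUP g \<in> nonzero_L2 (sphere_measure :: (real^3) measure).
        eLp_norm 4 lborel (extension_op g) / eLp_norm 2 sphere_measure g)"

end

theory Submission
  imports Defs "HOL-Probability.Probability"
begin

text \<open>
Constant functions are extremizers, and the supremum is \<open>2 \<pi>\<close>. The argument is Foschi's.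

Write \<open>F\<close> for the transform of \<open>f \<sigma>\<close>. Then \<open>F\<^sup>2\<close> is the transform of \<open>f \<sigma> * f \<sigma>\<close>, so formally
Plancherel turns \<open>\<integral> |F|^4\<close> into \<open>(2 \<pi>)^3\<close> times the integral of
\<open>f(a) f(b) cnj f(c) cnj f(d)\<close> against \<open>\<delta>(a + b - c - d)\<close>. This only grows if \<open>f\<close> is
replaced by \<open>|f|\<close>, and reflecting \<open>c\<close> and \<open>d\<close> makes the constraint symmetric:
\<open>a + b + c + d = 0\<close>. Four unit vectors with sum zero satisfy
  \<open>|a + b| |c + d| + |a + c| |b + d| + |a + d| |b + c| = 4\<close>,
so the integral splits into three terms of the same shape. In each of them the inequality
between arithmetic and geometric mean decouples the pairs, and then two of the four variables
can be integrated out: \<open>\<sigma> * \<sigma>\<close> has density \<open>2 \<pi> / |x|\<close> on the ball of radius 2, so that the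
weight \<open>|c + d|\<close> leaves the constant \<open>2 \<pi>\<close>. What remains is, with \<open>g = |f|\<^sup>2\<close>,
  \<open>\<integral>\<integral> g(x) g(y) (|x + y| + 2 |x - y|) d\<sigma> d\<sigma> \<le> 4 (\<integral> g d\<sigma>)\<^sup>2\<close>,
with equality for constants; it holds because the Euclidean distance is a kernel of negative
type. Altogether \<open>\<integral> |F|^4 \<le> 16 \<pi>^4 (\<integral> |f|\<^sup>2)\<^sup>2\<close>. For \<open>f = 1\<close> the transform is
\<open>4 \<pi> sin r / r\<close> with \<open>r = |\<xi>|\<close>, and \<open>\<integral> |F|^4 = 256 \<pi>^6\<close> is the value on the right.

The delta function is avoided by a Gaussian cutoff \<open>exp (- \<tau>\<^sup>2 |\<xi>|\<^sup>2 / 2)\<close>, which replaces it by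
a Gaussian density of width \<open>\<tau>\<close>. The geometric identity then holds up to \<open>8 |a + b + c + d|\<close>,
which costs a term of order \<open>\<tau> sup |f|^4\<close>. The bounds on the convolution are already exact
inequalities for every \<open>\<tau>\<close>. Truncating \<open>f\<close> at height \<open>n\<close> and taking \<open>\<tau>\<close> of order \<open>n^(-5)\<close>
makes the error vanish, and Fatou's lemma finishes the proof.

The load is carried by \<open>nn_integral_\<sigma>_inner\<close> (Archimedes), \<open>gauss_weighted_L2\<close> (Plancherel),
\<open>nn_integral_\<sigma>\<sigma>_gauss\<close> (the convolution), \<open>chord_form_bound\<close> (the energy),
\<open>foschi_inequality\<close> and \<open>quad_integral_gauss_bound\<close> (the combination),
\<open>nn_integral_extension_le\<close> (the limit) and \<open>nn_integral_extension_one\<close> (the constant function).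
\<close>

section \<open>Surface measure and its symmetries\<close>

text \<open>
It suffices to compare boxes, whose images under the inverse of \<open>T\<close> have the same volume.
\<close>
lemma distr_lborel_orthogonal:
  fixes T :: "real^'n::{finite,wellorder} \<Rightarrow> real^'n::_"
  assumes T: "orthogonal_transformation T"
  shows "distr lborel borel T = lborel"
proof (rule lborel_eqI[symmetric])
  fix l u :: "real^'n::_" assume lu: "\<And>b. b \<in> Basis \<Longrightarrow> l \<bullet> b \<le> u \<bullet> b"
  have lin: "linear T" using T orthogonal_transformation_linear by blast
  have Tm: "T \<in> borel_measurable borel"
    by (intro borel_measurable_continuous_onI linear_continuous_on) (simp add: lin linear_linear)
  have inv: "orthogonal_transformation (inv T)"
    by (rule orthogonal_transformation_inv[OF T])
  have bij: "bij T" by (rule orthogonal_transformation_bij[OF T])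
  have img: "T -` box l u = inv T ` box l u"
    using bij by (simp add: bij_vimage_eq_inv_image)
  have lm: "box l u \<in> lmeasurable" by simp
  have fin: "inv T ` box l u \<in> lmeasurable" by (rule measurable_orthogonal_image[OF inv lm])
  have b: "T -` box l u \<in> sets borel" using Tm by (simp add: measurable_sets_borel)
  have "emeasure (distr lborel borel T) (box l u) = emeasure lborel (T -` box l u)"
    using Tm by (subst emeasure_distr) auto
  also have "\<dots> = emeasure lebesgue (T -` box l u)" using b by simp
  also have "\<dots> = ennreal (measure lebesgue (inv T ` box l u))"
    unfolding img using fin by (simp add: emeasure_eq_measure2)
  also have "\<dots> = ennreal (measure lebesgue (box l u))"
    by (simp add: measure_orthogonal_image[OF inv lm])
  also have "\<dots> = ennreal (\<Prod>b\<in>Basis. (u - l) \<bullet> b)"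
    using lu by (simp add: measure_lborel_box)
  finally show "emeasure (distr lborel borel T) (box l u) = (\<Prod>b\<in>Basis. (u - l) \<bullet> b)" .
qed simp

lemma measurable_sphere_id: "(\<lambda>x. x) \<in> sphere_measure \<rightarrow>\<^sub>M borel"
  by (metis measurable_cong_sets measurable_restrict_space1 measurable_ident_sets sets_sphere_measure)

text \<open>
The cone over \<open>T -` A\<close> is the preimage of the cone over \<open>A\<close>, so the invariance of Lebesgue
measure passes to the sphere.
\<close>
lemma distr_sphere_measure_orthogonal:
  fixes T :: "real^'n::{finite,wellorder} \<Rightarrow> real^'n::_"
  assumes T: "orthogonal_transformation T"
  shows "T \<in> sphere_measure \<rightarrow>\<^sub>M sphere_measure"
    and "distr sphere_measure sphere_measure T = sphere_measure"
proof -
  have lin: "linear T" using T orthogonal_transformation_linear by blast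
  have Tb[measurable]: "T \<in> borel_measurable borel"
    by (intro borel_measurable_continuous_onI linear_continuous_on) (simp add: lin linear_linear)
  have nT: "norm (T x) = norm x" for x using T by (simp add: orthogonal_transformation)
  show Tm: "T \<in> sphere_measure \<rightarrow>\<^sub>M sphere_measure"
    unfolding measurable_cong_sets[OF refl sets_sphere_measure]
    by (intro measurable_restrict_space2 measurable_compose[OF measurable_sphere_id Tb]) (auto simp: nT)
  show "distr sphere_measure sphere_measure T = sphere_measure"
  proof (rule measure_eqI)
    fix A assume "A \<in> sets (distr sphere_measure sphere_measure T)"
    then have A: "A \<in> sets borel" "A \<subseteq> sphere 0 1"
      by (auto simp: sets_restrict_space_iff)
    have A': "A \<in> sets sphere_measure" using A by (auto simp: sets_restrict_space_iff)
    define B where "B = T -` A \<inter> sphere 0 1"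
    have B: "B \<in> sets borel" "B \<subseteq> sphere 0 1"
      unfolding B_def using A by (auto intro!: measurable_sets_borel[OF Tb])
    define C where "C = {t *\<^sub>R x |t x. 0 < t \<and> t \<le> 1 \<and> x \<in> A}"
    have sb: "(sgn :: real^'n::_ \<Rightarrow> real^'n::_) \<in> borel_measurable borel"
    proof -
      have "(\<lambda>x::real^'n::_. x /\<^sub>R norm x) \<in> borel_measurable borel"
        by measurable
      then show ?thesis by (simp add: sgn_div_norm[abs_def])
    qed
    have C: "C \<in> sets borel"
      unfolding C_def cone_eq_vimage_sgn[OF A(2)]
      using A sb by (intro sets.Int) (auto intro!: measurable_sets_borel[OF sb])
    have cone: "{t *\<^sub>R x |t x. 0 < t \<and> t \<le> 1 \<and> x \<in> B} = T -` C"
    proof -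
      have "sgn (T y) = T (sgn y)" for y
        by (simp add: sgn_div_norm nT linear_scale[OF lin])
      then show ?thesis
        unfolding C_def cone_eq_vimage_sgn[OF A(2)] cone_eq_vimage_sgn[OF B(2)]
        by (auto simp: B_def nT norm_sgn) (metis nT norm_eq_zero)+
    qed
    have "emeasure (distr sphere_measure sphere_measure T) A = emeasure sphere_measure B"
      using Tm A' by (subst emeasure_distr) (auto simp: B_def)
    also have "\<dots> = of_nat DIM(real^'n::_) * emeasure lborel (T -` C)"
      by (simp add: emeasure_sphere_measure[OF B] cone)
    also have "emeasure lborel (T -` C) = emeasure (distr lborel borel T) C"
      using C Tb by (subst emeasure_distr) auto
    also have "\<dots> = emeasure lborel C" by (simp add: distr_lborel_orthogonal[OF T])
    also have "of_nat DIM(real^'n::_) * emeasure lborel C = emeasure sphere_measure A"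
      by (simp add: emeasure_sphere_measure[OF A] C_def)
    finally show "emeasure (distr sphere_measure sphere_measure T) A = emeasure sphere_measure A" .
  qed simp
qed

text \<open>
Distribution functions determine measures on the line: the layers \<open>{\<phi> \<le> r}\<close> form an
intersection-stable generator. This turns the volume of balls into polar coordinates.
\<close>
lemma distr_lborel_eq_density:
  fixes \<phi> :: "'a::euclidean_space \<Rightarrow> real" and w :: "real \<Rightarrow> ennreal"
  assumes [measurable]: "\<phi> \<in> borel_measurable borel" "w \<in> borel_measurable borel"
    and nonneg: "\<And>x. 0 \<le> \<phi> x"
    and lev: "\<And>r. 0 \<le> r \<Longrightarrow> emeasure lborel {x. \<phi> x \<le> r} = (\<integral>\<^sup>+s. w s * indicator {0..r} s \<partial>lborel)"
    and fin: "\<And>r. 0 \<le> r \<Longrightarrow> emeasure lborel {x. \<phi> x \<le> r} < \<infinity>"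
  shows "distr lborel borel \<phi> = density lborel (\<lambda>s. w s * indicator {0..} s)"
proof (rule measure_eqI_generator_eq[where E = "range atMost" and \<Omega> = UNIV and A = "\<lambda>n::nat. {..real n}"])
  show "Int_stable (range (atMost :: real \<Rightarrow> real set))"
    by (auto simp: Int_stable_def)
  have D: "emeasure (distr lborel borel \<phi>) {..r} = emeasure lborel {x. \<phi> x \<le> r}" for r
    by (subst emeasure_distr) (auto intro!: arg_cong[where f="emeasure lborel"])
  fix X assume "X \<in> range (atMost :: real \<Rightarrow> real set)"
  then obtain r where X: "X = {..r}" by auto
  have "emeasure (density lborel (\<lambda>s. w s * indicator {0..} s)) {..r} = (\<integral>\<^sup>+s. w s * indicator {0..r} s \<partial>lborel)"
    by (subst emeasure_density) (auto intro!: nn_integral_cong split: split_indicator)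
  also have "\<dots> = emeasure lborel {x. \<phi> x \<le> r}"
  proof (cases "0 \<le> r")
    case False
    then have "{x. \<phi> x \<le> r} = {}" using nonneg by (force intro: order_trans)
    with False show ?thesis by simp
  qed (simp add: lev)
  finally show "emeasure (distr lborel borel \<phi>) X = emeasure (density lborel (\<lambda>s. w s * indicator {0..} s)) X"
    by (simp add: X D)
next
  show "sets (distr lborel borel \<phi>) = sigma_sets UNIV (range atMost)"
    "sets (density lborel (\<lambda>s. w s * indicator {0..} s)) = sigma_sets UNIV (range atMost)"
    by (simp_all add: borel_eq_atMost)
  show "(\<Union>i. {..real i}) = UNIV" by (auto simp: real_arch_simple)
  show "emeasure (distr lborel borel \<phi>) {..real i} \<noteq> \<infinity>" for i
    using fin[of "real i"] by (subst emeasure_distr) (auto simp: vimage_def)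
qed auto

text \<open>
The disc of radius \<open>sqrt r\<close> has area \<open>\<pi> r\<close>, linear in \<open>r\<close>: the squared norm in the plane is
uniformly distributed. This is why squares are used instead of norms.
\<close>
lemma nn_integral_plane_radial:
  fixes H :: "real \<Rightarrow> ennreal"
  assumes [measurable]: "H \<in> borel_measurable borel"
  shows "(\<integral>\<^sup>+y. H ((norm (y :: real \<times> real))\<^sup>2) \<partial>lborel) = (\<integral>\<^sup>+s. ennreal pi * indicator {0..} s * H s \<partial>lborel)"
proof -
  have lev: "emeasure lborel {y :: real \<times> real. (norm y)\<^sup>2 \<le> r} = ennreal (pi * r)" if "0 \<le> r" for r
  proof -
    have "{y :: real \<times> real. (norm y)\<^sup>2 \<le> r} = cball 0 (sqrt r)"
      using that by (auto simp: real_le_rsqrt) (metis norm_ge_zero real_sqrt_abs abs_of_nonneg real_sqrt_le_iff real_sqrt_pow2_iff sqrt_le_D that)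
    then show ?thesis using that by (simp add: emeasure_cball unit_ball_vol_2 numeral_2_eq_2[symmetric])
  qed
  have "(\<integral>\<^sup>+y. H ((norm (y :: real \<times> real))\<^sup>2) \<partial>lborel) = (\<integral>\<^sup>+s. H s \<partial>distr lborel borel (\<lambda>y :: real \<times> real. (norm y)\<^sup>2))"
    by (subst nn_integral_distr) auto
  also have "distr lborel borel (\<lambda>y :: real \<times> real. (norm y)\<^sup>2) = density lborel (\<lambda>s. ennreal pi * indicator {0..} s)"
    by (rule distr_lborel_eq_density) (auto simp: lev nn_integral_cmult ennreal_mult' ennreal_mult_less_top)
  finally show ?thesis by (simp add: nn_integral_density)
qed

lemma nn_integral_space_radial:
  fixes H :: "real \<Rightarrow> ennreal"
  assumes [measurable]: "H \<in> borel_measurable borel"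
  shows "(\<integral>\<^sup>+x. H (norm (x :: real^3)) \<partial>lborel) = (\<integral>\<^sup>+r. ennreal (4 * pi * r\<^sup>2) * indicator {0..} r * H r \<partial>lborel)"
proof -
  have lev: "emeasure lborel {y :: real^3. norm y \<le> r} = ennreal (4 / 3 * pi * r ^ 3)" if "0 \<le> r" for r
  proof -
    have "{y :: real^3. norm y \<le> r} = cball 0 r" by auto
    then show ?thesis using that by (simp add: emeasure_cball unit_ball_vol_3)
  qed
  have int: "(\<integral>\<^sup>+s. ennreal (4 * pi * s\<^sup>2) * indicator {0..r} s \<partial>lborel) = ennreal (4 / 3 * pi * r ^ 3)" if "0 \<le> r" for r
    using that by (subst nn_integral_FTC_Icc[where F = "\<lambda>s. 4 / 3 * pi * s ^ 3"])
      (auto intro!: derivative_eq_intros simp: power2_eq_square)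
  have "(\<integral>\<^sup>+x. H (norm (x :: real^3)) \<partial>lborel) = (\<integral>\<^sup>+s. H s \<partial>distr lborel borel (norm :: real^3 \<Rightarrow> real))"
    by (subst nn_integral_distr) auto
  also have "distr lborel borel (norm :: real^3 \<Rightarrow> real) = density lborel (\<lambda>s. ennreal (4 * pi * s\<^sup>2) * indicator {0..} s)"
    by (rule distr_lborel_eq_density) (auto simp: lev int)
  finally show ?thesis by (simp add: nn_integral_density)
qed

text \<open>
An identification of \<open>\<real> \<times> \<real>\<^sup>2\<close> with \<open>\<real>\<^sup>3\<close>, which makes Fubini available along the first axis.
\<close>
lemma distr_lborel_vec3:
  "distr (lborel :: (real \<times> real \<times> real) measure) borel
     (\<lambda>p. \<chi> i::3. if i = 1 then fst p else if i = 2 then fst (snd p) else snd (snd p)) = lborel"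
  (is "distr _ _ ?V = _")
proof (rule lborel_eqI[symmetric])
  have "continuous_on UNIV (\<lambda>p :: real \<times> real \<times> real. if i = 1 then fst p else if i = 2 then fst (snd p) else snd (snd p))" for i :: 3
    by (cases "i = 1"; cases "i = 2") (simp_all add: continuous_intros)
  then have "continuous_on UNIV ?V"
    by (rule continuous_on_vec_lambda)
  then have V: "?V \<in> borel_measurable borel" by (rule borel_measurable_continuous_onI)
  fix l u :: "real^3" assume lu0: "\<And>b. b \<in> Basis \<Longrightarrow> l \<bullet> b \<le> u \<bullet> b"
  have lu: "l $ i \<le> u $ i" for i using lu0[of "axis i 1"] by (simp add: inner_axis axis_in_Basis_iff)
  have eq: "?V -` box l u = {l$1<..<u$1} \<times> {l$2<..<u$2} \<times> {l$3<..<u$3}"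
    by (auto simp: mem_box_cart forall_3)
  have B3: "(\<Prod>b\<in>Basis. (u - l) \<bullet> b) = (\<Prod>i\<in>UNIV. u$i - l$i)"
    by (simp add: Basis_vec_def prod.UNION_disjoint inner_axis UNION_singleton_eq_range)
       (subst prod.reindex, auto simp: inj_on_def axis_eq_axis inner_axis)
  have "emeasure (distr lborel borel ?V) (box l u) = emeasure (lborel \<Otimes>\<^sub>M (lborel \<Otimes>\<^sub>M lborel)) ({l$1<..<u$1} \<times> {l$2<..<u$2} \<times> {l$3<..<u$3})"
    using V by (subst emeasure_distr) (simp_all add: eq lborel_prod)
  also have "\<dots> = ennreal (u$1 - l$1) * (ennreal (u$2 - l$2) * ennreal (u$3 - l$3))"
  proof -
    have inner: "emeasure lborel ({l$2<..<u$2} \<times> {l$3<..<u$3}) = ennreal (u$2 - l$2) * ennreal (u$3 - l$3)"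
      using lu by (subst lborel_prod[symmetric], subst lborel.emeasure_pair_measure_Times) simp_all
    show ?thesis
      unfolding lborel_prod[where 'a = real and 'b = real]
      using lu by (subst lborel.emeasure_pair_measure_Times) (simp_all add: inner borel_open open_Times)
  qed
  also have "\<dots> = (\<Prod>b\<in>Basis. (u - l) \<bullet> b)"
  proof -
    have "(\<Prod>i\<in>UNIV. u$i - l$i) = (u$1 - l$1) * ((u$2 - l$2) * (u$3 - l$3))"
      unfolding UNIV_3 by simp
    then show ?thesis using lu by (simp only: B3) (simp add: ennreal_mult)
  qed
  finally show "emeasure (distr lborel borel ?V) (box l u) = (\<Prod>b\<in>Basis. (u - l) \<bullet> b)" .
qed simp

text \<open>
Cylindrical coordinates \<open>(z, s)\<close> with \<open>s\<close> the squared distance from the axis, followed by the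
shift \<open>q = z\<^sup>2 + s\<close>; both steps have constant Jacobian.
\<close>
lemma nn_integral_space_axial:
  fixes g :: "real \<Rightarrow> real \<Rightarrow> ennreal"
  assumes [measurable]: "case_prod g \<in> borel_measurable borel"
  shows "(\<integral>\<^sup>+x. g (x $ 1) ((norm (x :: real^3))\<^sup>2) \<partial>lborel)
       = pi * (\<integral>\<^sup>+q. \<integral>\<^sup>+z. indicator {z\<^sup>2..} q * g z q \<partial>lborel \<partial>lborel)"
proof -
  let ?V = "\<lambda>p :: real \<times> real \<times> real. \<chi> i::3. if i = 1 then fst p else if i = 2 then fst (snd p) else snd (snd p)"
  have "continuous_on UNIV (\<lambda>p :: real \<times> real \<times> real. if i = 1 then fst p else if i = 2 then fst (snd p) else snd (snd p))" for i :: 3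
    by (cases "i = 1"; cases "i = 2") (simp_all add: continuous_intros)
  then have "continuous_on UNIV ?V"
    by (rule continuous_on_vec_lambda)
  then have V[measurable]: "?V \<in> borel_measurable borel" by (rule borel_measurable_continuous_onI)
  have [measurable]: "(\<lambda>x. x $ 1) \<in> borel_measurable (borel :: (real^3) measure)"
    by (intro borel_measurable_continuous_onI continuous_intros)
  have [measurable]: "case_prod g \<in> borel_measurable (borel \<Otimes>\<^sub>M borel)"
    using assms by (simp add: borel_prod)
  have gm[measurable]: "(\<lambda>x. g (h x) (k x)) \<in> borel_measurable M" if "h \<in> borel_measurable M" "k \<in> borel_measurable M" for h k and M :: "'z measure"
    using measurable_compose[OF measurable_Pair[OF that], of "case_prod g" borel] by simp
  have nV: "(norm (?V p))\<^sup>2 = (fst p)\<^sup>2 + (norm (snd p))\<^sup>2" for p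
    by (simp add: norm_vec_def L2_set_def sum_3 norm_Pair norm_prod_def)
  have V1: "?V p $ 1 = fst p" for p by simp
  have "(\<integral>\<^sup>+x. g (x $ 1) ((norm (x :: real^3))\<^sup>2) \<partial>lborel)
      = (\<integral>\<^sup>+x. g (x $ 1) ((norm (x :: real^3))\<^sup>2) \<partial>distr lborel borel ?V)"
    by (simp add: distr_lborel_vec3)
  also have "\<dots> = (\<integral>\<^sup>+p. g (fst p) ((fst p)\<^sup>2 + (norm (snd p :: real \<times> real))\<^sup>2) \<partial>lborel)"
    by (subst nn_integral_distr) (simp_all add: nV del: vec_lambda_beta add: V1)
  also have "\<dots> = (\<integral>\<^sup>+z. \<integral>\<^sup>+y. g z (z\<^sup>2 + (norm (y :: real \<times> real))\<^sup>2) \<partial>lborel \<partial>lborel)"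
    by (subst lborel_prod[symmetric], subst lborel.nn_integral_fst[symmetric]) simp_all
  also have "\<dots> = (\<integral>\<^sup>+z. \<integral>\<^sup>+s. ennreal pi * indicator {0..} s * g z (z\<^sup>2 + s) \<partial>lborel \<partial>lborel)"
    by (intro nn_integral_cong nn_integral_plane_radial) simp
  also have "\<dots> = (\<integral>\<^sup>+z. \<integral>\<^sup>+q. ennreal pi * (indicator {z\<^sup>2..} q * g z q) \<partial>lborel \<partial>lborel)"
  proof (rule nn_integral_cong)
    fix z :: real
    show "(\<integral>\<^sup>+s. ennreal pi * indicator {0..} s * g z (z\<^sup>2 + s) \<partial>lborel)
        = (\<integral>\<^sup>+q. ennreal pi * (indicator {z\<^sup>2..} q * g z q) \<partial>lborel)"
      by (subst (2) nn_integral_real_affine[where c = 1 and t = "z\<^sup>2"])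
         (auto intro!: nn_integral_cong simp: ac_simps split: split_indicator)
  qed
  also have "\<dots> = (\<integral>\<^sup>+q. \<integral>\<^sup>+z. ennreal pi * (indicator {z\<^sup>2..} q * g z q) \<partial>lborel \<partial>lborel)"
    by (rule lborel_pair.Fubini') (simp add: indicator_def)
  also have "\<dots> = pi * (\<integral>\<^sup>+q. \<integral>\<^sup>+z. indicator {z\<^sup>2..} q * g z q \<partial>lborel \<partial>lborel)"
    by (simp add: nn_integral_cmult indicator_def)
  finally show ?thesis .
qed

lemma nn_integral_sphere_measure:
  fixes g :: "'a::euclidean_space \<Rightarrow> ennreal"
  assumes [measurable]: "g \<in> borel_measurable borel"
  shows "(\<integral>\<^sup>+x. g x \<partial>sphere_measure)
       = of_nat DIM('a) * (\<integral>\<^sup>+x. g (sgn x) * indicator (cball 0 1 - {0}) x \<partial>lborel)"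
proof -
  have "g \<in> borel_measurable (restrict_space borel (sphere 0 1))"
    by (rule measurable_restrict_space1) simp
  then show ?thesis
    unfolding sphere_measure_def
    by (subst nn_integral_scale_measure)
       (simp_all add: nn_integral_distr[OF sgn_measurable_sphere] nn_integral_restrict_space)
qed

text \<open>
The surface measure as a Borel measure on the whole space: products and compositions then raise
no measurability questions about the sphere as a subspace.
\<close>
definition \<sigma> :: "(real^3) measure" where
  "\<sigma> = distr sphere_measure borel (\<lambda>x. x)"

lemma sets_\<sigma> [simp, measurable_cong]: "sets \<sigma> = sets borel"
  by (simp add: \<sigma>_def)

lemma space_\<sigma> [simp]: "space \<sigma> = UNIV"
  by (simp add: \<sigma>_def)

lemma nn_integral_\<sigma>:
  "g \<in> borel_measurable borel \<Longrightarrow> (\<integral>\<^sup>+x. g x \<partial>\<sigma>) = (\<integral>\<^sup>+x. g x \<partial>sphere_measure)"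
  unfolding \<sigma>_def by (subst nn_integral_distr) (simp_all add: measurable_sphere_id)

lemma emeasure_\<sigma>_UNIV: "emeasure \<sigma> UNIV = ennreal (4 * pi)"
proof -
  have "emeasure \<sigma> UNIV = emeasure sphere_measure (sphere 0 1 :: (real^3) set)"
    unfolding \<sigma>_def by (subst emeasure_distr) (simp_all add: measurable_sphere_id)
  then show ?thesis by (simp add: emeasure_sphere_measure_R3)
qed

lemma finite_measure_\<sigma>: "finite_measure \<sigma>"
  by (rule finite_measureI) (simp add: emeasure_\<sigma>_UNIV)

interpretation \<sigma>: finite_measure \<sigma> by (rule finite_measure_\<sigma>)
interpretation \<sigma>\<sigma>: pair_sigma_finite \<sigma> \<sigma> ..
interpretation \<sigma>\<sigma>: finite_measure "\<sigma> \<Otimes>\<^sub>M \<sigma>" by (intro finite_measure_pair_measure finite_measure_\<sigma>)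

lemma AE_\<sigma>: "AE x in \<sigma>. norm x = 1"
  unfolding \<sigma>_def by (subst AE_distr_iff) (auto simp: measurable_sphere_id)

lemma nn_integral_\<sigma>_cong:
  "(\<And>x. norm x = 1 \<Longrightarrow> f x = g x) \<Longrightarrow> (\<integral>\<^sup>+x. f x \<partial>\<sigma>) = (\<integral>\<^sup>+x. g x \<partial>\<sigma>)"
  using AE_\<sigma> by (intro nn_integral_cong_AE) auto

lemma nn_integral_\<sigma>_mono:
  "(\<And>x. norm x = 1 \<Longrightarrow> f x \<le> g x) \<Longrightarrow> (\<integral>\<^sup>+x. f x \<partial>\<sigma>) \<le> (\<integral>\<^sup>+x. g x \<partial>\<sigma>)"
  using AE_\<sigma> by (intro nn_integral_mono_AE) auto

lemma nn_integral_\<sigma>_orthogonal: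
  assumes T: "orthogonal_transformation T" and g[measurable]: "g \<in> borel_measurable borel"
  shows "(\<integral>\<^sup>+x. g (T x) \<partial>\<sigma>) = (\<integral>\<^sup>+x. g x \<partial>\<sigma>)"
proof -
  have "linear T" using T orthogonal_transformation_linear by blast
  then have [measurable]: "T \<in> borel_measurable borel"
    by (intro borel_measurable_continuous_onI linear_continuous_on) (simp add: linear_linear)
  have g': "g \<in> borel_measurable sphere_measure"
    using measurable_compose[OF measurable_sphere_id g] by simp
  show ?thesis
    using nn_integral_distr[OF distr_sphere_measure_orthogonal(1)[OF T], of g] g'
    by (simp add: nn_integral_\<sigma> distr_sphere_measure_orthogonal(2)[OF T])
qed

lemma nn_integral_\<sigma>_uminus:
  "g \<in> borel_measurable borel \<Longrightarrow> (\<integral>\<^sup>+x. g (- x) \<partial>\<sigma>) = (\<integral>\<^sup>+x. g x \<partial>\<sigma>)"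
  by (rule nn_integral_\<sigma>_orthogonal) (simp add: orthogonal_transformation_def linear_iff)

text \<open>
Archimedes: the projection of the sphere to a diameter is uniformly distributed. After a
rotation the diameter is the first axis. In the coordinates \<open>(z, q)\<close> of
\<open>nn_integral_space_axial\<close> the integrand depends on \<open>t = z / sqrt q\<close> alone, and \<open>z\<close> ranges over
\<open>[- sqrt q, sqrt q]\<close>; so each \<open>q\<close> contributes \<open>sqrt q\<close> times the same integral over
\<open>[-1, 1]\<close>. The factors are \<open>3 \<cdot> \<pi> \<cdot> 2/3 = 2 \<pi>\<close>.
\<close>
lemma nn_integral_\<sigma>_inner:
  fixes u :: "real^3" and H :: "real \<Rightarrow> ennreal"
  assumes [measurable]: "H \<in> borel_measurable borel" and u: "norm u = 1"
  shows "(\<integral>\<^sup>+x. H (x \<bullet> u) \<partial>\<sigma>) = (\<integral>\<^sup>+t. ennreal (2 * pi) * indicator {-1..1} t * H t \<partial>lborel)"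
proof -
  obtain T :: "real^3 \<Rightarrow> real^3" where T: "orthogonal_transformation T" and Tu: "T (axis 1 1) = u"
    using orthogonal_transformation_exists[of "axis 1 1 :: real^3" u] u by auto
  define c where "c = (\<integral>\<^sup>+t. indicator {-1..1} t * H t \<partial>lborel)"
  have "(\<integral>\<^sup>+x. H (x \<bullet> u) \<partial>\<sigma>) = (\<integral>\<^sup>+x. H (T x \<bullet> u) \<partial>\<sigma>)"
    by (rule nn_integral_\<sigma>_orthogonal[OF T, symmetric]) simp
  also have "\<dots> = (\<integral>\<^sup>+x. H (x $ 1) \<partial>\<sigma>)"
    using T by (auto simp: Tu[symmetric] orthogonal_transformation_def inner_axis)
  also have "\<dots> = 3 * (\<integral>\<^sup>+x. H (sgn x $ 1) * indicator (cball 0 1 - {0}) (x :: real^3) \<partial>lborel)"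
  proof -
    have [measurable]: "(\<lambda>x. x $ 1) \<in> borel_measurable (borel :: (real^3) measure)"
      by (intro borel_measurable_continuous_onI continuous_intros)
    show ?thesis by (simp add: nn_integral_\<sigma> nn_integral_sphere_measure)
  qed
  also have "(\<integral>\<^sup>+x. H (sgn x $ 1) * indicator (cball 0 1 - {0}) (x :: real^3) \<partial>lborel)
     = (\<integral>\<^sup>+x. (\<lambda>z q. H (z / sqrt q) * indicator {0<..1} q) (x $ 1) ((norm (x :: real^3))\<^sup>2) \<partial>lborel)"
    by (intro nn_integral_cong) (auto simp: sgn_div_norm divide_inverse mult.commute abs_square_le_1 split: split_indicator)
  also have "\<dots> = pi * (\<integral>\<^sup>+q. \<integral>\<^sup>+z. indicator {z\<^sup>2..} q * (H (z / sqrt q) * indicator {0<..1} q) \<partial>lborel \<partial>lborel)"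
    by (rule nn_integral_space_axial) (simp add: borel_prod[symmetric])
  also have "(\<integral>\<^sup>+q. \<integral>\<^sup>+z. indicator {z\<^sup>2..} q * (H (z / sqrt q) * indicator {0<..1} q) \<partial>lborel \<partial>lborel)
     = (\<integral>\<^sup>+q. c * (ennreal (sqrt q) * indicator {0..1} q) \<partial>lborel)"
  proof (intro nn_integral_cong)
    fix q :: real
    show "(\<integral>\<^sup>+z. indicator {z\<^sup>2..} q * (H (z / sqrt q) * indicator {0<..1} q) \<partial>lborel) = c * (ennreal (sqrt q) * indicator {0..1} q)"
    proof (cases "q \<in> {0<..1}")
      case True
      then have q: "0 < q" "q \<le> 1" by auto
      have [measurable]: "(\<lambda>z. indicator {z\<^sup>2..} q * H (z / sqrt q)) \<in> borel_measurable borel"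
        by (simp add: indicator_def)
      have sq: "q * t\<^sup>2 \<le> q \<longleftrightarrow> -1 \<le> t \<and> t \<le> 1" for t
        using q by (simp add: abs_square_le_1 abs_le_iff) linarith
      have "(\<integral>\<^sup>+z. indicator {z\<^sup>2..} q * (H (z / sqrt q) * indicator {0<..1} q) \<partial>lborel)
         = ennreal (sqrt q) * (\<integral>\<^sup>+t. indicator {-1..1} t * H t \<partial>lborel)"
        using q by (subst nn_integral_real_affine[where c = "sqrt q" and t = 0])
          (auto intro!: arg_cong2[where f = "(*)"] nn_integral_cong simp: power_mult_distrib sq split: split_indicator)
      with True show ?thesis by (simp add: c_def mult.commute)
    next
      case False
      then show ?thesis by (cases "q = 0") (auto simp: indicator_def)
    qed
  qed
  also have "\<dots> = c * ennreal (2 / 3)"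
  proof -
    have "(\<integral>\<^sup>+q. ennreal (sqrt q) * indicator {0..1} q \<partial>lborel) = ennreal (2 / 3 * 1 * sqrt 1 - 2 / 3 * 0 * sqrt 0)"
    proof (rule nn_integral_FTC_Icc[where F = "\<lambda>q. 2 / 3 * q * sqrt q"])
      fix x :: real assume x: "x \<in> {0..1}"
      show "((\<lambda>q. 2 / 3 * q * sqrt q) has_real_derivative sqrt x) (at x)"
      proof (cases "x = 0")
        case True
        have "((\<lambda>q::real. 2 / 3 * sqrt q) \<longlongrightarrow> 2 / 3 * sqrt 0) (at 0)"
          by (intro tendsto_intros)
        then have "((\<lambda>q::real. 2 / 3 * sqrt q) \<longlongrightarrow> 0) (at 0)" by simp
        then have "((\<lambda>q::real. (2 / 3 * q * sqrt q - 0) / (q - 0)) \<longlongrightarrow> 0) (at 0)"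
          by (rule Lim_transform_eventually) (auto simp: eventually_at_filter)
        with True show ?thesis by (simp add: has_field_derivative_iff)
      next
        case False
        with x have "0 < x" by simp
        then show ?thesis
          by (auto intro!: derivative_eq_intros simp: field_simps)
      qed
    qed auto
    then show ?thesis by (simp add: nn_integral_cmult)
  qed
  also have "3 * (ennreal pi * (c * ennreal (2 / 3))) = ennreal (2 * pi) * c"
  proof -
    have "3 * (ennreal pi * (c * ennreal (2 / 3))) = (3 * ennreal pi * ennreal (2 / 3)) * c"
      by (simp add: ac_simps)
    also have "3 * ennreal pi * ennreal (2 / 3) = ennreal (3 * pi * (2 / 3))"
      by (simp only: ennreal_mult'' ennreal_mult' flip: ennreal_numeral)
    finally show ?thesis by simp
  qed
  also have "ennreal (2 * pi) * c = (\<integral>\<^sup>+t. ennreal (2 * pi) * indicator {-1..1} t * H t \<partial>lborel)"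
    by (simp add: c_def nn_integral_cmult mult.assoc)
  finally show ?thesis .
qed

section \<open>Gaussian weights and their Fourier transforms\<close>

text \<open>
The centred Gaussian density with standard deviation \<open>\<tau>\<close> in every coordinate.
\<close>
definition gauss :: "real \<Rightarrow> 'a::euclidean_space \<Rightarrow> real" where
  "gauss \<tau> s = exp (- (norm s)\<^sup>2 / (2 * \<tau>\<^sup>2)) / (sqrt (2 * pi) * \<tau>) ^ DIM('a)"

lemma gauss_nonneg: "0 \<le> \<tau> \<Longrightarrow> 0 \<le> gauss \<tau> s"
  by (simp add: gauss_def)

lemma measurable_gauss [measurable]: "gauss \<tau> \<in> borel_measurable borel"
  unfolding gauss_def[abs_def] by measurable

text \<open>
A rescaling of the characteristic function of the standard normal distribution.
\<close>
lemma gauss_fourier_real: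
  fixes \<tau> a :: real
  assumes \<tau>: "0 < \<tau>"
  shows "integrable lborel (\<lambda>t. complex_of_real (exp (- ((\<tau> * t)\<^sup>2 / 2))) * exp (- (\<i> * complex_of_real (a * t))))"
    (is "integrable _ ?f")
    and "(LINT t|lborel. complex_of_real (exp (- ((\<tau> * t)\<^sup>2 / 2))) * exp (- (\<i> * complex_of_real (a * t))))
       = complex_of_real (sqrt (2 * pi) / \<tau> * exp (- a\<^sup>2 / (2 * \<tau>\<^sup>2)))"
proof -
  let ?g = "\<lambda>x. std_normal_density x *\<^sub>R iexp (- (a / \<tau>) * x)"
  have gi: "integrable lborel ?g"
  proof (rule Bochner_Integration.integrable_bound)
    show "integrable lborel std_normal_density" by simp
  qed (simp_all add: norm_mult)
  have "(LINT x|lborel. ?g x) = char std_normal_distribution (- (a / \<tau>))"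
    unfolding char_def by (subst integral_density) (simp_all)
  then have gint: "(LINT x|lborel. ?g x) = complex_of_real (exp (- (a / \<tau>)\<^sup>2 / 2))"
    by (simp add: char_std_normal_distribution)
  have f: "?f t = complex_of_real (sqrt (2 * pi)) * ?g (0 + \<tau> * t)" for t
  proof -
    have "- (a / \<tau>) * (\<tau> * t) = - (a * t)" using \<tau> by simp
    then show ?thesis
      by (simp add: std_normal_density_def scaleR_conv_of_real)
  qed
  have g2: "integrable lborel (\<lambda>t. ?g (0 + \<tau> * t))"
    using \<tau> by (intro lborel_integrable_real_affine gi) simp
  then show "integrable lborel ?f"
    unfolding f by (rule integrable_mult_right)
  have "complex_of_real (exp (- (a / \<tau>)\<^sup>2 / 2)) = \<bar>\<tau>\<bar> *\<^sub>R (LINT t|lborel. ?g (0 + \<tau> * t))"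
    unfolding gint[symmetric] using \<tau> by (intro lborel_integral_real_affine) simp
  then have "(LINT t|lborel. ?g (0 + \<tau> * t)) = complex_of_real (exp (- (a / \<tau>)\<^sup>2 / 2) / \<tau>)"
    using \<tau> by (simp add: scaleR_conv_of_real field_simps)
  then have "(LINT t|lborel. ?f t) = complex_of_real (sqrt (2 * pi)) * complex_of_real (exp (- (a / \<tau>)\<^sup>2 / 2) / \<tau>)"
    unfolding f integral_mult_right_zero by (simp only:)
  also have "\<dots> = complex_of_real (sqrt (2 * pi) / \<tau> * exp (- a\<^sup>2 / (2 * \<tau>\<^sup>2)))"
    by (simp add: power_divide mult.commute)
  finally show "(LINT t|lborel. ?f t) = complex_of_real (sqrt (2 * pi) / \<tau> * exp (- a\<^sup>2 / (2 * \<tau>\<^sup>2)))" .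
qed

text \<open>
Both exponentials factor over an orthonormal basis, which reduces the integral to dimension one.
\<close>
lemma gauss_fourier:
  fixes s :: "'a::euclidean_space"
  assumes \<tau>: "0 < \<tau>"
  shows "integrable lborel (\<lambda>\<xi>::'a. complex_of_real (exp (- ((\<tau> * norm \<xi>)\<^sup>2 / 2))) * exp (- (\<i> * complex_of_real (s \<bullet> \<xi>))))"
    (is "integrable _ ?f")
    and "(LINT \<xi>|lborel. complex_of_real (exp (- ((\<tau> * norm \<xi>)\<^sup>2 / 2))) * exp (- (\<i> * complex_of_real (s \<bullet> \<xi>))))
       = complex_of_real ((2 * pi) ^ DIM('a) * gauss \<tau> s)"
proof -
  interpret product_sigma_finite "\<lambda>b::'a. lborel :: real measure" ..
  let ?h = "\<lambda>b t. complex_of_real (exp (- ((\<tau> * t)\<^sup>2 / 2))) * exp (- (\<i> * complex_of_real ((s \<bullet> b) * t)))"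
  let ?S = "\<lambda>f. \<Sum>b\<in>Basis. f b *\<^sub>R b :: 'a"
  have S: "?S \<in> (\<Pi>\<^sub>M b\<in>Basis. lborel) \<rightarrow>\<^sub>M borel" by measurable
  have fm: "?f \<in> borel_measurable borel" by measurable
  have fS: "?f (?S f) = (\<Prod>b\<in>Basis. ?h b (f b))" for f
  proof -
    have n: "(norm (?S f))\<^sup>2 = (\<Sum>b\<in>Basis. (f b)\<^sup>2)"
      unfolding power2_norm_eq_inner
      by (simp add: inner_sum_left inner_sum_right inner_Basis sum.delta power2_eq_square if_distrib cong: if_cong)
    have i: "s \<bullet> ?S f = (\<Sum>b\<in>Basis. (s \<bullet> b) * f b)"
      by (simp add: inner_sum_right mult.commute)
    show ?thesis
      unfolding power_mult_distrib n i
      by (simp add: prod.distrib exp_sum[symmetric] sum_distrib_left sum_negf sum_divide_distrib flip: of_real_prod)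
  qed
  have hi: "integrable lborel (?h b)" for b by (rule gauss_fourier_real(1)[OF \<tau>])
  have "integrable (\<Pi>\<^sub>M b\<in>Basis. lborel) (\<lambda>f. \<Prod>b\<in>Basis. ?h b (f b))"
    by (rule product_integrable_prod[OF finite_Basis hi])
  then show "integrable lborel ?f"
    by (subst lborel_eq) (simp only: integrable_distr_eq[OF S fm] fS)
  have "(LINT \<xi>|lborel. ?f \<xi>) = (LINT f|(\<Pi>\<^sub>M b\<in>(Basis::'a set). lborel). ?f (?S f))"
    by (subst lborel_eq) (rule integral_distr[OF S fm])
  also have "\<dots> = (\<Prod>b\<in>Basis. LINT t|lborel. ?h b t)"
    unfolding fS by (rule product_integral_prod[OF finite_Basis hi])
  also have "\<dots> = (\<Prod>b\<in>Basis. complex_of_real (sqrt (2 * pi) / \<tau> * exp (- (s \<bullet> b)\<^sup>2 / (2 * \<tau>\<^sup>2))))"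
    by (simp only: gauss_fourier_real(2)[OF \<tau>])
  also have "\<dots> = complex_of_real ((sqrt (2 * pi) / \<tau>) ^ DIM('a) * exp (- (norm s)\<^sup>2 / (2 * \<tau>\<^sup>2)))"
  proof -
    have "(norm s)\<^sup>2 = (\<Sum>b\<in>Basis. (s \<bullet> b)\<^sup>2)"
      by (simp add: norm_eq_sqrt_inner euclidean_inner[of s s] power2_eq_square sum_nonneg)
    then have "(\<Prod>b\<in>Basis. exp (- (s \<bullet> b)\<^sup>2 / (2 * \<tau>\<^sup>2))) = exp (- (norm s)\<^sup>2 / (2 * \<tau>\<^sup>2))"
      by (simp add: exp_sum[symmetric] sum_negf sum_divide_distrib)
    then show ?thesis by (simp only: of_real_prod[symmetric] prod.distrib prod_constant)
  qed
  also have "(sqrt (2 * pi) / \<tau>) ^ DIM('a) = (2 * pi) ^ DIM('a) / (sqrt (2 * pi) * \<tau>) ^ DIM('a)"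
  proof -
    have "sqrt (2 * pi) / \<tau> = 2 * pi / (sqrt (2 * pi) * \<tau>)"
      using \<tau> real_sqrt_mult_self[of "2 * pi"] by (simp add: field_simps del: real_sqrt_mult_self)
    then show ?thesis by (simp add: power_divide)
  qed
  finally show "(LINT \<xi>|lborel. ?f \<xi>) = complex_of_real ((2 * pi) ^ DIM('a) * gauss \<tau> s)"
    by (simp add: gauss_def)
qed

text \<open>
The substitute for Plancherel. Writing the squared modulus as a double integral over \<open>M\<close> and
integrating over \<open>\<xi>\<close> first replaces the oscillating factor by the nonnegative Gaussian
\<open>(2 \<pi>)^n gauss \<tau> (p x - p y)\<close>, after which moduli can be taken inside. Taking \<open>M = \<sigma> \<Otimes> \<sigma>\<close> and
\<open>p (a, b) = a + b\<close> gives the fourth power of the extension operator.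
\<close>
lemma (in finite_measure) gauss_weighted_L2:
  fixes a :: "'a \<Rightarrow> complex" and p :: "'a \<Rightarrow> 'v::euclidean_space"
  assumes am[measurable]: "a \<in> borel_measurable M" and pm[measurable]: "p \<in> borel_measurable M"
    and bound: "\<And>x. x \<in> space M \<Longrightarrow> norm (a x) \<le> B" and \<tau>: "0 < \<tau>"
  shows "(\<integral>\<^sup>+\<xi>. ennreal (exp (- ((\<tau> * norm \<xi>)\<^sup>2 / 2)) * (norm (LINT x|M. exp (- (\<i> * complex_of_real (p x \<bullet> \<xi>))) * a x))\<^sup>2) \<partial>lborel)
     \<le> (\<integral>\<^sup>+z. ennreal ((2 * pi) ^ DIM('v) * gauss \<tau> (p (fst z) - p (snd z)) * (norm (a (fst z)) * norm (a (snd z)))) \<partial>(M \<Otimes>\<^sub>M M))"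
proof -
  interpret MM: pair_sigma_finite M M ..
  interpret MM: finite_measure "M \<Otimes>\<^sub>M M"
    by (rule finite_measure_pair_measure) unfold_locales
  interpret P: pair_sigma_finite "M \<Otimes>\<^sub>M M" "lborel :: 'v measure" ..
  let ?W = "\<lambda>\<xi>::'v. exp (- ((\<tau> * norm \<xi>)\<^sup>2 / 2))"
  let ?e = "\<lambda>s \<xi>::'v. exp (- (\<i> * complex_of_real (s \<bullet> \<xi>)))"
  let ?A = "\<lambda>\<xi>. LINT x|M. ?e (p x) \<xi> * a x"
  let ?c = "\<lambda>z. a (fst z) * cnj (a (snd z))"
  define \<Phi> where "\<Phi> z \<xi> = ?c z * (complex_of_real (?W \<xi>) * ?e (p (fst z) - p (snd z)) \<xi>)" for z \<xi>
  have [measurable]: "cnj \<in> borel_measurable borel"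
    by (intro borel_measurable_continuous_onI continuous_intros)
  have cm[measurable]: "?c \<in> borel_measurable (M \<Otimes>\<^sub>M M)" by measurable
  have \<Phi>m: "case_prod \<Phi> \<in> borel_measurable ((M \<Otimes>\<^sub>M M) \<Otimes>\<^sub>M lborel)"
    unfolding \<Phi>_def by measurable
  have ne: "norm (?e s \<xi>) = 1" for s \<xi> :: 'v by (simp add: norm_exp_imaginary)
  have Wi: "integrable lborel ?W"
    using integrable_Re[OF gauss_fourier(1)[OF \<tau>, of "0::'v"]] by (simp del: of_real_exp)
  have "0 \<le> B \<or> space M = {}" using bound norm_ge_zero order_trans by blast
  have cb: "norm (?c z) \<le> B * B" if "z \<in> space (M \<Otimes>\<^sub>M M)" for z
    using that bound[of "fst z"] bound[of "snd z"]
    by (auto simp: norm_mult space_pair_measure intro!: mult_mono intro: order_trans[OF norm_ge_zero])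
  have ci: "integrable (M \<Otimes>\<^sub>M M) ?c"
    by (rule MM.integrable_const_bound[where B = "B * B"]) (use cb in auto)
  have \<Phi>i: "integrable ((M \<Otimes>\<^sub>M M) \<Otimes>\<^sub>M lborel) (case_prod \<Phi>)"
  proof (rule P.Fubini_integrable[OF \<Phi>m])
    have "(LINT \<xi>|lborel. norm (case_prod \<Phi> (z, \<xi>))) = norm (?c z) * (LINT \<xi>|lborel. ?W \<xi>)" for z
      by (simp add: \<Phi>_def norm_mult ne del: complex_mod_cnj)
    then show "integrable (M \<Otimes>\<^sub>M M) (\<lambda>z. LINT \<xi>|lborel. norm (case_prod \<Phi> (z, \<xi>)))"
      using ci by (simp only:) (intro integrable_mult_left integrable_norm)
    show "AE z in M \<Otimes>\<^sub>M M. integrable lborel (\<lambda>\<xi>. case_prod \<Phi> (z, \<xi>))"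
      unfolding \<Phi>_def case_prod_conv by (intro AE_I2 integrable_mult_right gauss_fourier(1)[OF \<tau>])
  qed
  have Am: "integrable M (\<lambda>x. ?e (p x) \<xi> * a x)" for \<xi>
    by (rule integrable_const_bound[where B = B]) (use bound in \<open>auto simp: norm_mult ne\<close>)
  have sec: "(LINT z|(M \<Otimes>\<^sub>M M). \<Phi> z \<xi>) = complex_of_real (?W \<xi> * (norm (?A \<xi>))\<^sup>2)" for \<xi>
  proof -
    have eq: "\<Phi> z \<xi> = complex_of_real (?W \<xi>) * ((?e (p (fst z)) \<xi> * a (fst z)) * cnj (?e (p (snd z)) \<xi> * a (snd z)))" for z
      by (simp add: \<Phi>_def exp_cnj inner_diff_left algebra_simps flip: exp_add)
    have int: "integrable (M \<Otimes>\<^sub>M M) (\<lambda>z. (?e (p (fst z)) \<xi> * a (fst z)) * cnj (?e (p (snd z)) \<xi> * a (snd z)))"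
      by (rule MM.integrable_const_bound[where B = "B * B"]) (use cb in \<open>auto simp: norm_mult ne\<close>)
    have "(LINT z|(M \<Otimes>\<^sub>M M). (?e (p (fst z)) \<xi> * a (fst z)) * cnj (?e (p (snd z)) \<xi> * a (snd z))) = ?A \<xi> * cnj (?A \<xi>)"
      by (subst MM.integral_fst'[symmetric, OF int]) (simp del: complex_cnj_mult)
    then show ?thesis
      unfolding eq integral_mult_right_zero of_real_mult complex_norm_square by (simp only:)
  qed
  have Fi: "integrable lborel (\<lambda>\<xi>. complex_of_real (?W \<xi> * (norm (?A \<xi>))\<^sup>2))"
    using P.integrable_snd[OF \<Phi>i] by (simp only: sec)
  then have Fi': "integrable lborel (\<lambda>\<xi>. ?W \<xi> * (norm (?A \<xi>))\<^sup>2)"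
    by (drule_tac integrable_Re) (simp only: Re_complex_of_real)
  define G where "G z = (2 * pi) ^ DIM('v) * gauss \<tau> (p (fst z) - p (snd z))" for z
  have G0: "0 \<le> G z" for z using \<tau> by (simp add: G_def gauss_nonneg)
  have sec2: "(LINT \<xi>|lborel. \<Phi> z \<xi>) = ?c z * complex_of_real (G z)" for z
    unfolding \<Phi>_def G_def by (subst gauss_fourier(2)[OF \<tau>, symmetric]) simp
  have Gi: "integrable (M \<Otimes>\<^sub>M M) (\<lambda>z. ?c z * complex_of_real (G z))"
    using P.integrable_fst[OF \<Phi>i] by (simp only: sec2)
  have "complex_of_real (LINT \<xi>|lborel. ?W \<xi> * (norm (?A \<xi>))\<^sup>2) = (LINT \<xi>|lborel. LINT z|(M \<Otimes>\<^sub>M M). \<Phi> z \<xi>)"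
    by (simp only: sec integral_complex_of_real)
  also have "\<dots> = (LINT z|(M \<Otimes>\<^sub>M M). LINT \<xi>|lborel. \<Phi> z \<xi>)"
    by (rule P.Fubini_integral[OF \<Phi>i])
  also have "\<dots> = (LINT z|(M \<Otimes>\<^sub>M M). ?c z * complex_of_real (G z))" by (simp only: sec2)
  finally have eq: "complex_of_real (LINT \<xi>|lborel. ?W \<xi> * (norm (?A \<xi>))\<^sup>2)
      = (LINT z|(M \<Otimes>\<^sub>M M). ?c z * complex_of_real (G z))" .
  have "(LINT \<xi>|lborel. ?W \<xi> * (norm (?A \<xi>))\<^sup>2) \<le> norm (LINT z|(M \<Otimes>\<^sub>M M). ?c z * complex_of_real (G z))"
    unfolding eq[symmetric] norm_of_real by (rule abs_ge_self)
  also have "\<dots> \<le> (LINT z|(M \<Otimes>\<^sub>M M). norm (?c z * complex_of_real (G z)))" by (rule integral_norm_bound)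
  finally have le: "(LINT \<xi>|lborel. ?W \<xi> * (norm (?A \<xi>))\<^sup>2) \<le> (LINT z|(M \<Otimes>\<^sub>M M). norm (?c z * complex_of_real (G z)))" .
  have "(\<integral>\<^sup>+\<xi>. ennreal (?W \<xi> * (norm (?A \<xi>))\<^sup>2) \<partial>lborel) = ennreal (LINT \<xi>|lborel. ?W \<xi> * (norm (?A \<xi>))\<^sup>2)"
    by (rule nn_integral_eq_integral[OF Fi']) simp
  also have "\<dots> \<le> ennreal (LINT z|(M \<Otimes>\<^sub>M M). norm (?c z * complex_of_real (G z)))" using le by (rule ennreal_leI)
  also have "\<dots> = (\<integral>\<^sup>+z. ennreal (norm (?c z * complex_of_real (G z))) \<partial>(M \<Otimes>\<^sub>M M))"
    by (rule nn_integral_eq_integral[symmetric]) (use Gi in auto)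
  also have "\<dots> = (\<integral>\<^sup>+z. ennreal (G z * (norm (a (fst z)) * norm (a (snd z)))) \<partial>(M \<Otimes>\<^sub>M M))"
    using G0 by (simp add: norm_mult mult.commute)
  finally show ?thesis by (simp add: G_def)
qed

section \<open>Convolution of two surface measures with a Gaussian\<close>

lemma nn_integral_\<sigma>_inner_scaled:
  fixes v :: "real^3" and H :: "real \<Rightarrow> ennreal"
  assumes [measurable]: "H \<in> borel_measurable borel" and v: "v \<noteq> 0"
  shows "(\<integral>\<^sup>+x. H (x \<bullet> v) \<partial>\<sigma>) = (\<integral>\<^sup>+t. ennreal (2 * pi) * indicator {-1..1} t * H (norm v * t) \<partial>lborel)"
proof -
  have "x \<bullet> v = norm v * (x \<bullet> sgn v)" for x using v by (simp add: sgn_div_norm)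
  then show ?thesis
    using v by (simp only:) (rule nn_integral_\<sigma>_inner, auto simp: norm_sgn)
qed

text \<open>
The profile that results from averaging a Gaussian in space over a sphere: two one-dimensional
Gaussians of opposite sign at \<open>\<rho>\<close> and \<open>- \<rho>\<close>.
\<close>
definition dipole :: "real \<Rightarrow> real \<Rightarrow> real \<Rightarrow> real" where
  "dipole \<tau> \<rho> r = normal_density \<rho> \<tau> r - normal_density (- \<rho>) \<tau> r"

lemma measurable_dipole [measurable]: "dipole \<tau> \<rho> \<in> borel_measurable borel"
  unfolding dipole_def[abs_def] by measurable

lemma dipole_nonneg: "0 \<le> \<rho> \<Longrightarrow> 0 \<le> r \<Longrightarrow> 0 \<le> dipole \<tau> \<rho> r"
  unfolding dipole_def normal_density_def
  by (auto intro!: mult_left_mono divide_right_mono simp: power2_eq_square algebra_simps)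

lemma dipole_0 [simp]: "dipole \<tau> \<rho> 0 = 0"
  by (simp add: dipole_def normal_density_def)

text \<open>
By Archimedes the average of a function of \<open>u \<bullet> z\<close> is an integral over an interval, and here the
integrand \<open>exp (- (\<rho>\<^sup>2 + r\<^sup>2 + 2 \<rho> r t) / (2 \<tau>\<^sup>2))\<close> has an elementary antiderivative.
\<close>
lemma nn_integral_gauss_sphere:
  fixes z :: "real^3"
  assumes \<tau>: "0 < \<tau>" and \<rho>: "0 < \<rho>" and z: "z \<noteq> 0"
  shows "(\<integral>\<^sup>+u. ennreal (gauss \<tau> (\<rho> *\<^sub>R u + z)) \<partial>\<sigma>) = ennreal (dipole \<tau> \<rho> (norm z) / (\<rho> * norm z))"
proof -
  define r where "r = norm z"
  have r: "0 < r" using z by (simp add: r_def)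
  define C where "C = (sqrt (2 * pi) * \<tau>) ^ 3"
  have C: "0 < C" using \<tau> by (simp add: C_def)
  define h where "h t = exp (- (\<rho>\<^sup>2 + r\<^sup>2 + 2 * \<rho> * t) / (2 * \<tau>\<^sup>2)) / C" for t
  have [measurable]: "h \<in> borel_measurable borel" unfolding h_def[abs_def] by measurable
  have "(\<integral>\<^sup>+u. ennreal (gauss \<tau> (\<rho> *\<^sub>R u + z)) \<partial>\<sigma>) = (\<integral>\<^sup>+u. ennreal (h (u \<bullet> z)) \<partial>\<sigma>)"
  proof (rule nn_integral_\<sigma>_cong)
    fix u :: "real^3" assume u: "norm u = 1"
    have "(norm (\<rho> *\<^sub>R u + z))\<^sup>2 = \<rho>\<^sup>2 + r\<^sup>2 + 2 * \<rho> * (u \<bullet> z)"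
      using u dot_norm[of "\<rho> *\<^sub>R u" z] \<rho> by (simp add: r_def power_mult_distrib)
    then show "ennreal (gauss \<tau> (\<rho> *\<^sub>R u + z)) = ennreal (h (u \<bullet> z))"
      by (simp add: gauss_def h_def C_def)
  qed
  also have "\<dots> = (\<integral>\<^sup>+t. ennreal (2 * pi) * indicator {-1..1} t * ennreal (h (r * t)) \<partial>lborel)"
    unfolding r_def by (rule nn_integral_\<sigma>_inner_scaled) (simp_all add: z)
  also have "\<dots> = (\<integral>\<^sup>+t. ennreal (2 * pi * h (r * t)) * indicator {-1..1} t \<partial>lborel)"
  proof -
    have "ennreal (2 * pi * h (r * t)) = ennreal (2 * pi) * ennreal (h (r * t))" for t
      by (rule ennreal_mult') simp
    then show ?thesis by (simp only: ac_simps)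
  qed
  also have "\<dots> = ennreal (- (2 * pi * \<tau>\<^sup>2 / (\<rho> * r)) * h (r * 1) - - (2 * pi * \<tau>\<^sup>2 / (\<rho> * r)) * h (r * (- 1)))"
  proof (rule nn_integral_FTC_Icc)
    fix x :: real
    show "((\<lambda>t. - (2 * pi * \<tau>\<^sup>2 / (\<rho> * r)) * h (r * t)) has_real_derivative 2 * pi * h (r * x)) (at x)"
      unfolding h_def using \<tau> \<rho> r C
      by (auto intro!: derivative_eq_intros simp: field_simps power2_eq_square)
    show "0 \<le> 2 * pi * h (r * x)" using C by (simp add: h_def)
  qed simp_all
  also have "- (2 * pi * \<tau>\<^sup>2 / (\<rho> * r)) * h (r * 1) - - (2 * pi * \<tau>\<^sup>2 / (\<rho> * r)) * h (r * (- 1))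
      = dipole \<tau> \<rho> r / (\<rho> * r)"
  proof -
    have s: "2 * pi * \<tau>\<^sup>2 / C = 1 / sqrt (2 * pi * \<tau>\<^sup>2)"
    proof -
      have "(sqrt (2 * pi) * \<tau>)\<^sup>2 = 2 * pi * \<tau>\<^sup>2" by (simp add: power_mult_distrib)
      moreover have "sqrt (2 * pi * \<tau>\<^sup>2) = sqrt (2 * pi) * \<tau>" using \<tau> by (simp add: real_sqrt_mult)
      moreover have "C = (sqrt (2 * pi) * \<tau>)\<^sup>2 * (sqrt (2 * pi) * \<tau>)" by (simp add: C_def power3_eq_cube power2_eq_square)
      ultimately show ?thesis using \<tau> by simp
    qed
    have e: "\<rho>\<^sup>2 + r\<^sup>2 + 2 * \<rho> * (r * 1) = (r - - \<rho>)\<^sup>2" "\<rho>\<^sup>2 + r\<^sup>2 + 2 * \<rho> * (r * (- 1)) = (r - \<rho>)\<^sup>2"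
      by (simp_all add: power2_eq_square algebra_simps)
    have "2 * pi * \<tau>\<^sup>2 * h (r * 1) = normal_density (- \<rho>) \<tau> r" "2 * pi * \<tau>\<^sup>2 * h (r * (- 1)) = normal_density \<rho> \<tau> r"
      unfolding h_def e normal_density_def s[symmetric] by simp_all
    then show ?thesis by (simp add: dipole_def diff_divide_distrib)
  qed
  finally show ?thesis by (simp add: r_def)
qed

text \<open>
The distribution of \<open>|y + z|\<close> on the sphere times itself: \<open>|y + z| = sqrt (2 + 2 t)\<close> with
\<open>t = y \<bullet> z\<close> uniformly distributed, and \<open>dt = r dr\<close> for \<open>r = sqrt (2 + 2 t)\<close>.
\<close>
lemma nn_integral_\<sigma>\<sigma>_norm:
  fixes \<Phi> :: "real \<Rightarrow> real"
  assumes [measurable]: "\<Phi> \<in> borel_measurable borel" and nonneg: "\<And>r. 0 \<le> \<Phi> r"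
  shows "(\<integral>\<^sup>+y. \<integral>\<^sup>+z. ennreal (\<Phi> (norm (y + z))) \<partial>\<sigma> \<partial>\<sigma>)
       = ennreal (8 * pi\<^sup>2) * (\<integral>\<^sup>+r. ennreal (\<Phi> r * r) * indicator {0..2} r \<partial>lborel)"
proof -
  define X where "X = (\<integral>\<^sup>+r. ennreal (\<Phi> r * r) * indicator {0..2} r \<partial>lborel)"
  have one: "(\<integral>\<^sup>+z. ennreal (\<Phi> (norm (y + z))) \<partial>\<sigma>) = ennreal (2 * pi) * X" if y: "norm y = 1" for y :: "real^3"
  proof -
    have "(\<integral>\<^sup>+z. ennreal (\<Phi> (norm (y + z))) \<partial>\<sigma>) = (\<integral>\<^sup>+z. ennreal (\<Phi> (sqrt (2 + 2 * (z \<bullet> y)))) \<partial>\<sigma>)"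
    proof (rule nn_integral_\<sigma>_cong)
      fix z :: "real^3" assume z: "norm z = 1"
      have "(norm (y + z))\<^sup>2 = 2 + 2 * (z \<bullet> y)"
        using y z dot_norm[of y z] by (simp add: inner_commute)
      then show "ennreal (\<Phi> (norm (y + z))) = ennreal (\<Phi> (sqrt (2 + 2 * (z \<bullet> y))))"
        by (metis norm_ge_zero real_sqrt_unique)
    qed
    also have "\<dots> = (\<integral>\<^sup>+t. ennreal (2 * pi) * indicator {-1..1} t * ennreal (\<Phi> (sqrt (2 + 2 * t))) \<partial>lborel)"
      by (rule nn_integral_\<sigma>_inner) (simp_all add: y)
    also have "\<dots> = ennreal (2 * pi) * (\<integral>\<^sup>+t. ennreal (\<Phi> (sqrt (2 + 2 * t))) * indicator {0\<^sup>2 / 2 - 1..2\<^sup>2 / 2 - 1} t \<partial>lborel)"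
      by (subst nn_integral_cmult[symmetric]) (simp_all add: ac_simps)
    also have "(\<integral>\<^sup>+t. ennreal (\<Phi> (sqrt (2 + 2 * t))) * indicator {0\<^sup>2 / 2 - 1..2\<^sup>2 / 2 - 1} t \<partial>lborel)
       = (\<integral>\<^sup>+t. ennreal (\<Phi> (sqrt (2 + 2 * t)) * indicator {0\<^sup>2 / 2 - 1..2\<^sup>2 / 2 - 1} t) \<partial>lborel)"
      by (intro nn_integral_cong) (simp split: split_indicator)
    also have "\<dots> = (\<integral>\<^sup>+r. ennreal (\<Phi> (sqrt (2 + 2 * (r\<^sup>2 / 2 - 1))) * r * indicator {0..2} r) \<partial>lborel)"
      by (rule nn_integral_substitution)
        (auto intro!: derivative_eq_intros continuous_intros simp: set_borel_measurable_def)
    also have "\<dots> = X"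
      unfolding X_def by (intro nn_integral_cong) (simp split: split_indicator)
    finally show ?thesis .
  qed
  have "(\<integral>\<^sup>+y. \<integral>\<^sup>+z. ennreal (\<Phi> (norm (y + z))) \<partial>\<sigma> \<partial>\<sigma>) = (\<integral>\<^sup>+y. ennreal (2 * pi) * X \<partial>\<sigma>)"
    by (rule nn_integral_\<sigma>_cong) (rule one)
  also have "\<dots> = ennreal (2 * pi) * ennreal (4 * pi) * X"
    by (simp add: emeasure_\<sigma>_UNIV ac_simps)
  also have "ennreal (2 * pi) * ennreal (4 * pi) = ennreal (8 * pi\<^sup>2)"
    by (simp flip: ennreal_mult add: power2_eq_square)
  finally show ?thesis by (simp add: X_def)
qed

lemma nn_integral_\<sigma>\<sigma>_orthogonal:
  fixes F :: "real^3 \<Rightarrow> real^3 \<Rightarrow> ennreal"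
  assumes T: "orthogonal_transformation T" and Fm[measurable]: "case_prod F \<in> borel_measurable (borel \<Otimes>\<^sub>M borel)"
  shows "(\<integral>\<^sup>+y. \<integral>\<^sup>+z. F (T y) (T z) \<partial>\<sigma> \<partial>\<sigma>) = (\<integral>\<^sup>+y. \<integral>\<^sup>+z. F y z \<partial>\<sigma> \<partial>\<sigma>)"
proof -
  have "(\<integral>\<^sup>+y. \<integral>\<^sup>+z. F (T y) (T z) \<partial>\<sigma> \<partial>\<sigma>) = (\<integral>\<^sup>+y. \<integral>\<^sup>+z. F (T y) z \<partial>\<sigma> \<partial>\<sigma>)"
    by (intro nn_integral_cong nn_integral_\<sigma>_orthogonal[OF T]) simp
  also have "\<dots> = (\<integral>\<^sup>+y. \<integral>\<^sup>+z. F y z \<partial>\<sigma> \<partial>\<sigma>)"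
    by (rule nn_integral_\<sigma>_orthogonal[OF T]) simp
  finally show ?thesis .
qed

text \<open>
The left-hand side is the convolution of a Gaussian with the image of \<open>\<sigma> \<times> \<sigma>\<close> under addition,
weighted by \<open>\<phi>\<close>. It depends on \<open>|x|\<close> only, hence equals its average over the sphere of that
radius. Under the average the Gaussian becomes a function of \<open>|y + z|\<close>, whose distribution is
known. For continuous \<open>\<phi>\<close> and \<open>\<tau>\<close> tending to 0 the right-hand side approaches
\<open>2 \<pi> \<phi>(|x|) / |x|\<close> inside the ball of radius 2.
\<close>
lemma nn_integral_\<sigma>\<sigma>_gauss:
  fixes \<phi> :: "real \<Rightarrow> real" and x :: "real^3"
  assumes [measurable]: "\<phi> \<in> borel_measurable borel" and nonneg: "\<And>r. 0 \<le> \<phi> r"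
    and \<tau>: "0 < \<tau>" and x: "x \<noteq> 0"
  shows "(\<integral>\<^sup>+y. \<integral>\<^sup>+z. ennreal (\<phi> (norm (y + z)) * gauss \<tau> (x + y + z)) \<partial>\<sigma> \<partial>\<sigma>)
       = ennreal (2 * pi) * (\<integral>\<^sup>+r. ennreal (\<phi> r * dipole \<tau> (norm x) r / norm x) * indicator {0..2} r \<partial>lborel)"
proof -
  define \<rho> where "\<rho> = norm x"
  have \<rho>: "0 < \<rho>" using x by (simp add: \<rho>_def)
  define J where "J w = (\<integral>\<^sup>+y. \<integral>\<^sup>+z. ennreal (\<phi> (norm (y + z)) * gauss \<tau> (w + y + z)) \<partial>\<sigma> \<partial>\<sigma>)" for w :: "real^3"
  have Jrot: "J (\<rho> *\<^sub>R u) = J x" if u: "norm u = 1" for u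
  proof -
    obtain T where T: "orthogonal_transformation T" and Tx: "T x = \<rho> *\<^sub>R u"
      using orthogonal_transformation_exists[of x "\<rho> *\<^sub>R u"] u \<rho> by (auto simp: \<rho>_def)
    have lin: "linear T" using T orthogonal_transformation_linear by blast
    have n: "norm (T y) = norm y" for y using T by (simp add: orthogonal_transformation)
    have "J (\<rho> *\<^sub>R u) = (\<integral>\<^sup>+y. \<integral>\<^sup>+z. ennreal (\<phi> (norm (T y + T z)) * gauss \<tau> (T x + T y + T z)) \<partial>\<sigma> \<partial>\<sigma>)"
      unfolding J_def Tx[symmetric]
      by (rule nn_integral_\<sigma>\<sigma>_orthogonal[OF T, symmetric]) measurable
    also have "\<dots> = J x"
      unfolding J_def gauss_def linear_add[OF lin, symmetric] n ..
    finally show ?thesis .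
  qed
  \<comment> \<open>Where \<open>y + z = 0\<close> the average is the constant \<open>\<kappa>\<close>, which the weight \<open>r\<close> in the
    distribution of \<open>|y + z|\<close> annihilates.\<close>
  define \<kappa> where "\<kappa> = 4 * pi * gauss \<tau> (\<rho> *\<^sub>R axis 1 1 :: real^3)"
  have \<kappa>: "0 \<le> \<kappa>" using \<tau> by (simp add: \<kappa>_def gauss_nonneg)
  define \<Phi> where "\<Phi> r = \<phi> r * (if r = 0 then \<kappa> else if 0 < r then dipole \<tau> \<rho> r / (\<rho> * r) else 0)" for r
  have [measurable]: "\<Phi> \<in> borel_measurable borel" unfolding \<Phi>_def[abs_def] by measurable
  have \<Phi>0: "0 \<le> \<Phi> r" for r using \<rho> \<kappa> by (auto simp: \<Phi>_def nonneg dipole_nonneg)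
  have inner: "(\<integral>\<^sup>+u. ennreal (\<phi> (norm (y + z)) * gauss \<tau> (\<rho> *\<^sub>R u + y + z)) \<partial>\<sigma>) = ennreal (\<Phi> (norm (y + z)))" for y z :: "real^3"
  proof -
    have "(\<integral>\<^sup>+u. ennreal (\<phi> (norm (y + z)) * gauss \<tau> (\<rho> *\<^sub>R u + y + z)) \<partial>\<sigma>)
        = ennreal (\<phi> (norm (y + z))) * (\<integral>\<^sup>+u. ennreal (gauss \<tau> (\<rho> *\<^sub>R u + (y + z))) \<partial>\<sigma>)"
      by (subst nn_integral_cmult[symmetric]) (simp_all add: ennreal_mult' nonneg add.assoc)
    also have "(\<integral>\<^sup>+u. ennreal (gauss \<tau> (\<rho> *\<^sub>R u + (y + z))) \<partial>\<sigma>)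
        = ennreal (if norm (y + z) = 0 then \<kappa> else dipole \<tau> \<rho> (norm (y + z)) / (\<rho> * norm (y + z)))"
    proof (cases "y + z = 0")
      case True
      have "(\<integral>\<^sup>+u. ennreal (gauss \<tau> (\<rho> *\<^sub>R u + (y + z))) \<partial>\<sigma>) = (\<integral>\<^sup>+u. ennreal (gauss \<tau> (\<rho> *\<^sub>R axis 1 1 :: real^3)) \<partial>\<sigma>)"
        unfolding True by (rule nn_integral_\<sigma>_cong) (simp add: gauss_def)
      also have "\<dots> = ennreal \<kappa>"
        unfolding \<kappa>_def by (subst mult.commute, subst ennreal_mult) (use \<tau> in \<open>simp_all add: gauss_nonneg emeasure_\<sigma>_UNIV\<close>)
      finally show ?thesis using True by simp
    next
      case False
      then show ?thesis using nn_integral_gauss_sphere[OF \<tau> \<rho> False] by simp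
    qed
    finally show ?thesis by (simp add: \<Phi>_def ennreal_mult' nonneg)
  qed
  have "ennreal (4 * pi) * J x = (\<integral>\<^sup>+u. J x \<partial>\<sigma>)"
    by (simp add: emeasure_\<sigma>_UNIV mult.commute)
  also have "\<dots> = (\<integral>\<^sup>+u. J (\<rho> *\<^sub>R u) \<partial>\<sigma>)" by (rule nn_integral_\<sigma>_cong) (simp add: Jrot)
  also have "\<dots> = (\<integral>\<^sup>+y. \<integral>\<^sup>+u. \<integral>\<^sup>+z. ennreal (\<phi> (norm (y + z)) * gauss \<tau> (\<rho> *\<^sub>R u + y + z)) \<partial>\<sigma> \<partial>\<sigma> \<partial>\<sigma>)"
    unfolding J_def by (rule \<sigma>\<sigma>.Fubini') measurable
  also have "\<dots> = (\<integral>\<^sup>+y. \<integral>\<^sup>+z. \<integral>\<^sup>+u. ennreal (\<phi> (norm (y + z)) * gauss \<tau> (\<rho> *\<^sub>R u + y + z)) \<partial>\<sigma> \<partial>\<sigma> \<partial>\<sigma>)"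
    by (rule nn_integral_cong, rule \<sigma>\<sigma>.Fubini') measurable
  also have "\<dots> = (\<integral>\<^sup>+y. \<integral>\<^sup>+z. ennreal (\<Phi> (norm (y + z))) \<partial>\<sigma> \<partial>\<sigma>)" by (simp only: inner)
  also have "\<dots> = ennreal (8 * pi\<^sup>2) * (\<integral>\<^sup>+r. ennreal (\<Phi> r * r) * indicator {0..2} r \<partial>lborel)"
    by (rule nn_integral_\<sigma>\<sigma>_norm) (simp_all add: \<Phi>0)
  also have "(\<integral>\<^sup>+r. ennreal (\<Phi> r * r) * indicator {0..2} r \<partial>lborel)
      = (\<integral>\<^sup>+r. ennreal (\<phi> r * dipole \<tau> \<rho> r / \<rho>) * indicator {0..2} r \<partial>lborel)"
    by (intro nn_integral_cong) (auto simp: \<Phi>_def split: split_indicator)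
  also have "ennreal (8 * pi\<^sup>2) = ennreal (4 * pi) * ennreal (2 * pi)"
    by (simp flip: ennreal_mult add: power2_eq_square)
  finally show ?thesis
    unfolding mult.assoc ennreal_mult_cancel_left J_def \<rho>_def by auto
qed

lemma nn_integral_dipole:
  assumes \<tau>: "0 < \<tau>" and \<rho>: "0 < \<rho>"
  shows "(\<integral>\<^sup>+r. ennreal (dipole \<tau> \<rho> r) * indicator {0..2} r \<partial>lborel) \<le> 1"
proof -
  have "(\<integral>\<^sup>+r. ennreal (dipole \<tau> \<rho> r) * indicator {0..2} r \<partial>lborel) \<le> (\<integral>\<^sup>+r. ennreal (normal_density \<rho> \<tau> r) \<partial>lborel)"
    by (intro nn_integral_mono) (auto simp: dipole_def intro!: ennreal_leI split: split_indicator)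
  also have "\<dots> = 1" using \<tau> by (subst nn_integral_eq_integral) auto
  finally show ?thesis .
qed

text \<open>
The mean of the normal distribution around \<open>\<rho>\<close> is \<open>\<rho>\<close>; folding its integral over the line at 0
gives exactly \<open>r * dipole \<tau> \<rho> r\<close> on the half-line.
\<close>
lemma nn_integral_dipole_mean:
  assumes \<tau>: "0 < \<tau>" and \<rho>: "0 < \<rho>"
  shows "(\<integral>\<^sup>+r. ennreal (r * dipole \<tau> \<rho> r) * indicator {0..2} r \<partial>lborel) \<le> ennreal \<rho>"
proof -
  let ?n = "\<lambda>r. normal_density \<rho> \<tau> r * r"
  let ?p = "\<lambda>r. indicator {0..} r * ?n r" and ?m = "\<lambda>r. indicator {..<0} r * ?n r"
  have ni: "integrable lborel ?n" using normal_moment_nz_1[OF \<tau>] by (rule integrable.intros)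
  have pi: "integrable lborel ?p" and mi: "integrable lborel ?m"
    using integrable_mult_indicator[OF _ ni, of "{0..}"] integrable_mult_indicator[OF _ ni, of "{..<0}"] by simp_all
  have mi': "integrable lborel (\<lambda>r. ?m (0 + (- 1) * r))" by (rule lborel_integrable_real_affine[OF mi]) simp
  have "\<rho> = (LINT r|lborel. ?n r)" using normal_moment_nz_1[OF \<tau>, of \<rho>] by (simp add: has_bochner_integral_integral_eq)
  also have "\<dots> = (LINT r|lborel. ?p r + ?m r)"
    by (intro Bochner_Integration.integral_cong) (auto split: split_indicator)
  also have "\<dots> = (LINT r|lborel. ?p r) + (LINT r|lborel. ?m r)" by (rule Bochner_Integration.integral_add[OF pi mi])
  also have "(LINT r|lborel. ?m r) = (LINT r|lborel. ?m (0 + (- 1) * r))"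
    by (subst lborel_integral_real_affine[where c = "- 1" and t = 0]) simp_all
  also have "(LINT r|lborel. ?p r) + (LINT r|lborel. ?m (0 + (- 1) * r)) = (LINT r|lborel. ?p r + ?m (0 + (- 1) * r))"
    by (rule Bochner_Integration.integral_add[OF pi mi', symmetric])
  finally have \<rho>_eq: "\<rho> = (LINT r|lborel. ?p r + ?m (0 + (- 1) * r))" .
  \<comment> \<open>The part of the mean over the negative half-line, moved to the positive one.\<close>
  have reflect: "?p r + ?m (0 + (- 1) * r) = r * dipole \<tau> \<rho> r * indicator {0..} r" for r
  proof -
    have "normal_density \<rho> \<tau> (- r) = normal_density (- \<rho>) \<tau> r"
      by (simp add: normal_density_def power2_commute[of "- r" \<rho>] add.commute)
    then show ?thesis by (auto simp: dipole_def algebra_simps split: split_indicator)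
  qed
  have "(\<integral>\<^sup>+r. ennreal (r * dipole \<tau> \<rho> r) * indicator {0..2} r \<partial>lborel) \<le> (\<integral>\<^sup>+r. ennreal (?p r + ?m (0 + (- 1) * r)) \<partial>lborel)"
    unfolding reflect using \<rho>
    by (intro nn_integral_mono) (auto split: split_indicator)
  also have "\<dots> = ennreal (LINT r|lborel. ?p r + ?m (0 + (- 1) * r))"
  proof (rule nn_integral_eq_integral)
    show "integrable lborel (\<lambda>r. ?p r + ?m (0 + (- 1) * r))"
      by (rule Bochner_Integration.integrable_add[OF pi mi'])
    show "AE r in lborel. 0 \<le> ?p r + ?m (0 + (- 1) * r)"
      unfolding reflect using \<rho> by (auto intro!: mult_nonneg_nonneg dipole_nonneg split: split_indicator)
  qed
  also have "\<dots> = ennreal \<rho>" by (simp only: \<rho>_eq[symmetric])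
  finally show ?thesis .
qed

section \<open>The distance energy on the sphere\<close>

text \<open>
The functions enter through their squares, and the kernel is \<open>|x + y|\<close>, the length of the chord
from \<open>x\<close> to \<open>- y\<close>. With \<open>f (- x)\<close> in the second argument it becomes the form of \<open>|x - y|\<close>.
\<close>
definition chord_form :: "(real^3 \<Rightarrow> real) \<Rightarrow> (real^3 \<Rightarrow> real) \<Rightarrow> ennreal" where
  "chord_form u v = (\<integral>\<^sup>+x. \<integral>\<^sup>+y. ennreal ((u x)\<^sup>2 * (v y)\<^sup>2 * norm (x + y)) \<partial>\<sigma> \<partial>\<sigma>)"

definition height_measure :: "real measure" where "height_measure = density lborel (indicator {-1..1})"

lemma sets_height_measure [simp, measurable_cong]: "sets height_measure = sets borel" by (simp add: height_measure_def)

lemma nn_integral_height_measure: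
  "f \<in> borel_measurable borel \<Longrightarrow> (\<integral>\<^sup>+t. f t \<partial>height_measure) = (\<integral>\<^sup>+t. f t * indicator {-1..1} t \<partial>lborel)"
  unfolding height_measure_def by (subst nn_integral_density) (simp_all add: mult.commute)

lemma finite_measure_height_measure: "finite_measure height_measure"
  by (rule finite_measureI) (simp add: height_measure_def emeasure_density)

interpretation height_measure: finite_measure height_measure by (rule finite_measure_height_measure)
interpretation Caps: pair_sigma_finite \<sigma> height_measure ..
interpretation Caps: finite_measure "\<sigma> \<Otimes>\<^sub>M height_measure"
  by (intro finite_measure_pair_measure finite_measure_\<sigma> finite_measure_height_measure)
interpretation \<sigma>Caps: pair_sigma_finite \<sigma> "\<sigma> \<Otimes>\<^sub>M height_measure" ..

text \<open>
A pair \<open>(u, t)\<close> stands for the spherical cap \<open>{x. t \<le> x \<bullet> u}\<close>, and \<open>cap x\<close> is the indicator of the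
caps that contain \<open>x\<close>.
\<close>
definition cap :: "real^3 \<Rightarrow> (real^3) \<times> real \<Rightarrow> ennreal" where
  "cap x p = (if snd p \<le> x \<bullet> fst p then 1 else 0)"

lemma measurable_cap [measurable]:
  assumes [measurable]: "f \<in> M \<rightarrow>\<^sub>M borel" "g \<in> M \<rightarrow>\<^sub>M borel \<Otimes>\<^sub>M borel"
  shows "(\<lambda>z. cap (f z) (g z)) \<in> borel_measurable M"
  unfolding cap_def by measurable

lemma nn_integral_Caps:
  assumes F: "F \<in> borel_measurable (borel \<Otimes>\<^sub>M borel)"
  shows "(\<integral>\<^sup>+p. F p \<partial>(\<sigma> \<Otimes>\<^sub>M height_measure)) = (\<integral>\<^sup>+u. \<integral>\<^sup>+t. F (u, t) * indicator {-1..1} t \<partial>lborel \<partial>\<sigma>)"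
proof -
  have F': "F \<in> borel_measurable (\<sigma> \<Otimes>\<^sub>M height_measure)"
    using F by (simp add: measurable_cong_sets[OF sets_pair_measure_cong[OF sets_\<sigma> sets_height_measure] refl])
  note [measurable] = F
  show ?thesis
    unfolding height_measure.nn_integral_fst[OF F', symmetric] by (intro nn_integral_cong nn_integral_height_measure) measurable
qed

text \<open>
The distance is a constant minus a positive definite kernel: up to the factor \<open>1 / \<pi>\<close> that kernel
is the measure of the caps containing both points. For fixed \<open>u\<close> the heights form an interval of
length \<open>1 + min (x \<bullet> u) (y \<bullet> u)\<close>. Since \<open>min\<close> is half the sum minus half the absolute
difference, the sum contributes nothing beyond \<open>4 \<pi>\<close> and the difference gives
\<open>\<pi> |x - y|\<close>, both by Archimedes.
\<close>
lemma nn_integral_cap_cap: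
  fixes x y :: "real^3"
  assumes x: "norm x = 1" and y: "norm y = 1"
  shows "(\<integral>\<^sup>+p. cap x p * cap y p \<partial>(\<sigma> \<Otimes>\<^sub>M height_measure)) + ennreal (pi * norm (x - y)) = ennreal (4 * pi)"
proof -
  have inner_le: "\<bar>w \<bullet> u\<bar> \<le> 1" if "norm w = 1" "norm u = 1" for w u :: "real^3"
    using Cauchy_Schwarz_ineq2[of w u] that by simp
  have "(\<integral>\<^sup>+p. cap x p * cap y p \<partial>(\<sigma> \<Otimes>\<^sub>M height_measure)) = (\<integral>\<^sup>+u. \<integral>\<^sup>+t. cap x (u, t) * cap y (u, t) * indicator {-1..1} t \<partial>lborel \<partial>\<sigma>)"
    by (rule nn_integral_Caps) measurable
  also have "\<dots> = (\<integral>\<^sup>+u. ennreal (1 + min (x \<bullet> u) (y \<bullet> u)) \<partial>\<sigma>)"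
  proof (rule nn_integral_\<sigma>_cong)
    fix u :: "real^3" assume u: "norm u = 1"
    let ?m = "min (x \<bullet> u) (y \<bullet> u)"
    have m: "- 1 \<le> ?m" "?m \<le> 1" using inner_le[OF x u] inner_le[OF y u] by auto
    have "(\<integral>\<^sup>+t. cap x (u, t) * cap y (u, t) * indicator {-1..1} t \<partial>lborel) = (\<integral>\<^sup>+t. indicator {-1..?m} t \<partial>lborel)"
      using m by (intro nn_integral_cong) (auto simp: cap_def split: split_indicator)
    then show "(\<integral>\<^sup>+t. cap x (u, t) * cap y (u, t) * indicator {-1..1} t \<partial>lborel) = ennreal (1 + ?m)"
      using m by (simp add: add.commute)
  qed
  finally have L: "(\<integral>\<^sup>+p. cap x p * cap y p \<partial>(\<sigma> \<Otimes>\<^sub>M height_measure)) = (\<integral>\<^sup>+u. ennreal (1 + min (x \<bullet> u) (y \<bullet> u)) \<partial>\<sigma>)" .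
  have absint: "(\<integral>\<^sup>+u. ennreal (\<bar>u \<bullet> (x - y)\<bar> / 2) \<partial>\<sigma>) = ennreal (pi * norm (x - y))"
  proof (cases "x = y")
    case False
    let ?n = "norm (x - y)"
    have "(\<integral>\<^sup>+u. ennreal (\<bar>u \<bullet> (x - y)\<bar> / 2) \<partial>\<sigma>) = (\<integral>\<^sup>+t. ennreal (2 * pi) * indicator {-1..1} t * ennreal (\<bar>?n * t\<bar> / 2) \<partial>lborel)"
      by (rule nn_integral_\<sigma>_inner_scaled) (use False in auto)
    also have "\<dots> = (\<integral>\<^sup>+t. ennreal (pi * ?n * \<bar>t\<bar>) * indicator {-1..1} t \<partial>lborel)"
    proof (rule nn_integral_cong)
      fix t :: real
      have "ennreal (2 * pi) * ennreal (\<bar>?n * t\<bar> / 2) = ennreal (2 * pi * (\<bar>?n * t\<bar> / 2))"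
        by (rule ennreal_mult'[symmetric]) simp
      then show "ennreal (2 * pi) * indicator {-1..1} t * ennreal (\<bar>?n * t\<bar> / 2) = ennreal (pi * ?n * \<bar>t\<bar>) * indicator {-1..1} t"
        by (simp add: abs_mult ac_simps split: split_indicator)
    qed
    also have "\<dots> = (\<integral>\<^sup>+t. ennreal (pi * ?n * t) * indicator {0..1} t + ennreal (pi * ?n * - t) * indicator {-1..0} t \<partial>lborel)"
      by (intro nn_integral_cong) (auto split: split_indicator simp: abs_if)
    also have "\<dots> = (\<integral>\<^sup>+t. ennreal (pi * ?n * t) * indicator {0..1} t \<partial>lborel) + (\<integral>\<^sup>+t. ennreal (pi * ?n * - t) * indicator {-1..0} t \<partial>lborel)"
      by (rule nn_integral_add) measurable
    also have "(\<integral>\<^sup>+t. ennreal (pi * ?n * t) * indicator {0..1} t \<partial>lborel) = ennreal (pi * ?n * (1\<^sup>2 / 2) - pi * ?n * (0\<^sup>2 / 2))"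
      by (rule nn_integral_FTC_Icc) (auto intro!: derivative_eq_intros)
    also have "(\<integral>\<^sup>+t. ennreal (pi * ?n * - t) * indicator {-1..0} t \<partial>lborel) = ennreal (- (pi * ?n * (0\<^sup>2 / 2)) - - (pi * ?n * ((-1)\<^sup>2 / 2)))"
      by (rule nn_integral_FTC_Icc) (auto intro!: derivative_eq_intros mult_nonneg_nonpos)
    also have "ennreal (pi * ?n * (1\<^sup>2 / 2) - pi * ?n * (0\<^sup>2 / 2)) + ennreal (- (pi * ?n * (0\<^sup>2 / 2)) - - (pi * ?n * ((-1)\<^sup>2 / 2))) = ennreal (pi * ?n)"
      by (subst ennreal_plus[symmetric]) (auto simp: field_simps)
    finally show ?thesis .
  qed simp
  have linint: "(\<integral>\<^sup>+u. ennreal (1 + (u \<bullet> (x + y)) / 2) \<partial>\<sigma>) = ennreal (4 * pi)"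
  proof (cases "x + y = 0")
    case True
    then show ?thesis by (simp add: emeasure_\<sigma>_UNIV)
  next
    case False
    let ?n = "norm (x + y)"
    have n: "?n \<le> 2" using norm_triangle_ineq[of x y] x y by simp
    have "(\<integral>\<^sup>+u. ennreal (1 + (u \<bullet> (x + y)) / 2) \<partial>\<sigma>) = (\<integral>\<^sup>+t. ennreal (2 * pi) * indicator {-1..1} t * ennreal (1 + ?n * t / 2) \<partial>lborel)"
      by (rule nn_integral_\<sigma>_inner_scaled) (use False in auto)
    also have "\<dots> = (\<integral>\<^sup>+t. ennreal (2 * pi * (1 + ?n * t / 2)) * indicator {-1..1} t \<partial>lborel)"
    proof (rule nn_integral_cong)
      fix t :: real
      have "ennreal (2 * pi) * ennreal (1 + ?n * t / 2) = ennreal (2 * pi * (1 + ?n * t / 2))"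
        by (rule ennreal_mult'[symmetric]) simp
      then show "ennreal (2 * pi) * indicator {-1..1} t * ennreal (1 + ?n * t / 2) = ennreal (2 * pi * (1 + ?n * t / 2)) * indicator {-1..1} t"
        by (simp split: split_indicator)
    qed
    also have "\<dots> = ennreal (2 * pi * (1 + ?n * 1\<^sup>2 / 4) - 2 * pi * (- 1 + ?n * (- 1)\<^sup>2 / 4))"
    proof (rule nn_integral_FTC_Icc[where F = "\<lambda>t. 2 * pi * (t + ?n * t\<^sup>2 / 4)"])
      fix t :: real assume t: "t \<in> {-1..1}"
      show "((\<lambda>t. 2 * pi * (t + ?n * t\<^sup>2 / 4)) has_real_derivative 2 * pi * (1 + ?n * t / 2)) (at t)"
        by (auto intro!: derivative_eq_intros)
      have "\<bar>?n * t\<bar> \<le> 2 * 1" unfolding abs_mult using n t by (intro mult_mono) auto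
      then show "0 \<le> 2 * pi * (1 + ?n * t / 2)" by (intro mult_nonneg_nonneg) auto
    qed auto
    finally show ?thesis by (simp add: algebra_simps)
  qed
  have "(\<integral>\<^sup>+u. ennreal (1 + min (x \<bullet> u) (y \<bullet> u)) \<partial>\<sigma>) + (\<integral>\<^sup>+u. ennreal (\<bar>u \<bullet> (x - y)\<bar> / 2) \<partial>\<sigma>)
      = (\<integral>\<^sup>+u. ennreal (1 + min (x \<bullet> u) (y \<bullet> u)) + ennreal (\<bar>u \<bullet> (x - y)\<bar> / 2) \<partial>\<sigma>)"
    by (rule nn_integral_add[symmetric]) simp_all
  also have "\<dots> = (\<integral>\<^sup>+u. ennreal (1 + (u \<bullet> (x + y)) / 2) \<partial>\<sigma>)"
  proof (rule nn_integral_\<sigma>_cong)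
    fix u :: "real^3" assume u: "norm u = 1"
    have "0 \<le> 1 + min (x \<bullet> u) (y \<bullet> u)" using inner_le[OF x u] inner_le[OF y u] by auto
    moreover have "1 + min (x \<bullet> u) (y \<bullet> u) + \<bar>u \<bullet> (x - y)\<bar> / 2 = 1 + (u \<bullet> (x + y)) / 2"
      by (auto simp: inner_commute[of u] inner_simps min_def abs_if field_simps)
    ultimately show "ennreal (1 + min (x \<bullet> u) (y \<bullet> u)) + ennreal (\<bar>u \<bullet> (x - y)\<bar> / 2) = ennreal (1 + (u \<bullet> (x + y)) / 2)"
      by (metis ennreal_plus abs_ge_zero divide_nonneg_pos zero_less_numeral)
  qed
  finally show ?thesis unfolding L absint linint .
qed

definition cap_mass :: "(real^3 \<Rightarrow> real) \<Rightarrow> (real^3) \<times> real \<Rightarrow> ennreal" where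
  "cap_mass u p = (\<integral>\<^sup>+x. ennreal ((u x)\<^sup>2) * cap x p \<partial>\<sigma>)"

lemma measurable_cap_mass [measurable]:
  assumes [measurable]: "u \<in> borel_measurable borel"
  shows "cap_mass u \<in> borel_measurable (borel \<Otimes>\<^sub>M borel)"
  unfolding cap_mass_def[abs_def] by measurable

text \<open>
Integrate \<open>nn_integral_cap_cap\<close>, applied to \<open>x\<close> and \<open>- y\<close>, against \<open>u\<^sup>2 v\<^sup>2\<close>. The equation is
kept in additive form because it lives in the extended nonnegative reals.
\<close>
lemma cap_mass_chord_form:
  assumes [measurable]: "u \<in> borel_measurable borel" "v \<in> borel_measurable borel"
  shows "(\<integral>\<^sup>+p. cap_mass u p * cap_mass (\<lambda>y. v (- y)) p \<partial>(\<sigma> \<Otimes>\<^sub>M height_measure)) + ennreal pi * chord_form u v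
     = ennreal (4 * pi) * ((\<integral>\<^sup>+x. ennreal ((u x)\<^sup>2) \<partial>\<sigma>) * (\<integral>\<^sup>+x. ennreal ((v x)\<^sup>2) \<partial>\<sigma>))"
proof -
  let ?w = "\<lambda>x y. ennreal ((u x)\<^sup>2) * ennreal ((v y)\<^sup>2)"
  let ?v = "\<lambda>y. v (- y)"
  have "(\<integral>\<^sup>+p. cap_mass u p * cap_mass ?v p \<partial>(\<sigma> \<Otimes>\<^sub>M height_measure))
      = (\<integral>\<^sup>+p. \<integral>\<^sup>+x. \<integral>\<^sup>+y. ?w x y * (cap x p * cap (- y) p) \<partial>\<sigma> \<partial>\<sigma> \<partial>(\<sigma> \<Otimes>\<^sub>M height_measure))"
  proof (rule nn_integral_cong)
    fix p :: "(real^3) \<times> real"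
    have [simp]: "p \<in> space (borel \<Otimes>\<^sub>M borel)" by (simp add: space_pair_measure)
    have "cap_mass ?v p = (\<integral>\<^sup>+y. ennreal ((v (- (- y)))\<^sup>2) * cap (- y) p \<partial>\<sigma>)"
      unfolding cap_mass_def by (rule nn_integral_\<sigma>_uminus[symmetric]) measurable
    then have "cap_mass u p * cap_mass ?v p = (\<integral>\<^sup>+x. ennreal ((u x)\<^sup>2) * cap x p * (\<integral>\<^sup>+y. ennreal ((v y)\<^sup>2) * cap (- y) p \<partial>\<sigma>) \<partial>\<sigma>)"
      unfolding cap_mass_def by (subst nn_integral_multc) simp_all
    also have "\<dots> = (\<integral>\<^sup>+x. \<integral>\<^sup>+y. ?w x y * (cap x p * cap (- y) p) \<partial>\<sigma> \<partial>\<sigma>)"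
      by (simp add: nn_integral_cmult[symmetric] ac_simps)
    finally show "cap_mass u p * cap_mass ?v p = (\<integral>\<^sup>+x. \<integral>\<^sup>+y. ?w x y * (cap x p * cap (- y) p) \<partial>\<sigma> \<partial>\<sigma>)" .
  qed
  also have "\<dots> = (\<integral>\<^sup>+x. \<integral>\<^sup>+p. \<integral>\<^sup>+y. ?w x y * (cap x p * cap (- y) p) \<partial>\<sigma> \<partial>(\<sigma> \<Otimes>\<^sub>M height_measure) \<partial>\<sigma>)"
    by (rule \<sigma>Caps.Fubini') measurable
  also have "\<dots> = (\<integral>\<^sup>+x. \<integral>\<^sup>+y. \<integral>\<^sup>+p. ?w x y * (cap x p * cap (- y) p) \<partial>(\<sigma> \<Otimes>\<^sub>M height_measure) \<partial>\<sigma> \<partial>\<sigma>)"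
    by (rule nn_integral_cong, rule \<sigma>Caps.Fubini') measurable
  also have "\<dots> = (\<integral>\<^sup>+x. \<integral>\<^sup>+y. ?w x y * (\<integral>\<^sup>+p. cap x p * cap (- y) p \<partial>(\<sigma> \<Otimes>\<^sub>M height_measure)) \<partial>\<sigma> \<partial>\<sigma>)"
    by (simp add: nn_integral_cmult)
  finally have caps: "(\<integral>\<^sup>+p. cap_mass u p * cap_mass ?v p \<partial>(\<sigma> \<Otimes>\<^sub>M height_measure))
      = (\<integral>\<^sup>+x. \<integral>\<^sup>+y. ?w x y * (\<integral>\<^sup>+p. cap x p * cap (- y) p \<partial>(\<sigma> \<Otimes>\<^sub>M height_measure)) \<partial>\<sigma> \<partial>\<sigma>)" .
  have dipole: "ennreal pi * chord_form u v = (\<integral>\<^sup>+x. \<integral>\<^sup>+y. ?w x y * ennreal (pi * norm (x - - y)) \<partial>\<sigma> \<partial>\<sigma>)"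
  proof -
    have "ennreal pi * chord_form u v = (\<integral>\<^sup>+x. \<integral>\<^sup>+y. ennreal pi * ennreal ((u x)\<^sup>2 * (v y)\<^sup>2 * norm (x + y)) \<partial>\<sigma> \<partial>\<sigma>)"
      unfolding chord_form_def by (simp add: nn_integral_cmult)
    also have "\<dots> = (\<integral>\<^sup>+x. \<integral>\<^sup>+y. ?w x y * ennreal (pi * norm (x - - y)) \<partial>\<sigma> \<partial>\<sigma>)"
      by (intro nn_integral_cong) (simp add: ennreal_mult ac_simps)
    finally show ?thesis .
  qed
  have [measurable]: "(\<lambda>(x, y). \<integral>\<^sup>+p. cap x p * cap (- y) p \<partial>(\<sigma> \<Otimes>\<^sub>M height_measure)) \<in> borel_measurable (borel \<Otimes>\<^sub>M borel)"
    by measurable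
  have "(\<integral>\<^sup>+p. cap_mass u p * cap_mass ?v p \<partial>(\<sigma> \<Otimes>\<^sub>M height_measure)) + ennreal pi * chord_form u v
      = (\<integral>\<^sup>+x. \<integral>\<^sup>+y. ?w x y * (\<integral>\<^sup>+p. cap x p * cap (- y) p \<partial>(\<sigma> \<Otimes>\<^sub>M height_measure)) + ?w x y * ennreal (pi * norm (x - - y)) \<partial>\<sigma> \<partial>\<sigma>)"
    unfolding caps dipole by (simp add: nn_integral_add)
  also have "\<dots> = (\<integral>\<^sup>+x. \<integral>\<^sup>+y. ?w x y * ennreal (4 * pi) \<partial>\<sigma> \<partial>\<sigma>)"
    unfolding distrib_left[symmetric]
    by (rule nn_integral_\<sigma>_cong, rule nn_integral_\<sigma>_cong, subst nn_integral_cap_cap) simp_all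
  also have "\<dots> = ennreal (4 * pi) * ((\<integral>\<^sup>+x. ennreal ((u x)\<^sup>2) \<partial>\<sigma>) * (\<integral>\<^sup>+x. ennreal ((v x)\<^sup>2) \<partial>\<sigma>))"
    by (simp add: nn_integral_cmult nn_integral_multc ac_simps)
  finally show ?thesis .
qed

lemma chord_form_reflect:
  assumes [measurable]: "u \<in> borel_measurable borel" "v \<in> borel_measurable borel"
  shows "chord_form (\<lambda>x. u (- x)) (\<lambda>y. v (- y)) = chord_form u v"
proof -
  have T: "orthogonal_transformation (uminus :: real^3 \<Rightarrow> real^3)"
    by (simp add: orthogonal_transformation_def linear_iff)
  have "norm (x + y) = norm (- x + - y)" for x y :: "real^3"
    by (metis minus_add_distrib norm_minus_cancel)
  then have "chord_form (\<lambda>x. u (- x)) (\<lambda>y. v (- y))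
      = (\<integral>\<^sup>+x. \<integral>\<^sup>+y. ennreal ((u (- x))\<^sup>2 * (v (- y))\<^sup>2 * norm (- x + - y)) \<partial>\<sigma> \<partial>\<sigma>)"
    unfolding chord_form_def by simp
  also have "\<dots> = chord_form u v"
    unfolding chord_form_def by (rule nn_integral_\<sigma>\<sigma>_orthogonal[OF T]) measurable
  finally show ?thesis .
qed

lemma nn_integral_cap_weight:
  fixes x :: "real^3"
  assumes x: "norm x = 1"
  shows "(\<integral>\<^sup>+p. ennreal (1 - snd p) * cap x p \<partial>(\<sigma> \<Otimes>\<^sub>M height_measure)) = ennreal (16 * pi / 3)"
proof -
  have "(\<integral>\<^sup>+p. ennreal (1 - snd p) * cap x p \<partial>(\<sigma> \<Otimes>\<^sub>M height_measure))
      = (\<integral>\<^sup>+u. \<integral>\<^sup>+t. ennreal (1 - snd (u, t)) * cap x (u, t) * indicator {-1..1} t \<partial>lborel \<partial>\<sigma>)"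
    by (rule nn_integral_Caps) measurable
  also have "\<dots> = (\<integral>\<^sup>+u. ennreal (2 - (1 - u \<bullet> x)\<^sup>2 / 2) \<partial>\<sigma>)"
  proof (rule nn_integral_\<sigma>_cong)
    fix u :: "real^3" assume u: "norm u = 1"
    have b: "-1 \<le> u \<bullet> x" "u \<bullet> x \<le> 1" using Cauchy_Schwarz_ineq2[of u x] u x by auto
    have "(\<integral>\<^sup>+t. ennreal (1 - snd (u, t)) * cap x (u, t) * indicator {-1..1} t \<partial>lborel)
        = (\<integral>\<^sup>+t. ennreal (1 - t) * indicator {-1..u \<bullet> x} t \<partial>lborel)"
      using b by (intro nn_integral_cong) (auto simp: cap_def inner_commute split: split_indicator)
    also have "\<dots> = ennreal (- (1 - u \<bullet> x)\<^sup>2 / 2 - - (1 - (- 1))\<^sup>2 / 2)"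
      by (rule nn_integral_FTC_Icc) (use b in \<open>auto intro!: derivative_eq_intros simp: field_simps\<close>)
    also have "- (1 - u \<bullet> x)\<^sup>2 / 2 - - (1 - (- 1))\<^sup>2 / 2 = 2 - (1 - u \<bullet> x)\<^sup>2 / 2" by simp
    finally show "(\<integral>\<^sup>+t. ennreal (1 - snd (u, t)) * cap x (u, t) * indicator {-1..1} t \<partial>lborel) = ennreal (2 - (1 - u \<bullet> x)\<^sup>2 / 2)" .
  qed
  also have "\<dots> = (\<integral>\<^sup>+t. ennreal (2 * pi) * indicator {-1..1} t * ennreal (2 - (1 - t)\<^sup>2 / 2) \<partial>lborel)"
    by (rule nn_integral_\<sigma>_inner) (simp_all add: x)
  also have "\<dots> = (\<integral>\<^sup>+t. ennreal (2 * pi) * (ennreal (2 - (1 - t)\<^sup>2 / 2) * indicator {-1..1} t) \<partial>lborel)"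
    by (simp only: ac_simps)
  also have "\<dots> = ennreal (2 * pi) * (\<integral>\<^sup>+t. ennreal (2 - (1 - t)\<^sup>2 / 2) * indicator {-1..1} t \<partial>lborel)"
    by (rule nn_integral_cmult) measurable
  also have "(\<integral>\<^sup>+t. ennreal (2 - (1 - t)\<^sup>2 / 2) * indicator {-1..1} t \<partial>lborel)
      = ennreal (2 * 1 + (1 - 1) ^ 3 / 6 - (2 * (- 1) + (1 - (- 1)) ^ 3 / 6))"
  proof (rule nn_integral_FTC_Icc[where F = "\<lambda>t. 2 * t + (1 - t) ^ 3 / 6"])
    fix t :: real assume t: "t \<in> {-1..1}"
    show "((\<lambda>t. 2 * t + (1 - t) ^ 3 / 6) has_real_derivative 2 - (1 - t)\<^sup>2 / 2) (at t)"
      by (auto intro!: derivative_eq_intros)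
    have "(1 - t)\<^sup>2 \<le> 2\<^sup>2" using t by (intro power_mono) auto
    then show "0 \<le> 2 - (1 - t)\<^sup>2 / 2" by simp
  qed auto
  also have "ennreal (2 * pi) * \<dots> = ennreal (2 * pi * (8 / 3))"
    by (subst ennreal_mult') simp_all
  finally show ?thesis by simp
qed

lemma nn_integral_Caps_weight:
  "(\<integral>\<^sup>+p. ennreal ((1 - snd p)\<^sup>2) \<partial>(\<sigma> \<Otimes>\<^sub>M height_measure)) = ennreal (32 * pi / 3)"
proof -
  have "(\<integral>\<^sup>+p. ennreal ((1 - snd p)\<^sup>2) \<partial>(\<sigma> \<Otimes>\<^sub>M height_measure))
      = (\<integral>\<^sup>+u. \<integral>\<^sup>+t. ennreal ((1 - snd (u, t))\<^sup>2) * indicator {-1..1} t \<partial>lborel \<partial>\<sigma>)"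
    by (rule nn_integral_Caps) measurable
  also have "\<dots> = (\<integral>\<^sup>+u. ennreal (8 / 3) \<partial>\<sigma>)"
  proof (rule nn_integral_cong)
    fix u :: "real^3"
    have "(\<integral>\<^sup>+t. ennreal ((1 - t)\<^sup>2) * indicator {-1..1} t \<partial>lborel) = ennreal (- ((1 - 1) ^ 3 / 3) - - ((1 - (- 1)) ^ 3 / 3))"
      by (rule nn_integral_FTC_Icc[where F = "\<lambda>t. - ((1 - t) ^ 3 / 3)"]) (auto intro!: derivative_eq_intros)
    then show "(\<integral>\<^sup>+t. ennreal ((1 - snd (u, t))\<^sup>2) * indicator {-1..1} t \<partial>lborel) = ennreal (8 / 3)" by simp
  qed
  also have "\<dots> = ennreal (8 / 3 * (4 * pi))"
    by (subst ennreal_mult) (simp_all add: emeasure_\<sigma>_UNIV)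
  finally show ?thesis by simp
qed

text \<open>
Let \<open>A\<close> and \<open>B\<close> be the masses that \<open>f\<^sup>2\<close> and its reflection assign to caps, and \<open>C\<close> the mass
assigned by the constant function with the same integral \<open>s\<close>, that is \<open>C (u, t) = s (1 - t) / 2\<close>.
By \<open>cap_mass_chord_form\<close> the claim is a lower bound for the integral of \<open>A\<^sup>2 + B\<^sup>2 + A B\<close>. As this
quadratic form is positive definite, it lies above its tangent at \<open>(C, C)\<close>, which is
\<open>3 C (A + B) - 3 C\<^sup>2\<close>. The integrals of \<open>C A\<close>, \<open>C B\<close> and \<open>C\<^sup>2\<close> agree, because by rotation
invariance the caps through a point, weighted by \<open>C\<close>, have the same total for all points.
\<close>
lemma chord_form_bound:
  assumes [measurable]: "f \<in> borel_measurable borel"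
    and S: "(\<integral>\<^sup>+x. ennreal ((f x)\<^sup>2) \<partial>\<sigma>) = ennreal s" and s: "0 \<le> s"
  shows "chord_form f f + 2 * chord_form f (\<lambda>x. f (- x)) \<le> ennreal (4 * s\<^sup>2)"
proof -
  let ?P = "\<sigma> \<Otimes>\<^sub>M height_measure" and ?r = "\<lambda>x. f (- x)"
  let ?A = "cap_mass f" and ?B = "cap_mass ?r"
  let ?C = "\<lambda>p :: (real^3) \<times> real. ennreal (s / 2) * ennreal (1 - snd p)"
  have [measurable]: "?r \<in> borel_measurable borel" by measurable
  have Sr: "(\<integral>\<^sup>+x. ennreal ((?r x)\<^sup>2) \<partial>\<sigma>) = ennreal s"
    using nn_integral_\<sigma>_uminus[of "\<lambda>x. ennreal ((f x)\<^sup>2)"] S by simp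
  have e1: "(\<integral>\<^sup>+p. ?A p * ?B p \<partial>?P) + ennreal pi * chord_form f f = ennreal (4 * pi) * (ennreal s * ennreal s)"
    using cap_mass_chord_form[of f f] by (simp add: S)
  have e2: "(\<integral>\<^sup>+p. ?A p * ?A p \<partial>?P) + ennreal pi * chord_form f ?r = ennreal (4 * pi) * (ennreal s * ennreal s)"
    using cap_mass_chord_form[of f ?r] by (simp add: S Sr)
  have "chord_form ?r f = chord_form f ?r"
    using chord_form_reflect[of f ?r] by simp
  then have e3: "(\<integral>\<^sup>+p. ?B p * ?B p \<partial>?P) + ennreal pi * chord_form f ?r = ennreal (4 * pi) * (ennreal s * ennreal s)"
    using cap_mass_chord_form[of ?r f] by (simp add: S Sr)
  have CA: "(\<integral>\<^sup>+p. ?C p * cap_mass g p \<partial>?P) = ennreal (8 * pi / 3 * s\<^sup>2)"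
    if [measurable]: "g \<in> borel_measurable borel" and g: "(\<integral>\<^sup>+x. ennreal ((g x)\<^sup>2) \<partial>\<sigma>) = ennreal s" for g
  proof -
    have "(\<integral>\<^sup>+p. ?C p * cap_mass g p \<partial>?P)
        = (\<integral>\<^sup>+p. \<integral>\<^sup>+x. ennreal (s / 2) * ennreal ((g x)\<^sup>2) * (ennreal (1 - snd p) * cap x p) \<partial>\<sigma> \<partial>?P)"
    proof (rule nn_integral_cong)
      fix p :: "(real^3) \<times> real"
      have [simp]: "p \<in> space (borel \<Otimes>\<^sub>M borel)" by (simp add: space_pair_measure)
      show "?C p * cap_mass g p = (\<integral>\<^sup>+x. ennreal (s / 2) * ennreal ((g x)\<^sup>2) * (ennreal (1 - snd p) * cap x p) \<partial>\<sigma>)"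
        unfolding cap_mass_def by (subst nn_integral_cmult[symmetric]) (simp_all add: ac_simps)
    qed
    also have "\<dots> = (\<integral>\<^sup>+x. \<integral>\<^sup>+p. ennreal (s / 2) * ennreal ((g x)\<^sup>2) * (ennreal (1 - snd p) * cap x p) \<partial>?P \<partial>\<sigma>)"
      by (rule \<sigma>Caps.Fubini') measurable
    also have "\<dots> = (\<integral>\<^sup>+x. ennreal (s / 2) * ennreal ((g x)\<^sup>2) * (\<integral>\<^sup>+p. ennreal (1 - snd p) * cap x p \<partial>?P) \<partial>\<sigma>)"
      by (simp add: nn_integral_cmult)
    also have "\<dots> = (\<integral>\<^sup>+x. ennreal (s / 2) * ennreal ((g x)\<^sup>2) * ennreal (16 * pi / 3) \<partial>\<sigma>)"
      by (rule nn_integral_\<sigma>_cong) (simp only: nn_integral_cap_weight)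
    also have "\<dots> = ennreal (s / 2) * ennreal s * ennreal (16 * pi / 3)"
      by (simp add: nn_integral_cmult nn_integral_multc g)
    also have "\<dots> = ennreal (s / 2 * s * (16 * pi / 3))"
      using s by (simp only: ennreal_mult'[symmetric] ennreal_mult''[symmetric] mult_nonneg_nonneg divide_nonneg_pos zero_less_numeral)
    finally show ?thesis by (simp add: power2_eq_square mult.commute)
  qed
  have CC: "(\<integral>\<^sup>+p. ?C p * ?C p \<partial>?P) = ennreal (8 * pi / 3 * s\<^sup>2)"
  proof -
    have "(\<integral>\<^sup>+p. ?C p * ?C p \<partial>?P) = (\<integral>\<^sup>+p. ennreal (s / 2) * ennreal (s / 2) * ennreal ((1 - snd p)\<^sup>2) \<partial>?P)"
    proof (rule nn_integral_cong_AE)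
      have "AE t in height_measure. - 1 \<le> t \<and> t \<le> 1"
        unfolding height_measure_def by (subst AE_density) (auto split: split_indicator)
      then have t: "AE t in height_measure. t \<le> 1" by (auto elim: eventually_mono)
      have "AE p in ?P. snd p \<le> 1"
      proof (rule Caps.AE_pair_measure)
        show "{p \<in> space ?P. snd p \<le> 1} \<in> sets ?P" by measurable
        show "AE u in \<sigma>. AE t in height_measure. snd (u, t) \<le> 1" using t by simp
      qed
      then show "AE p in ?P. ?C p * ?C p = ennreal (s / 2) * ennreal (s / 2) * ennreal ((1 - snd p)\<^sup>2)"
        by eventually_elim (simp add: power2_eq_square ennreal_mult ac_simps)
    qed
    also have "\<dots> = ennreal (s / 2) * ennreal (s / 2) * ennreal (32 * pi / 3)"
      by (subst nn_integral_cmult) (simp_all add: nn_integral_Caps_weight)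
    also have "\<dots> = ennreal (s / 2 * (s / 2) * (32 * pi / 3))"
      using s by (simp only: ennreal_mult'[symmetric] ennreal_mult''[symmetric] mult_nonneg_nonneg divide_nonneg_pos zero_less_numeral)
    finally show ?thesis by (simp add: power2_eq_square mult.commute)
  qed
  have fin: "cap_mass g p < \<top>" if "(\<integral>\<^sup>+x. ennreal ((g x)\<^sup>2) \<partial>\<sigma>) = ennreal s" for g p
  proof -
    have "cap_mass g p \<le> (\<integral>\<^sup>+x. ennreal ((g x)\<^sup>2) \<partial>\<sigma>)"
      unfolding cap_mass_def by (intro nn_integral_mono) (simp add: cap_def)
    then show ?thesis by (simp add: that order_le_less_trans)
  qed
  have quad: "3 * (?C p * ?A p) + 3 * (?C p * ?B p) \<le> ?A p * ?A p + ?B p * ?B p + ?A p * ?B p + 3 * (?C p * ?C p)" for p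
  proof -
    obtain a where a: "?A p = ennreal a" "0 \<le> a" using fin[OF S, of p] by (cases "?A p") auto
    obtain b where b: "?B p = ennreal b" "0 \<le> b" using fin[OF Sr, of p] by (cases "?B p") auto
    obtain c where c: "?C p = ennreal c" "0 \<le> c" by (cases "?C p") (auto simp: ennreal_mult_eq_top_iff)
    \<comment> \<open>Twice the quadratic form \<open>x\<^sup>2 + y\<^sup>2 + x y\<close> at \<open>x = a - c\<close>, \<open>y = b - c\<close>.\<close>
    have "0 \<le> ((a - c) + (b - c))\<^sup>2 + (a - c)\<^sup>2 + (b - c)\<^sup>2" by simp
    then have "3 * (c * a) + 3 * (c * b) \<le> a * a + b * b + a * b + 3 * (c * c)"
      by (simp add: power2_eq_square algebra_simps)
    then have "ennreal (3 * (c * a) + 3 * (c * b)) \<le> ennreal (a * a + b * b + a * b + 3 * (c * c))"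
      by (rule ennreal_leI)
    then show ?thesis using a b c by (simp add: ennreal_mult ennreal_plus)
  qed
  define Y where "Y = (\<integral>\<^sup>+p. ?A p * ?A p \<partial>?P) + (\<integral>\<^sup>+p. ?B p * ?B p \<partial>?P) + (\<integral>\<^sup>+p. ?A p * ?B p \<partial>?P)"
  define X where "X = chord_form f f + 2 * chord_form f ?r"
  have "(\<integral>\<^sup>+p. 3 * (?C p * ?A p) + 3 * (?C p * ?B p) \<partial>?P)
      \<le> (\<integral>\<^sup>+p. ?A p * ?A p + ?B p * ?B p + ?A p * ?B p + 3 * (?C p * ?C p) \<partial>?P)"
    by (intro nn_integral_mono quad)
  also have "(\<integral>\<^sup>+p. 3 * (?C p * ?A p) + 3 * (?C p * ?B p) \<partial>?P)
      = 3 * (\<integral>\<^sup>+p. ?C p * ?A p \<partial>?P) + 3 * (\<integral>\<^sup>+p. ?C p * ?B p \<partial>?P)"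
    by (subst nn_integral_add, measurable, subst nn_integral_cmult, measurable, subst nn_integral_cmult) measurable
  also have "(\<integral>\<^sup>+p. ?A p * ?A p + ?B p * ?B p + ?A p * ?B p + 3 * (?C p * ?C p) \<partial>?P)
      = Y + 3 * (\<integral>\<^sup>+p. ?C p * ?C p \<partial>?P)"
    unfolding Y_def
    by (subst nn_integral_add, measurable, subst nn_integral_add, measurable, subst nn_integral_add, measurable,
        subst nn_integral_cmult) measurable
  finally have Yge: "3 * ennreal (8 * pi / 3 * s\<^sup>2) + 3 * ennreal (8 * pi / 3 * s\<^sup>2) \<le> Y + 3 * ennreal (8 * pi / 3 * s\<^sup>2)"
    by (simp only: CA[OF _ S] CA[OF _ Sr] CC assms(1) \<open>?r \<in> borel_measurable borel\<close>)
  have YX: "Y + ennreal pi * X = ennreal (12 * pi * s\<^sup>2)"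
  proof -
    have "Y + ennreal pi * X = ((\<integral>\<^sup>+p. ?A p * ?B p \<partial>?P) + ennreal pi * chord_form f f)
        + ((\<integral>\<^sup>+p. ?A p * ?A p \<partial>?P) + ennreal pi * chord_form f ?r) + ((\<integral>\<^sup>+p. ?B p * ?B p \<partial>?P) + ennreal pi * chord_form f ?r)"
      by (simp add: Y_def X_def mult_2 distrib_left add_ac)
    also have "\<dots> = ennreal (4 * pi * (s * s)) + ennreal (4 * pi * (s * s)) + ennreal (4 * pi * (s * s))"
      unfolding e1 e2 e3 using s by (simp add: ennreal_mult)
    also have "\<dots> = ennreal (12 * pi * s\<^sup>2)"
      using s by (simp add: ennreal_plus[symmetric] power2_eq_square del: ennreal_plus)
    finally show ?thesis .
  qed
  have Yfin: "Y < \<top>" and Xfin: "ennreal pi * X < \<top>"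
    using YX by (auto simp: less_top[symmetric] intro: ccontr)
  obtain y where y: "Y = ennreal y" "0 \<le> y" using Yfin by (cases Y) auto
  obtain x where x: "X = ennreal x" "0 \<le> x" using Xfin by (cases X) (auto simp: ennreal_mult_top)
  have "ennreal (8 * pi * s\<^sup>2 + 8 * pi * s\<^sup>2) \<le> ennreal (y + 8 * pi * s\<^sup>2)"
  proof -
    have "3 * ennreal (8 * pi / 3 * s\<^sup>2) = ennreal (3 * (8 * pi / 3 * s\<^sup>2))" by (subst ennreal_mult') simp_all
    then have three: "3 * ennreal (8 * pi / 3 * s\<^sup>2) = ennreal (8 * pi * s\<^sup>2)" by simp
    show ?thesis using Yge y unfolding three by (subst (1 2) ennreal_plus) auto
  qed
  then have y1: "8 * pi * s\<^sup>2 \<le> y" using y by (subst (asm) ennreal_le_iff) auto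
  have y2: "y + pi * x = 12 * pi * s\<^sup>2"
  proof -
    have "ennreal (y + pi * x) = ennreal (12 * pi * s\<^sup>2)" using YX x y by (simp add: ennreal_mult ennreal_plus)
    then show ?thesis using x y by (subst (asm) ennreal_inj) auto
  qed
  define q where "q = pi * s\<^sup>2"
  have "8 * q \<le> y" "y + pi * x = 12 * q" using y1 y2 by (simp_all add: q_def mult.assoc)
  then have "pi * x \<le> 4 * q" by linarith
  then have "x \<le> 4 * s\<^sup>2" by (simp add: q_def mult.left_commute)
  then show ?thesis using x by (simp add: X_def[symmetric] ennreal_leI)
qed

section \<open>Quadruple integrals against a Gaussian\<close>

text \<open>
The weight \<open>|y + z|\<close> cancels the singularity \<open>1 / |x|\<close> of \<open>\<sigma> * \<sigma>\<close>. The bound by the constant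
\<open>2 \<pi>\<close> holds for every \<open>\<tau>\<close>, and the factor \<open>norm x\<close> takes care of \<open>x = 0\<close>.
\<close>
lemma nn_integral_convolution_gauss_le:
  fixes x :: "real^3"
  assumes \<tau>: "0 < \<tau>"
  shows "ennreal (norm x) * (\<integral>\<^sup>+y. \<integral>\<^sup>+z. ennreal (norm (y + z) * gauss \<tau> (x + y + z)) \<partial>\<sigma> \<partial>\<sigma>) \<le> ennreal (2 * pi * norm x)"
proof (cases "x = 0")
  case False
  then have \<rho>: "0 < norm x" by simp
  have "(\<integral>\<^sup>+y. \<integral>\<^sup>+z. ennreal (norm (y + z) * gauss \<tau> (x + y + z)) \<partial>\<sigma> \<partial>\<sigma>)
      = (\<integral>\<^sup>+y. \<integral>\<^sup>+z. ennreal (\<bar>norm (y + z)\<bar> * gauss \<tau> (x + y + z)) \<partial>\<sigma> \<partial>\<sigma>)" by simp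
  also have "\<dots> = ennreal (2 * pi) * (\<integral>\<^sup>+r. ennreal (\<bar>r\<bar> * dipole \<tau> (norm x) r / norm x) * indicator {0..2} r \<partial>lborel)"
    by (rule nn_integral_\<sigma>\<sigma>_gauss) (simp_all add: \<tau> False)
  finally have "ennreal (norm x) * (\<integral>\<^sup>+y. \<integral>\<^sup>+z. ennreal (norm (y + z) * gauss \<tau> (x + y + z)) \<partial>\<sigma> \<partial>\<sigma>)
      = ennreal (2 * pi) * (ennreal (norm x) * (\<integral>\<^sup>+r. ennreal (\<bar>r\<bar> * dipole \<tau> (norm x) r / norm x) * indicator {0..2} r \<partial>lborel))"
    by (simp only: ac_simps)
  also have "ennreal (norm x) * (\<integral>\<^sup>+r. ennreal (\<bar>r\<bar> * dipole \<tau> (norm x) r / norm x) * indicator {0..2} r \<partial>lborel)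
      = (\<integral>\<^sup>+r. ennreal (r * dipole \<tau> (norm x) r) * indicator {0..2} r \<partial>lborel)"
    using False by (subst nn_integral_cmult[symmetric])
      (auto intro!: nn_integral_cong simp: ennreal_mult'[symmetric] split: split_indicator)
  also have "\<dots> \<le> ennreal (norm x)" by (rule nn_integral_dipole_mean[OF \<tau> \<rho>])
  also have "ennreal (2 * pi) * ennreal (norm x) = ennreal (2 * pi * norm x)" by (rule ennreal_mult'[symmetric]) simp
  finally show ?thesis by (simp add: mult_left_mono)
qed simp

definition quad_integral :: "(real^3 \<Rightarrow> real^3 \<Rightarrow> real^3 \<Rightarrow> real^3 \<Rightarrow> ennreal) \<Rightarrow> ennreal" where
  "quad_integral F = (\<integral>\<^sup>+a. \<integral>\<^sup>+b. \<integral>\<^sup>+c. \<integral>\<^sup>+d. F a b c d \<partial>\<sigma> \<partial>\<sigma> \<partial>\<sigma> \<partial>\<sigma>)"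

text \<open>
Measurability of a curried function of four variables, as a predicate that the exchange rules
below can carry from one ordering of the variables to another.
\<close>
definition quad_measurable :: "(real^3 \<Rightarrow> real^3 \<Rightarrow> real^3 \<Rightarrow> real^3 \<Rightarrow> ennreal) \<Rightarrow> bool" where
  "quad_measurable F \<longleftrightarrow> (\<lambda>(a, b, c, d). F a b c d) \<in> borel_measurable (borel \<Otimes>\<^sub>M borel \<Otimes>\<^sub>M borel \<Otimes>\<^sub>M borel)"

lemma quad_measurableD:
  assumes "quad_measurable F" and "a \<in> M \<rightarrow>\<^sub>M borel" "b \<in> M \<rightarrow>\<^sub>M borel" "c \<in> M \<rightarrow>\<^sub>M borel" "d \<in> M \<rightarrow>\<^sub>M borel"
  shows "(\<lambda>x. F (a x) (b x) (c x) (d x)) \<in> borel_measurable M"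
  using measurable_compose[OF measurable_Pair[OF assms(2) measurable_Pair[OF assms(3) measurable_Pair[OF assms(4,5)]]]
      assms(1)[unfolded quad_measurable_def]]
  by simp

lemma quad_integral_swap12: assumes F: "quad_measurable F" shows "quad_integral F = quad_integral (\<lambda>a b c d. F b a c d)"
proof -
  note [measurable] = quad_measurableD[OF F]
  show ?thesis unfolding quad_integral_def by (rule \<sigma>\<sigma>.Fubini') measurable
qed

lemma quad_integral_swap23: assumes F: "quad_measurable F" shows "quad_integral F = quad_integral (\<lambda>a b c d. F a c b d)"
proof -
  note [measurable] = quad_measurableD[OF F]
  show ?thesis unfolding quad_integral_def by (rule nn_integral_cong, rule \<sigma>\<sigma>.Fubini') measurable
qed

lemma quad_integral_swap34: assumes F: "quad_measurable F" shows "quad_integral F = quad_integral (\<lambda>a b c d. F a b d c)"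
proof -
  note [measurable] = quad_measurableD[OF F]
  show ?thesis unfolding quad_integral_def by (rule nn_integral_cong, rule nn_integral_cong, rule \<sigma>\<sigma>.Fubini') measurable
qed

lemma quad_integral_swap_pairs: assumes F: "quad_measurable F" shows "quad_integral F = quad_integral (\<lambda>a b c d. F c d a b)"
proof -
  note [measurable] = quad_measurableD[OF F]
  have "quad_integral F = quad_integral (\<lambda>a b c d. F a c b d)" by (rule quad_integral_swap23[OF F])
  also have "\<dots> = quad_integral (\<lambda>a b c d. F b c a d)" by (rule quad_integral_swap12) (simp add: quad_measurable_def split_beta')
  also have "\<dots> = quad_integral (\<lambda>a b c d. F b d a c)" by (rule quad_integral_swap34) (simp add: quad_measurable_def split_beta')
  also have "\<dots> = quad_integral (\<lambda>a b c d. F c d a b)" by (rule quad_integral_swap23) (simp add: quad_measurable_def split_beta')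
  finally show ?thesis .
qed

lemma quad_integral_swap24: assumes F: "quad_measurable F" shows "quad_integral F = quad_integral (\<lambda>a b c d. F a d c b)"
proof -
  note [measurable] = quad_measurableD[OF F]
  have "quad_integral F = quad_integral (\<lambda>a b c d. F a c b d)" by (rule quad_integral_swap23[OF F])
  also have "\<dots> = quad_integral (\<lambda>a b c d. F a d b c)" by (rule quad_integral_swap34) (simp add: quad_measurable_def split_beta')
  also have "\<dots> = quad_integral (\<lambda>a b c d. F a d c b)" by (rule quad_integral_swap23) (simp add: quad_measurable_def split_beta')
  finally show ?thesis .
qed

lemma quad_integral_add: assumes F: "quad_measurable F" and G: "quad_measurable G" shows "quad_integral (\<lambda>a b c d. F a b c d + G a b c d) = quad_integral F + quad_integral G"
proof -
  note [measurable] = quad_measurableD[OF F] quad_measurableD[OF G]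
  show ?thesis unfolding quad_integral_def by (simp add: nn_integral_add)
qed

lemma quad_integral_cmult: assumes F: "quad_measurable F" shows "quad_integral (\<lambda>a b c d. k * F a b c d) = k * quad_integral F"
proof -
  note [measurable] = quad_measurableD[OF F]
  show ?thesis unfolding quad_integral_def by (simp add: nn_integral_cmult)
qed

lemma quad_integral_mono:
  assumes "\<And>a b c d. norm a = 1 \<Longrightarrow> norm b = 1 \<Longrightarrow> norm c = 1 \<Longrightarrow> norm d = 1 \<Longrightarrow> F a b c d \<le> G a b c d"
  shows "quad_integral F \<le> quad_integral G"
  unfolding quad_integral_def by (intro nn_integral_\<sigma>_mono assms)

lemma quad_integral_half_pairing:
  assumes [measurable]: "u \<in> borel_measurable borel" "v \<in> borel_measurable borel" and \<tau>: "0 < \<tau>"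
  shows "quad_integral (\<lambda>a b c d. ennreal ((u a)\<^sup>2 * (v b)\<^sup>2 * (norm (a + b) * norm (c + d) * gauss \<tau> (a + b + c + d))))
     \<le> ennreal (2 * pi) * chord_form u v"
proof -
  have "quad_integral (\<lambda>a b c d. ennreal ((u a)\<^sup>2 * (v b)\<^sup>2 * (norm (a + b) * norm (c + d) * gauss \<tau> (a + b + c + d))))
     = (\<integral>\<^sup>+a. \<integral>\<^sup>+b. ennreal ((u a)\<^sup>2 * (v b)\<^sup>2) * (ennreal (norm (a + b)) * (\<integral>\<^sup>+c. \<integral>\<^sup>+d. ennreal (norm (c + d) * gauss \<tau> ((a + b) + c + d)) \<partial>\<sigma> \<partial>\<sigma>)) \<partial>\<sigma> \<partial>\<sigma>)"
    unfolding quad_integral_def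
    by (simp add: nn_integral_cmult[symmetric] ennreal_mult'[symmetric] mult.assoc)
  also have "\<dots> \<le> (\<integral>\<^sup>+a. \<integral>\<^sup>+b. ennreal ((u a)\<^sup>2 * (v b)\<^sup>2) * ennreal (2 * pi * norm (a + b)) \<partial>\<sigma> \<partial>\<sigma>)"
    by (intro nn_integral_mono mult_left_mono nn_integral_convolution_gauss_le[OF \<tau>]) simp
  also have "\<dots> = (\<integral>\<^sup>+a. \<integral>\<^sup>+b. ennreal (2 * pi) * ennreal ((u a)\<^sup>2 * (v b)\<^sup>2 * norm (a + b)) \<partial>\<sigma> \<partial>\<sigma>)"
  proof -
    have "ennreal A * ennreal (k * N) = ennreal k * ennreal (A * N)" if "0 \<le> A" "0 \<le> k" "0 \<le> N" for A k N
      using that by (simp add: ennreal_mult ac_simps)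
    then show ?thesis by (intro nn_integral_cong) simp
  qed
  also have "\<dots> = ennreal (2 * pi) * chord_form u v"
    unfolding chord_form_def by (simp add: nn_integral_cmult)
  finally show ?thesis .
qed

text \<open>
The product of four functions is at most half the sum of \<open>(u1 u2)\<^sup>2\<close> and \<open>(u3 u4)\<^sup>2\<close>. In either
summand the two variables that no longer occur can be integrated out.
\<close>
lemma quad_integral_pairing:
  assumes [measurable]: "u1 \<in> borel_measurable borel" "u2 \<in> borel_measurable borel" "u3 \<in> borel_measurable borel" "u4 \<in> borel_measurable borel"
    and \<tau>: "0 < \<tau>"
  shows "quad_integral (\<lambda>a b c d. ennreal (u1 a * u2 b * u3 c * u4 d * (norm (a + b) * norm (c + d) * gauss \<tau> (a + b + c + d))))
     \<le> ennreal pi * (chord_form u1 u2 + chord_form u3 u4)"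
proof -
  let ?k = "\<lambda>a b c d. norm (a + b) * norm (c + d) * gauss \<tau> (a + b + c + d)"
  let ?F = "\<lambda>a b c d. ennreal ((u1 a)\<^sup>2 * (u2 b)\<^sup>2 * ?k a b c d)"
  let ?G = "\<lambda>a b c d. ennreal ((u3 c)\<^sup>2 * (u4 d)\<^sup>2 * ?k a b c d)"
  have k: "0 \<le> ?k a b c d" for a b c d :: "real^3" using \<tau> by (simp add: gauss_nonneg)
  have F: "quad_measurable ?F" and G: "quad_measurable ?G" unfolding quad_measurable_def by measurable
  have "quad_integral (\<lambda>a b c d. ennreal (u1 a * u2 b * u3 c * u4 d * ?k a b c d))
      \<le> quad_integral (\<lambda>a b c d. ennreal (1/2) * (?F a b c d + ?G a b c d))"
  proof (rule quad_integral_mono)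
    fix a b c d :: "real^3"
    have "u1 a * u2 b * (u3 c * u4 d) \<le> 1/2 * ((u1 a * u2 b)\<^sup>2 + (u3 c * u4 d)\<^sup>2)"
      using sum_squares_bound[of "u1 a * u2 b" "u3 c * u4 d"] by simp
    then have "u1 a * u2 b * (u3 c * u4 d) * ?k a b c d \<le> 1/2 * ((u1 a * u2 b)\<^sup>2 + (u3 c * u4 d)\<^sup>2) * ?k a b c d"
      using k by (rule mult_right_mono)
    also have "\<dots> = 1/2 * ((u1 a)\<^sup>2 * (u2 b)\<^sup>2 * ?k a b c d + (u3 c)\<^sup>2 * (u4 d)\<^sup>2 * ?k a b c d)"
      by (simp only: power_mult_distrib distrib_right mult.assoc)
    finally have "ennreal (u1 a * u2 b * u3 c * u4 d * ?k a b c d)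
        \<le> ennreal (1/2 * ((u1 a)\<^sup>2 * (u2 b)\<^sup>2 * ?k a b c d + (u3 c)\<^sup>2 * (u4 d)\<^sup>2 * ?k a b c d))"
      by (intro ennreal_leI) (simp only: mult.assoc)
    also have "\<dots> = ennreal (1/2) * (?F a b c d + ?G a b c d)"
      by (subst ennreal_mult', simp, subst ennreal_plus) (auto intro: mult_nonneg_nonneg k)
    finally show "ennreal (u1 a * u2 b * u3 c * u4 d * ?k a b c d) \<le> ennreal (1/2) * (?F a b c d + ?G a b c d)" .
  qed
  also have "\<dots> = ennreal (1/2) * (quad_integral ?F + quad_integral ?G)"
    by (subst quad_integral_cmult) (use F G in \<open>simp_all add: quad_integral_add quad_measurable_def split_beta'\<close>)
  also have "\<dots> \<le> ennreal (1/2) * (ennreal (2 * pi) * chord_form u1 u2 + ennreal (2 * pi) * chord_form u3 u4)"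
  proof (intro mult_left_mono add_mono)
    show "quad_integral ?F \<le> ennreal (2 * pi) * chord_form u1 u2" by (rule quad_integral_half_pairing) (simp_all add: \<tau>)
    have "quad_integral ?G = quad_integral (\<lambda>a b c d. ennreal ((u3 a)\<^sup>2 * (u4 b)\<^sup>2 * ?k c d a b))" by (rule quad_integral_swap_pairs[OF G])
    also have "\<dots> = quad_integral (\<lambda>a b c d. ennreal ((u3 a)\<^sup>2 * (u4 b)\<^sup>2 * ?k a b c d))"
      by (simp add: ac_simps)
    also have "\<dots> \<le> ennreal (2 * pi) * chord_form u3 u4" by (rule quad_integral_half_pairing) (simp_all add: \<tau>)
    finally show "quad_integral ?G \<le> ennreal (2 * pi) * chord_form u3 u4" .
  qed simp
  also have "\<dots> = ennreal (1/2) * ennreal (2 * pi) * (chord_form u1 u2 + chord_form u3 u4)"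
    by (simp only: distrib_left mult.assoc)
  also have "ennreal (1/2) * ennreal (2 * pi) = ennreal pi"
    by (subst ennreal_mult'[symmetric]) simp_all
  finally show ?thesis .
qed

text \<open>
The error term needs a bound that is uniform in \<open>\<tau>\<close>. Two variables integrate to at most
\<open>2 \<pi> / |x|\<close>, which is integrable against the distribution of \<open>x = a + b\<close>.
\<close>
lemma quad_integral_gauss_le:
  assumes \<tau>: "0 < \<tau>"
  shows "quad_integral (\<lambda>a b c d. ennreal (gauss \<tau> (a + b + c + d))) \<le> ennreal (32 * pi ^ 3)"
proof -
  define C where "C = 1 / (sqrt (2 * pi) * \<tau>) ^ 3"
  have C: "0 \<le> C" using \<tau> by (simp add: C_def)
  \<comment> \<open>As \<open>2 * pi / 0 = 0\<close>, the point \<open>x = 0\<close> needs a bound of its own: the maximum of the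
    Gaussian times the total mass.\<close>
  define \<Phi> where "\<Phi> r = (if r = 0 then C * (4 * pi) * (4 * pi) else 2 * pi / \<bar>r\<bar>)" for r
  have [measurable]: "\<Phi> \<in> borel_measurable borel" unfolding \<Phi>_def[abs_def] by measurable
  have \<Phi>0: "0 \<le> \<Phi> r" for r using C by (simp add: \<Phi>_def)
  have le: "(\<integral>\<^sup>+c. \<integral>\<^sup>+d. ennreal (gauss \<tau> (x + c + d)) \<partial>\<sigma> \<partial>\<sigma>) \<le> ennreal (\<Phi> (norm x))" for x :: "real^3"
  proof (cases "x = 0")
    case True
    have "gauss \<tau> s \<le> C" for s :: "real^3"
      using \<tau> by (simp add: gauss_def C_def divide_right_mono)
    then have "(\<integral>\<^sup>+c. \<integral>\<^sup>+d. ennreal (gauss \<tau> (x + c + d)) \<partial>\<sigma> \<partial>\<sigma>) \<le> (\<integral>\<^sup>+c. \<integral>\<^sup>+d. ennreal C \<partial>\<sigma> \<partial>\<sigma>)"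
      by (intro nn_integral_mono ennreal_leI)
    also have "\<dots> = ennreal C * ennreal (4 * pi) * ennreal (4 * pi)" by (simp add: emeasure_\<sigma>_UNIV)
    also have "\<dots> = ennreal (C * (4 * pi) * (4 * pi))"
      using C by (simp only: ennreal_mult'[symmetric] ennreal_mult''[symmetric] mult_nonneg_nonneg pi_ge_zero zero_le_numeral)
    finally show ?thesis using True by (simp add: \<Phi>_def)
  next
    case False
    have "(\<integral>\<^sup>+c. \<integral>\<^sup>+d. ennreal (gauss \<tau> (x + c + d)) \<partial>\<sigma> \<partial>\<sigma>)
        = ennreal (2 * pi) * (\<integral>\<^sup>+r. ennreal (1 * dipole \<tau> (norm x) r / norm x) * indicator {0..2} r \<partial>lborel)"
      using nn_integral_\<sigma>\<sigma>_gauss[of "\<lambda>_. 1" \<tau> x] \<tau> False by simp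
    also have "(\<integral>\<^sup>+r. ennreal (1 * dipole \<tau> (norm x) r / norm x) * indicator {0..2} r \<partial>lborel)
        = (\<integral>\<^sup>+r. ennreal (1 / norm x) * (ennreal (dipole \<tau> (norm x) r) * indicator {0..2} r) \<partial>lborel)"
      by (intro nn_integral_cong) (auto simp: ennreal_mult'[symmetric] split: split_indicator)
    also have "\<dots> = ennreal (1 / norm x) * (\<integral>\<^sup>+r. ennreal (dipole \<tau> (norm x) r) * indicator {0..2} r \<partial>lborel)"
      by (rule nn_integral_cmult) measurable
    also have "ennreal (2 * pi) * \<dots> \<le> ennreal (2 * pi) * (ennreal (1 / norm x) * 1)"
      using False \<tau> by (intro mult_left_mono nn_integral_dipole) auto
    also have "\<dots> = ennreal (2 * pi * (1 / norm x))"
      by (simp only: mult_1_right) (rule ennreal_mult'[symmetric], simp)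
    finally show ?thesis using False by (simp add: \<Phi>_def)
  qed
  have "quad_integral (\<lambda>a b c d. ennreal (gauss \<tau> (a + b + c + d))) \<le> (\<integral>\<^sup>+a. \<integral>\<^sup>+b. ennreal (\<Phi> (norm (a + b))) \<partial>\<sigma> \<partial>\<sigma>)"
    unfolding quad_integral_def by (intro nn_integral_mono le)
  also have "\<dots> = ennreal (8 * pi\<^sup>2) * (\<integral>\<^sup>+r. ennreal (\<Phi> r * r) * indicator {0..2} r \<partial>lborel)"
    by (rule nn_integral_\<sigma>\<sigma>_norm) (simp_all add: \<Phi>0)
  also have "(\<integral>\<^sup>+r. ennreal (\<Phi> r * r) * indicator {0..2} r \<partial>lborel) \<le> (\<integral>\<^sup>+r. ennreal (2 * pi) * indicator {0..2::real} r \<partial>lborel)"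
    by (intro nn_integral_mono) (auto simp: \<Phi>_def split: split_indicator)
  also have "\<dots> = ennreal (2 * pi) * ennreal 2"
    by (subst nn_integral_cmult_indicator) simp_all
  also have "ennreal (8 * pi\<^sup>2) * (ennreal (2 * pi) * ennreal 2) = ennreal (8 * pi\<^sup>2 * (2 * pi * 2))"
    by (simp only: ennreal_mult'[symmetric] mult_nonneg_nonneg pi_ge_zero zero_le_numeral zero_le_power2)
  also have "8 * pi\<^sup>2 * (2 * pi * 2) = 32 * pi ^ 3" by (simp add: power2_eq_square power3_eq_cube)
  finally show ?thesis by (simp add: mult_left_mono)
qed

text \<open>
A Gaussian of twice the width absorbs the factor \<open>|s| / \<tau>\<close>: with \<open>v = |s| / \<tau>\<close> one has
\<open>v \<le> 2 exp (3 v\<^sup>2 / 8)\<close>, and the normalisations differ by \<open>2^3\<close>.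
\<close>
lemma norm_gauss_le:
  fixes s :: "real^3"
  assumes \<tau>: "0 < \<tau>"
  shows "norm s * gauss \<tau> s \<le> 16 * \<tau> * gauss (2 * \<tau>) s"
proof -
  define v where "v = norm s / \<tau>"
  have v: "norm s = \<tau> * v" using \<tau> by (simp add: v_def)
  have "v \<le> 2 * (1 + 3 * v\<^sup>2 / 8)"
    using sum_squares_ge_zero[of "v - 2/3" 0] by (simp add: power2_eq_square algebra_simps)
  also have "\<dots> \<le> 2 * exp (3 * v\<^sup>2 / 8)"
    by (intro mult_left_mono exp_ge_add_one_self) simp
  finally have "v * exp (- v\<^sup>2 / 2) \<le> 2 * exp (3 * v\<^sup>2 / 8) * exp (- v\<^sup>2 / 2)"
    by (rule mult_right_mono) simp
  also have "\<dots> = 2 * exp (- v\<^sup>2 / 8)"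
    by (simp add: exp_add[symmetric])
  finally have le: "v * exp (- v\<^sup>2 / 2) \<le> 2 * exp (- v\<^sup>2 / 8)" .
  define D where "D = (sqrt (2 * pi) * \<tau>) ^ 3"
  have D: "0 < D" using \<tau> by (simp add: D_def)
  have "(sqrt (2 * pi) * (2 * \<tau>)) ^ 3 = 8 * D"
    by (simp add: D_def power_mult_distrib)
  moreover have "- (norm s)\<^sup>2 / (2 * \<tau>\<^sup>2) = - v\<^sup>2 / 2" "- (norm s)\<^sup>2 / (2 * (2 * \<tau>)\<^sup>2) = - v\<^sup>2 / 8"
    using \<tau> by (simp_all add: v power_mult_distrib)
  ultimately have g: "gauss \<tau> s = exp (- v\<^sup>2 / 2) / D" "gauss (2 * \<tau>) s = exp (- v\<^sup>2 / 8) / (8 * D)"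
    by (simp_all add: gauss_def D_def)
  have "norm s * gauss \<tau> s = \<tau> * (v * exp (- v\<^sup>2 / 2)) / D" by (simp add: v g(1))
  also have "\<dots> \<le> \<tau> * (2 * exp (- v\<^sup>2 / 8)) / D"
    using le \<tau> D by (intro divide_right_mono mult_left_mono) auto
  also have "\<dots> = 16 * \<tau> * gauss (2 * \<tau>) s" by (simp add: g(2))
  finally show ?thesis .
qed

lemma norm_add_unit:
  fixes a b :: "'a::real_inner"
  assumes "norm a = 1" "norm b = 1"
  shows "(norm (a + b))\<^sup>2 = 2 + 2 * (a \<bullet> b)"
  using dot_norm[of a b] assms by simp

text \<open>
When \<open>s = a + b + c + d\<close> vanishes this is an equality without the last term: \<open>|c + d| = |a + b|\<close>,
and the three squares add up to \<open>6 + 2 a \<bullet> (b + c + d) = 4\<close>. In general the sum of the squares is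
\<open>4 + 2 a \<bullet> s\<close>, and each square exceeds the corresponding product by at most \<open>2 |s|\<close>; the total
loss is at most \<open>(2 + 3 \<cdot> 2) |s|\<close>.
\<close>
lemma foschi_inequality:
  fixes a b c d :: "'a::real_inner"
  assumes n: "norm a = 1" "norm b = 1" "norm c = 1" "norm d = 1"
  shows "4 \<le> norm (a + b) * norm (c + d) + norm (a + c) * norm (b + d) + norm (a + d) * norm (b + c)
           + 8 * norm (a + b + c + d)"
proof -
  define s where "s = a + b + c + d"
  have one: "(norm p)\<^sup>2 \<le> norm p * norm q + 2 * norm s" if "p + q = s" "norm p \<le> 2" for p q
  proof -
    have "p = s - q" using that(1) by (simp add: eq_diff_eq)
    then have "norm p = norm (s - q)" by simp
    also have "\<dots> \<le> norm s + norm q" by (rule norm_triangle_ineq4)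
    finally have "norm p * norm p \<le> norm p * (norm s + norm q)" by (rule mult_left_mono) simp
    also have "\<dots> = norm p * norm s + norm p * norm q" by (rule distrib_left)
    also have "norm p * norm s \<le> 2 * norm s" using that(2) by (rule mult_right_mono) simp
    finally show ?thesis by (simp add: power2_eq_square)
  qed
  have two: "norm (x + y) \<le> 2" if "norm x = 1" "norm y = 1" for x y :: 'a
    using norm_triangle_ineq[of x y] that by simp
  have "(norm (a + b))\<^sup>2 + (norm (a + c))\<^sup>2 + (norm (a + d))\<^sup>2 = 6 + 2 * (a \<bullet> (s - a))"
    by (simp add: norm_add_unit n s_def inner_add_right inner_diff_right)
  also have "\<dots> = 4 + 2 * (a \<bullet> s)"
    using n by (simp add: inner_diff_right power2_norm_eq_inner[symmetric])
  finally have sum: "(norm (a + b))\<^sup>2 + (norm (a + c))\<^sup>2 + (norm (a + d))\<^sup>2 = 4 + 2 * (a \<bullet> s)" .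
  have "- (a \<bullet> s) \<le> norm s"
    using Cauchy_Schwarz_ineq2[of a s] n by simp
  moreover have "(norm (a + b))\<^sup>2 \<le> norm (a + b) * norm (c + d) + 2 * norm s"
    by (rule one) (simp_all add: s_def two n)
  moreover have "(norm (a + c))\<^sup>2 \<le> norm (a + c) * norm (b + d) + 2 * norm s"
    by (rule one) (simp_all add: s_def two n)
  moreover have "(norm (a + d))\<^sup>2 \<le> norm (a + d) * norm (b + c) + 2 * norm s"
    by (rule one) (simp_all add: s_def two n)
  ultimately show ?thesis using sum by (simp add: s_def)
qed

text \<open>
Foschi's inequality splits the integral into three paired terms and an error. The functions in
positions \<open>c\<close> and \<open>d\<close> are reflected, so the pairing \<open>ab|cd\<close> yields \<open>chord_form\<close> of \<open>f\<close> with itself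
and the other two yield \<open>chord_form\<close> of \<open>f\<close> and its reflection: exactly the combination in
\<open>chord_form_bound\<close>.
\<close>
lemma quad_integral_gauss_bound:
  assumes [measurable]: "f \<in> borel_measurable borel" and f0: "\<And>x. 0 \<le> f x" and fB: "\<And>x. f x \<le> B"
    and \<tau>: "0 < \<tau>" and S: "(\<integral>\<^sup>+x. ennreal ((f x)\<^sup>2) \<partial>\<sigma>) = ennreal s" and s: "0 \<le> s"
  shows "4 * quad_integral (\<lambda>a b c d. ennreal (f a * f b * f (- c) * f (- d) * gauss \<tau> (a + b + c + d)))
     \<le> ennreal (8 * pi * s\<^sup>2 + 4096 * pi ^ 3 * B ^ 4 * \<tau>)"
proof -
  have B: "0 \<le> B" using f0[of 0] fB[of 0] by simp
  let ?r = "\<lambda>x. f (- x)"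
  have [measurable]: "?r \<in> borel_measurable borel" by measurable
  let ?w = "\<lambda>a b c d. f a * f b * ?r c * ?r d"
  let ?K = "\<lambda>a b c d :: real^3. gauss \<tau> (a + b + c + d)"
  let ?F1 = "\<lambda>a b c d. ennreal (?w a b c d * (norm (a + b) * norm (c + d) * ?K a b c d))"
  let ?F2 = "\<lambda>a b c d. ennreal (?w a b c d * (norm (a + c) * norm (b + d) * ?K a b c d))"
  let ?F3 = "\<lambda>a b c d. ennreal (?w a b c d * (norm (a + d) * norm (b + c) * ?K a b c d))"
  let ?F4 = "\<lambda>a b c d :: real^3. ennreal (128 * \<tau> * B ^ 4) * ennreal (gauss (2 * \<tau>) (a + b + c + d))"
  have w0: "0 \<le> ?w a b c d" for a b c d by (simp add: f0)
  have wB: "?w a b c d \<le> B ^ 4" for a b c d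
  proof -
    have "?w a b c d \<le> B * B * B * B" using f0 fB B by (intro mult_mono mult_nonneg_nonneg) auto
    then show ?thesis by (simp add: power4_eq_xxxx)
  qed
  have m[simp]: "quad_measurable ?F1" "quad_measurable ?F2" "quad_measurable ?F3" "quad_measurable ?F4"
    "quad_measurable (\<lambda>a b c d. ennreal (?w a b c d * ?K a b c d))"
    "quad_measurable (\<lambda>a b c d. ennreal (gauss (2 * \<tau>) (a + b + c + d)))"
    unfolding quad_measurable_def by measurable
  have add: "quad_measurable (\<lambda>a b c d. F a b c d + G a b c d)" if "quad_measurable F" "quad_measurable G" for F G
    using that unfolding quad_measurable_def split_beta' by measurable
  have "4 * quad_integral (\<lambda>a b c d. ennreal (?w a b c d * ?K a b c d)) = quad_integral (\<lambda>a b c d. 4 * ennreal (?w a b c d * ?K a b c d))"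
    by (rule quad_integral_cmult[symmetric]) simp
  also have "\<dots> \<le> quad_integral (\<lambda>a b c d. ?F1 a b c d + ?F2 a b c d + ?F3 a b c d + ?F4 a b c d)"
  proof (rule quad_integral_mono)
    fix a b c d :: "real^3" assume n: "norm a = 1" "norm b = 1" "norm c = 1" "norm d = 1"
    let ?s = "a + b + c + d"
    define k where "k = ?K a b c d"
    define w where "w = ?w a b c d"
    have k: "0 \<le> k" using \<tau> by (simp add: k_def gauss_nonneg)
    have w: "0 \<le> w" "w \<le> B ^ 4" using w0 wB by (simp_all add: w_def)
    have "4 * (w * k) \<le> (norm (a + b) * norm (c + d) + norm (a + c) * norm (b + d) + norm (a + d) * norm (b + c) + 8 * norm ?s) * (w * k)"
      using k w by (intro mult_right_mono foschi_inequality n) auto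
    also have "\<dots> = w * (norm (a + b) * norm (c + d) * k) + w * (norm (a + c) * norm (b + d) * k)
        + w * (norm (a + d) * norm (b + c) * k) + 8 * w * (norm ?s * k)"
      by (simp add: algebra_simps)
    also have "8 * w * (norm ?s * k) \<le> 8 * B ^ 4 * (16 * \<tau> * gauss (2 * \<tau>) ?s)"
    proof (rule mult_mono)
      show "norm ?s * k \<le> 16 * \<tau> * gauss (2 * \<tau>) ?s" unfolding k_def by (rule norm_gauss_le[OF \<tau>])
    qed (use w k B in auto)
    finally have "ennreal (4 * (w * k)) \<le> ennreal (w * (norm (a + b) * norm (c + d) * k) + w * (norm (a + c) * norm (b + d) * k)
        + w * (norm (a + d) * norm (b + c) * k) + 128 * \<tau> * B ^ 4 * gauss (2 * \<tau>) ?s)"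
      by (intro ennreal_leI) (simp add: ac_simps)
    also have "\<dots> = ennreal (w * (norm (a + b) * norm (c + d) * k)) + ennreal (w * (norm (a + c) * norm (b + d) * k))
        + ennreal (w * (norm (a + d) * norm (b + c) * k)) + ennreal (128 * \<tau> * B ^ 4) * ennreal (gauss (2 * \<tau>) ?s)"
      using w k \<tau> B by (simp add: ennreal_plus ennreal_mult'[symmetric] gauss_nonneg)
    also have "ennreal (4 * (w * k)) = 4 * ennreal (w * k)"
      by (subst ennreal_mult') simp_all
    finally show "4 * ennreal (?w a b c d * ?K a b c d) \<le> ?F1 a b c d + ?F2 a b c d + ?F3 a b c d + ?F4 a b c d"
      unfolding w_def k_def .
  qed
  also have "\<dots> = quad_integral ?F1 + quad_integral ?F2 + quad_integral ?F3 + quad_integral ?F4"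
    by (subst quad_integral_add, simp add: add, simp, subst quad_integral_add, simp add: add, simp, subst quad_integral_add) simp_all
  also have "\<dots> \<le> ennreal pi * (chord_form f f + chord_form ?r ?r) + ennreal pi * (chord_form f ?r + chord_form f ?r)
      + ennreal pi * (chord_form f ?r + chord_form ?r f) + ennreal (128 * \<tau> * B ^ 4) * ennreal (32 * pi ^ 3)"
  proof (intro add_mono)
    show "quad_integral ?F1 \<le> ennreal pi * (chord_form f f + chord_form ?r ?r)"
      by (rule quad_integral_pairing) (simp_all add: \<tau>)
    have "quad_integral ?F2 = quad_integral (\<lambda>a b c d. ennreal (f a * ?r b * f c * ?r d * (norm (a + b) * norm (c + d) * ?K a b c d)))"
      by (subst quad_integral_swap23[OF m(2)]) (simp add: ac_simps)
    also have "\<dots> \<le> ennreal pi * (chord_form f ?r + chord_form f ?r)"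
      by (rule quad_integral_pairing) (simp_all add: \<tau>)
    finally show "quad_integral ?F2 \<le> ennreal pi * (chord_form f ?r + chord_form f ?r)" .
    have "quad_integral ?F3 = quad_integral (\<lambda>a b c d. ennreal (f a * ?r b * ?r c * f d * (norm (a + b) * norm (c + d) * ?K a b c d)))"
      by (subst quad_integral_swap24[OF m(3)]) (simp add: ac_simps)
    also have "\<dots> \<le> ennreal pi * (chord_form f ?r + chord_form ?r f)"
      by (rule quad_integral_pairing) (simp_all add: \<tau>)
    finally show "quad_integral ?F3 \<le> ennreal pi * (chord_form f ?r + chord_form ?r f)" .
    show "quad_integral ?F4 \<le> ennreal (128 * \<tau> * B ^ 4) * ennreal (32 * pi ^ 3)"
      using \<tau> by (subst quad_integral_cmult) (auto intro!: mult_left_mono quad_integral_gauss_le)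
  qed
  also have "chord_form ?r ?r = chord_form f f"
    using chord_form_reflect[of f f] by simp
  also have "chord_form ?r f = chord_form f ?r"
    using chord_form_reflect[of f ?r] by simp
  also have "ennreal pi * (chord_form f f + chord_form f f) + ennreal pi * (chord_form f ?r + chord_form f ?r)
      + ennreal pi * (chord_form f ?r + chord_form f ?r) = ennreal pi * 2 * (chord_form f f + 2 * chord_form f ?r)"
    by (simp add: distrib_left mult_2 mult_2_right distrib_right ac_simps)
  also have "ennreal pi * 2 * (chord_form f f + 2 * chord_form f ?r) \<le> ennreal pi * 2 * ennreal (4 * s\<^sup>2)"
    by (intro mult_left_mono chord_form_bound S s) simp_all
  also have "ennreal pi * 2 * ennreal (4 * s\<^sup>2) + ennreal (128 * \<tau> * B ^ 4) * ennreal (32 * pi ^ 3)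
      = ennreal (8 * pi * s\<^sup>2 + 4096 * pi ^ 3 * B ^ 4 * \<tau>)"
  proof -
    have "ennreal pi * 2 = ennreal (pi * 2)" by (subst ennreal_mult') simp_all
    then have "ennreal pi * 2 * ennreal (4 * s\<^sup>2) = ennreal (pi * 2 * (4 * s\<^sup>2))"
      by (simp only:) (rule ennreal_mult'[symmetric], simp)
    moreover have "ennreal (128 * \<tau> * B ^ 4) * ennreal (32 * pi ^ 3) = ennreal (128 * \<tau> * B ^ 4 * (32 * pi ^ 3))"
      by (rule ennreal_mult''[symmetric]) simp
    ultimately show ?thesis
      using \<tau> B by (simp add: ennreal_plus[symmetric] ac_simps del: ennreal_plus)
  qed
  finally show ?thesis by (simp add: add_right_mono)
qed

section \<open>The sharp extension inequality\<close>

lemma extension_square: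
  fixes f :: "real^3 \<Rightarrow> complex"
  assumes [measurable]: "f \<in> borel_measurable borel" and B: "\<And>x. norm (f x) \<le> B"
  shows "(LINT z|(\<sigma> \<Otimes>\<^sub>M \<sigma>). exp (- (\<i> * complex_of_real ((fst z + snd z) \<bullet> \<xi>))) * (f (fst z) * f (snd z)))
       = (LINT x|\<sigma>. exp (- (\<i> * complex_of_real (x \<bullet> \<xi>))) * f x)\<^sup>2"
proof -
  let ?e = "\<lambda>x. exp (- (\<i> * complex_of_real (x \<bullet> \<xi>))) * f x"
  have ne: "norm (exp (- (\<i> * complex_of_real r))) = 1" for r by (simp add: norm_exp_imaginary)
  have B0: "0 \<le> B" using B norm_ge_zero order_trans by blast
  have int: "integrable (\<sigma> \<Otimes>\<^sub>M \<sigma>) (\<lambda>z. ?e (fst z) * ?e (snd z))"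
    by (rule \<sigma>\<sigma>.integrable_const_bound[where B = "B * B"])
      (auto simp: norm_mult ne intro!: mult_mono B B0)
  have "(LINT z|(\<sigma> \<Otimes>\<^sub>M \<sigma>). exp (- (\<i> * complex_of_real ((fst z + snd z) \<bullet> \<xi>))) * (f (fst z) * f (snd z)))
      = (LINT z|(\<sigma> \<Otimes>\<^sub>M \<sigma>). ?e (fst z) * ?e (snd z))"
    by (intro Bochner_Integration.integral_cong) (simp_all add: inner_add_left algebra_simps flip: exp_add)
  also have "\<dots> = (LINT x|\<sigma>. LINT y|\<sigma>. ?e x * ?e y)"
    by (subst \<sigma>\<sigma>.integral_fst'[symmetric, OF int]) simp
  also have "\<dots> = (LINT x|\<sigma>. ?e x)\<^sup>2" by (simp add: power2_eq_square)
  finally show ?thesis .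
qed

text \<open>
The square of the transform is an integral over \<open>\<sigma> \<Otimes> \<sigma>\<close>, so \<open>gauss_weighted_L2\<close> applies; the last
two variables are then reflected.
\<close>
lemma nn_integral_gauss_extension_le:
  fixes f :: "real^3 \<Rightarrow> complex"
  assumes fm[measurable]: "f \<in> borel_measurable borel" and B: "\<And>x. norm (f x) \<le> B"
    and \<tau>: "0 < \<tau>" and S: "(\<integral>\<^sup>+x. ennreal ((norm (f x))\<^sup>2) \<partial>\<sigma>) = ennreal s" and s: "0 \<le> s"
  shows "(\<integral>\<^sup>+\<xi>. ennreal (exp (- ((\<tau> * norm \<xi>)\<^sup>2 / 2)) * (norm (LINT x|\<sigma>. exp (- (\<i> * complex_of_real (x \<bullet> \<xi>))) * f x)) ^ 4) \<partial>lborel)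
     \<le> ennreal (16 * pi ^ 4 * s\<^sup>2 + 8192 * pi ^ 6 * B ^ 4 * \<tau>)"
proof -
  let ?F = "\<lambda>\<xi>. LINT x|\<sigma>. exp (- (\<i> * complex_of_real (x \<bullet> \<xi>))) * f x"
  let ?n = "\<lambda>x. norm (f x)"
  let ?G = "\<lambda>a b c d. ennreal (?n a * ?n b * ?n (- c) * ?n (- d) * gauss \<tau> (a + b + c + d))"
  have B0: "0 \<le> B" using B norm_ge_zero order_trans by blast
  have [measurable]: "(\<lambda>z. f (fst z) * f (snd z)) \<in> borel_measurable (\<sigma> \<Otimes>\<^sub>M \<sigma>)" by measurable
  have "(\<integral>\<^sup>+\<xi>. ennreal (exp (- ((\<tau> * norm \<xi>)\<^sup>2 / 2)) * (norm (?F \<xi>)) ^ 4) \<partial>lborel)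
     = (\<integral>\<^sup>+\<xi>. ennreal (exp (- ((\<tau> * norm \<xi>)\<^sup>2 / 2)) * (norm (LINT z|(\<sigma> \<Otimes>\<^sub>M \<sigma>). exp (- (\<i> * complex_of_real ((fst z + snd z) \<bullet> \<xi>))) * (f (fst z) * f (snd z))))\<^sup>2) \<partial>lborel)"
    by (simp add: extension_square[OF fm B] norm_power flip: power_mult)
  also have "\<dots> \<le> (\<integral>\<^sup>+z. ennreal ((2 * pi) ^ DIM(real^3) * gauss \<tau> ((fst (fst z) + snd (fst z)) - (fst (snd z) + snd (snd z)))
       * (norm (f (fst (fst z)) * f (snd (fst z))) * norm (f (fst (snd z)) * f (snd (snd z))))) \<partial>((\<sigma> \<Otimes>\<^sub>M \<sigma>) \<Otimes>\<^sub>M (\<sigma> \<Otimes>\<^sub>M \<sigma>)))"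
    by (rule \<sigma>\<sigma>.gauss_weighted_L2[where B = "B * B"]) (auto simp: norm_mult \<tau> intro!: mult_mono B B0)
  also have "\<dots> = (\<integral>\<^sup>+a. \<integral>\<^sup>+b. \<integral>\<^sup>+c. \<integral>\<^sup>+d. ennreal ((2 * pi) ^ 3 * gauss \<tau> ((a + b) - (c + d))
       * (norm (f a * f b) * norm (f c * f d))) \<partial>\<sigma> \<partial>\<sigma> \<partial>\<sigma> \<partial>\<sigma>)"
    by (subst \<sigma>\<sigma>.nn_integral_fst[symmetric], measurable, subst \<sigma>.nn_integral_fst[symmetric], measurable,
        subst \<sigma>.nn_integral_fst[symmetric]) simp_all
  also have "\<dots> = (\<integral>\<^sup>+a. \<integral>\<^sup>+b. \<integral>\<^sup>+c. \<integral>\<^sup>+d. ennreal ((2 * pi) ^ 3 * gauss \<tau> ((a + b) - (- c + - d))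
       * (norm (f a * f b) * norm (f (- c) * f (- d)))) \<partial>\<sigma> \<partial>\<sigma> \<partial>\<sigma> \<partial>\<sigma>)"
  proof (rule nn_integral_cong, rule nn_integral_cong)
    fix a b :: "real^3"
    have T: "orthogonal_transformation (uminus :: real^3 \<Rightarrow> real^3)"
      by (simp add: orthogonal_transformation_def linear_iff)
    show "(\<integral>\<^sup>+c. \<integral>\<^sup>+d. ennreal ((2 * pi) ^ 3 * gauss \<tau> ((a + b) - (c + d)) * (norm (f a * f b) * norm (f c * f d))) \<partial>\<sigma> \<partial>\<sigma>)
       = (\<integral>\<^sup>+c. \<integral>\<^sup>+d. ennreal ((2 * pi) ^ 3 * gauss \<tau> ((a + b) - (- c + - d)) * (norm (f a * f b) * norm (f (- c) * f (- d)))) \<partial>\<sigma> \<partial>\<sigma>)"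
      by (rule nn_integral_\<sigma>\<sigma>_orthogonal[OF T, symmetric]) measurable
  qed
  also have "\<dots> = quad_integral (\<lambda>a b c d. ennreal ((2 * pi) ^ 3) * ?G a b c d)"
    unfolding quad_integral_def by (simp add: norm_mult ennreal_mult'[symmetric] algebra_simps)
  also have "\<dots> = ennreal ((2 * pi) ^ 3) * quad_integral ?G"
    by (rule quad_integral_cmult) (simp add: quad_measurable_def)
  also have "\<dots> = ennreal (2 * pi ^ 3) * (4 * quad_integral ?G)"
  proof -
    have "ennreal ((2 * pi) ^ 3) = ennreal (2 * pi ^ 3 * 4)" by (simp add: power_mult_distrib)
    also have "\<dots> = ennreal (2 * pi ^ 3) * 4" by (subst ennreal_mult') simp_all
    finally show ?thesis by (simp only: mult.assoc)
  qed
  also have "\<dots> \<le> ennreal (2 * pi ^ 3) * ennreal (8 * pi * s\<^sup>2 + 4096 * pi ^ 3 * B ^ 4 * \<tau>)"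
    by (intro mult_left_mono quad_integral_gauss_bound S s \<tau> B) simp_all
  also have "\<dots> = ennreal (2 * pi ^ 3 * (8 * pi * s\<^sup>2 + 4096 * pi ^ 3 * B ^ 4 * \<tau>))"
    by (rule ennreal_mult'[symmetric]) simp
  also have "2 * pi ^ 3 * (8 * pi * s\<^sup>2 + 4096 * pi ^ 3 * B ^ 4 * \<tau>) = 16 * pi ^ 4 * s\<^sup>2 + 8192 * pi ^ 6 * B ^ 4 * \<tau>"
    by (simp add: distrib_left eval_nat_numeral)
  finally show ?thesis .
qed

text \<open>
Truncate \<open>f\<close> at height \<open>n\<close> and use the width \<open>(n + 1)^(-5)\<close>, for which the error
\<open>n^4 \<tau>\<close> tends to 0. The truncated transforms converge pointwise, because \<open>f\<close> is
integrable on a finite measure space, and Fatou's lemma preserves the bound.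
\<close>
lemma nn_integral_extension_le:
  fixes f :: "real^3 \<Rightarrow> complex"
  assumes fm[measurable]: "f \<in> borel_measurable borel"
    and S: "(\<integral>\<^sup>+x. ennreal ((norm (f x))\<^sup>2) \<partial>\<sigma>) = ennreal s" and s: "0 \<le> s"
  shows "(\<integral>\<^sup>+\<xi>. ennreal ((norm (LINT x|\<sigma>. exp (- (\<i> * complex_of_real (x \<bullet> \<xi>))) * f x)) ^ 4) \<partial>lborel)
     \<le> ennreal (16 * pi ^ 4 * s\<^sup>2)"
proof -
  let ?e = "\<lambda>\<xi> x. exp (- (\<i> * complex_of_real (x \<bullet> \<xi>)))"
  define g where "g n x = (if norm (f x) \<le> real n then f x else 0)" for n :: nat and x
  define \<tau> where "\<tau> n = 1 / real (Suc n) ^ 5" for n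
  define h where "h n \<xi> = ennreal (exp (- ((\<tau> n * norm \<xi>)\<^sup>2 / 2)) * (norm (LINT x|\<sigma>. ?e \<xi> x * g n x)) ^ 4)" for n and \<xi> :: "real^3"
  have gm[measurable]: "g n \<in> borel_measurable borel" for n unfolding g_def by measurable
  have ne: "norm (?e \<xi> x) = 1" for \<xi> x :: "real^3" by (simp add: norm_exp_imaginary)
  have hm[measurable]: "h n \<in> borel_measurable borel" for n
  proof -
    have "(\<lambda>\<xi>. LINT x|\<sigma>. ?e \<xi> x * g n x) \<in> borel_measurable borel"
      by (rule \<sigma>.borel_measurable_lebesgue_integral) measurable
    then show ?thesis unfolding h_def by measurable
  qed
  have \<tau>0: "0 < \<tau> n" for n by (simp add: \<tau>_def)
  have fi: "integrable \<sigma> f"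
  proof (rule integrableI_bounded)
    have "(\<integral>\<^sup>+x. ennreal (norm (f x)) \<partial>\<sigma>) \<le> (\<integral>\<^sup>+x. 1 + ennreal ((norm (f x))\<^sup>2) \<partial>\<sigma>)"
    proof (rule nn_integral_mono)
      fix x
      have "norm (f x) \<le> 1 + (norm (f x))\<^sup>2"
        using sum_squares_bound[of 1 "norm (f x)"] by (simp add: power2_eq_square) (smt (verit) norm_ge_zero)
      then show "ennreal (norm (f x)) \<le> 1 + ennreal ((norm (f x))\<^sup>2)"
        by (simp flip: ennreal_1 ennreal_plus)
    qed
    also have "\<dots> = emeasure \<sigma> UNIV + ennreal s" by (simp add: nn_integral_add S)
    also have "\<dots> < \<infinity>" by (simp add: emeasure_\<sigma>_UNIV)
    finally show "(\<integral>\<^sup>+x. ennreal (norm (f x)) \<partial>\<sigma>) < \<infinity>" .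
  qed simp
  have conv: "(\<lambda>n. h n \<xi>) \<longlonglongrightarrow> ennreal ((norm (LINT x|\<sigma>. ?e \<xi> x * f x)) ^ 4)" for \<xi>
  proof -
    have "(\<lambda>n. LINT x|\<sigma>. ?e \<xi> x * g n x) \<longlonglongrightarrow> (LINT x|\<sigma>. ?e \<xi> x * f x)"
    proof (rule integral_dominated_convergence[where w = "\<lambda>x. norm (f x)"])
      show "AE x in \<sigma>. (\<lambda>n. ?e \<xi> x * g n x) \<longlonglongrightarrow> ?e \<xi> x * f x"
      proof (rule AE_I2, rule tendsto_eventually)
        fix x
        obtain N where "norm (f x) \<le> real N" using real_arch_simple by blast
        then show "\<forall>\<^sub>F n in sequentially. ?e \<xi> x * g n x = ?e \<xi> x * f x"
          unfolding eventually_sequentially by (intro exI[of _ N]) (auto simp: g_def)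
      qed
      show "AE x in \<sigma>. norm (?e \<xi> x * g n x) \<le> norm (f x)" for n
        by (rule AE_I2) (simp add: norm_mult ne g_def)
    qed (use fi in auto)
    moreover have "\<tau> \<longlonglongrightarrow> 0"
    proof -
      have "(\<lambda>n. (1 / real (Suc n)) ^ 5) \<longlonglongrightarrow> 0 ^ 5"
        by (intro tendsto_power LIMSEQ_Suc lim_1_over_n)
      then show ?thesis by (simp add: \<tau>_def[abs_def] power_one_over)
    qed
    ultimately have "(\<lambda>n. exp (- ((\<tau> n * norm \<xi>)\<^sup>2 / 2)) * (norm (LINT x|\<sigma>. ?e \<xi> x * g n x)) ^ 4)
        \<longlonglongrightarrow> exp (- ((0 * norm \<xi>)\<^sup>2 / 2)) * (norm (LINT x|\<sigma>. ?e \<xi> x * f x)) ^ 4"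
      by (intro tendsto_intros) auto
    then show ?thesis unfolding h_def by (intro tendsto_ennrealI) simp
  qed
  have bound: "(\<integral>\<^sup>+\<xi>. h n \<xi> \<partial>lborel) \<le> ennreal (16 * pi ^ 4 * s\<^sup>2 + 8192 * pi ^ 6 / real (Suc n))" for n
  proof -
    have le: "(\<integral>\<^sup>+x. ennreal ((norm (g n x))\<^sup>2) \<partial>\<sigma>) \<le> ennreal s"
      unfolding S[symmetric] by (intro nn_integral_mono) (simp add: g_def)
    then obtain r where r: "(\<integral>\<^sup>+x. ennreal ((norm (g n x))\<^sup>2) \<partial>\<sigma>) = ennreal r" "0 \<le> r"
      by (cases "\<integral>\<^sup>+x. ennreal ((norm (g n x))\<^sup>2) \<partial>\<sigma>") (auto simp: top_unique)
    with le s have rs: "r \<le> s" by simp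
    have "(\<integral>\<^sup>+\<xi>. h n \<xi> \<partial>lborel) \<le> ennreal (16 * pi ^ 4 * r\<^sup>2 + 8192 * pi ^ 6 * real n ^ 4 * \<tau> n)"
      unfolding h_def by (rule nn_integral_gauss_extension_le[OF gm _ \<tau>0 r]) (simp add: g_def)
    also have "\<dots> \<le> ennreal (16 * pi ^ 4 * s\<^sup>2 + 8192 * pi ^ 6 / real (Suc n))"
    proof (intro ennreal_leI add_mono mult_left_mono)
      show "r\<^sup>2 \<le> s\<^sup>2" using rs r by (intro power_mono) auto
      have "real n ^ 4 * \<tau> n \<le> real (Suc n) ^ 4 * \<tau> n"
        using \<tau>0[of n] by (intro mult_right_mono power_mono) auto
      also have "\<dots> = 1 / real (Suc n)" by (simp add: \<tau>_def eval_nat_numeral del: of_nat_Suc)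
      finally have "8192 * pi ^ 6 * (real n ^ 4 * \<tau> n) \<le> 8192 * pi ^ 6 * (1 / real (Suc n))"
        by (intro mult_left_mono) auto
      then show "8192 * pi ^ 6 * real n ^ 4 * \<tau> n \<le> 8192 * pi ^ 6 / real (Suc n)" by (simp only: mult.assoc times_divide_eq_right mult_1_right)
    qed simp
    finally show ?thesis .
  qed
  have "(\<integral>\<^sup>+\<xi>. ennreal ((norm (LINT x|\<sigma>. ?e \<xi> x * f x)) ^ 4) \<partial>lborel) = (\<integral>\<^sup>+\<xi>. liminf (\<lambda>n. h n \<xi>) \<partial>lborel)"
    by (intro nn_integral_cong lim_imp_Liminf[symmetric] conv) simp
  also have "\<dots> \<le> liminf (\<lambda>n. \<integral>\<^sup>+\<xi>. h n \<xi> \<partial>lborel)"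
    by (rule nn_integral_liminf) simp
  also have "\<dots> \<le> liminf (\<lambda>n. ennreal (16 * pi ^ 4 * s\<^sup>2 + 8192 * pi ^ 6 / real (Suc n)))"
    by (intro Liminf_mono always_eventually allI bound)
  also have "\<dots> = ennreal (16 * pi ^ 4 * s\<^sup>2)"
  proof (rule lim_imp_Liminf)
    have "(\<lambda>n. 16 * pi ^ 4 * s\<^sup>2 + 8192 * pi ^ 6 * (1 / real (Suc n))) \<longlonglongrightarrow> 16 * pi ^ 4 * s\<^sup>2 + 8192 * pi ^ 6 * 0"
      by (intro tendsto_intros LIMSEQ_Suc lim_1_over_n)
    then show "(\<lambda>n. ennreal (16 * pi ^ 4 * s\<^sup>2 + 8192 * pi ^ 6 / real (Suc n))) \<longlonglongrightarrow> ennreal (16 * pi ^ 4 * s\<^sup>2)"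
      by (intro tendsto_ennrealI) simp
  qed simp
  finally show ?thesis .
qed

section \<open>The constant function\<close>

text \<open>
Integration by parts: the derivative of \<open>sin^4\<close> is \<open>sin 2x - (sin 4x) / 2\<close>, so the integral
reduces to two values of the sine integral, \<open>\<pi>/2 - \<pi>/4\<close>.
\<close>
lemma nn_integral_sin4:
  "(\<integral>\<^sup>+r. ennreal ((sin r) ^ 4 / r\<^sup>2) * indicator {0..} r \<partial>lborel) = ennreal (pi / 4)"
proof -
  define F where "F x = - ((sin x) ^ 4 / x) + Si (2 * x) - Si (4 * x) / 2" for x :: real
  have Si: "((\<lambda>x. Si (c * x)) has_real_derivative sinc (c * x) * c) (at x)" for c x
    by (rule DERIV_chain2[OF DERIV_Si]) (auto intro!: derivative_eq_intros)
  have "(\<integral>\<^sup>+r. ennreal ((sin r) ^ 4 / r\<^sup>2) * indicator {0..} r \<partial>lborel) = ennreal (pi / 4 - F 0)"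
  proof (rule nn_integral_FTC_atLeast)
    fix x :: real
    have D1: "((\<lambda>x. - ((sin x) ^ 4 / x)) has_real_derivative (sin x) ^ 4 / x\<^sup>2 - (sinc (2 * x) * 2 - sinc (4 * x) * 4 / 2)) (at x)"
    proof (cases "x = 0")
      case True
      have "((\<lambda>h::real. (sin h) ^ 4 / h\<^sup>2) \<longlongrightarrow> 0) (at 0)"
      proof (rule Lim_null_comparison[where g = "\<lambda>h::real. h\<^sup>2"])
        have "norm ((sin h) ^ 4 / h\<^sup>2) \<le> h\<^sup>2" for h :: real
        proof (cases "h = 0")
          case False
          have "\<bar>sin h\<bar> ^ 4 \<le> \<bar>h\<bar> ^ 4" by (intro power_mono abs_sin_x_le_abs_x) simp
          then show ?thesis using False by (simp add: divide_le_eq power_even_abs flip: power_add)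
        qed simp
        then show "\<forall>\<^sub>F h in at 0. norm ((sin h) ^ 4 / h\<^sup>2) \<le> h\<^sup>2" by simp
        have "((\<lambda>h::real. h\<^sup>2) \<longlongrightarrow> 0\<^sup>2) (at 0)" by (intro tendsto_intros)
        then show "((\<lambda>h::real. h\<^sup>2) \<longlongrightarrow> 0) (at 0)" by simp
      qed
      then have "((\<lambda>h::real. - ((sin h) ^ 4 / h\<^sup>2)) \<longlongrightarrow> - 0) (at 0)" by (rule tendsto_minus)
      then show ?thesis using True
        by (simp add: has_field_derivative_iff power2_eq_square)
    next
      case False
      have s4: "sin (4 * x) = 2 * sin (2 * x) * cos (2 * x)" using sin_double[of "2 * x"] by simp
      have c2: "cos (2 * x) = 1 - 2 * (sin x)\<^sup>2" by (rule cos_double_sin)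
      have s2: "sin (2 * x) = 2 * sin x * cos x" by (rule sin_double)
      have eq: "4 * (sin x) ^ 3 * cos x = sin (2 * x) - sin (4 * x) / 2"
        unfolding s4 c2 s2 by (simp add: power2_eq_square power3_eq_cube field_simps)
      have "sinc (2 * x) * 2 - sinc (4 * x) * 4 / 2 = (sin (2 * x) - sin (4 * x) / 2) / x"
        using False by (simp add: field_simps)
      then have "sinc (2 * x) * 2 - sinc (4 * x) * 4 / 2 = 4 * (sin x) ^ 3 * cos x / x" by (simp only: eq)
      then show ?thesis using False
        by (auto intro!: derivative_eq_intros simp: field_simps power2_eq_square eval_nat_numeral)
    qed
    show "(F has_real_derivative (sin x) ^ 4 / x\<^sup>2) (at x)"
      unfolding F_def
      by (rule DERIV_cong[OF DERIV_diff[OF DERIV_add[OF D1 Si] DERIV_cdivide[OF Si]]]) simp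
    show "0 \<le> (sin x) ^ 4 / x\<^sup>2" by simp
  next
    have mult: "filterlim (\<lambda>x::real. c * x) at_top at_top" if "0 < c" for c
      using that by (intro filterlim_tendsto_pos_mult_at_top[OF tendsto_const] filterlim_ident) auto
    have "((\<lambda>x::real. (sin x) ^ 4 / x) \<longlongrightarrow> 0) at_top"
    proof (rule Lim_null_comparison[where g = "\<lambda>x. inverse x"])
      show "\<forall>\<^sub>F x in at_top. norm ((sin x) ^ 4 / x) \<le> inverse (x::real)"
        using eventually_gt_at_top[of "0::real"]
      proof eventually_elim
        case (elim x)
        have "\<bar>sin x\<bar> ^ 4 \<le> 1 ^ 4" by (intro power_mono) auto
        then show ?case using elim by (simp add: field_simps power_even_abs)
      qed
    qed (rule tendsto_inverse_0_at_top[OF filterlim_ident])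
    then have "(F \<longlongrightarrow> - 0 + pi / 2 - pi / 2 / 2) at_top"
      unfolding F_def
      by (intro tendsto_intros filterlim_compose[OF Si_at_top mult]) auto
    then show "(F \<longlongrightarrow> pi / 4) at_top" by simp
  qed (simp_all)
  moreover have "Si 0 = 0" using Si_neg[of 0] by simp
  ultimately show ?thesis by (simp add: F_def)
qed

lemma distr_\<sigma>_inner:
  fixes u :: "real^3"
  assumes u: "norm u = 1"
  shows "distr \<sigma> borel (\<lambda>x. x \<bullet> u) = density lborel (\<lambda>t. ennreal (2 * pi * indicator {-1..1} t))"
proof (rule measure_eqI)
  fix A assume "A \<in> sets (distr \<sigma> borel (\<lambda>x. x \<bullet> u))"
  then have A[measurable]: "A \<in> sets borel" by simp
  have "emeasure (distr \<sigma> borel (\<lambda>x. x \<bullet> u)) A = (\<integral>\<^sup>+x. indicator A (x \<bullet> u) \<partial>\<sigma>)"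
    using A by (subst nn_integral_indicator[symmetric], simp, subst nn_integral_distr) simp_all
  also have "\<dots> = (\<integral>\<^sup>+t. ennreal (2 * pi) * indicator {-1..1} t * indicator A t \<partial>lborel)"
    by (rule nn_integral_\<sigma>_inner) (simp_all add: u)
  also have "\<dots> = emeasure (density lborel (\<lambda>t. ennreal (2 * pi * indicator {-1..1} t))) A"
    by (subst emeasure_density) (auto intro!: nn_integral_cong split: split_indicator)
  finally show "emeasure (distr \<sigma> borel (\<lambda>x. x \<bullet> u)) A = emeasure (density lborel (\<lambda>t. ennreal (2 * pi * indicator {-1..1} t))) A" .
qed simp

lemma extension_one:
  fixes \<xi> :: "real^3"
  assumes \<xi>: "\<xi> \<noteq> 0"
  shows "(LINT x|\<sigma>. exp (- (\<i> * complex_of_real (x \<bullet> \<xi>)))) = complex_of_real (4 * pi * sin (norm \<xi>) / norm \<xi>)"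
proof -
  define r where "r = norm \<xi>"
  have r: "0 < r" using \<xi> by (simp add: r_def)
  have ns: "norm (sgn \<xi>) = 1" using \<xi> by (simp add: norm_sgn)
  let ?e = "\<lambda>t. exp (- (\<i> * complex_of_real (r * t)))"
  define E where "E t = \<i> / complex_of_real r * ?e t" for t
  have "(LINT x|\<sigma>. exp (- (\<i> * complex_of_real (x \<bullet> \<xi>)))) = (LINT x|\<sigma>. ?e (x \<bullet> sgn \<xi>))"
  proof -
    have "r * (x \<bullet> sgn \<xi>) = x \<bullet> \<xi>" for x using \<xi> by (simp add: r_def sgn_div_norm)
    then show ?thesis by (simp only:)
  qed
  also have "\<dots> = (LINT t|distr \<sigma> borel (\<lambda>x. x \<bullet> sgn \<xi>). ?e t)"
    by (rule integral_distr[symmetric]) measurable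
  also have "\<dots> = (LINT t|lborel. (2 * pi * indicator {-1..1} t) *\<^sub>R ?e t)"
    unfolding distr_\<sigma>_inner[OF ns]
    by (rule integral_density) (auto split: split_indicator)
  also have "\<dots> = (LINT t|lborel. complex_of_real (2 * pi) * (indicator {-1..1} t *\<^sub>R ?e t))"
    by (intro Bochner_Integration.integral_cong) (auto split: split_indicator simp: scaleR_conv_of_real)
  also have "\<dots> = complex_of_real (2 * pi) * (LINT t|lborel. indicator {-1..1} t *\<^sub>R ?e t)"
    by (rule integral_mult_right_zero)
  also have "(LINT t|lborel. indicator {-1..1} t *\<^sub>R ?e t) = E 1 - E (- 1)"
  proof (rule integral_FTC_Icc)
    fix t :: real
    have "((\<lambda>z. \<i> / complex_of_real r * exp (- (\<i> * (complex_of_real r * z)))) has_field_derivative ?e t) (at (complex_of_real t))"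
      using r by (auto intro!: derivative_eq_intros simp: field_simps)
    then have "((\<lambda>t. \<i> / complex_of_real r * exp (- (\<i> * (complex_of_real r * complex_of_real t)))) has_vector_derivative ?e t) (at t)"
      by (rule has_vector_derivative_real_field)
    then show "(E has_vector_derivative ?e t) (at t within {- 1..1})"
      unfolding E_def[abs_def] by (simp add: has_vector_derivative_at_within)
  next
    show "continuous_on {- 1..1} ?e" by (intro continuous_intros)
  qed simp
  also have "E 1 - E (- 1) = complex_of_real (2 * sin r / r)"
  proof -
    have "exp (- (\<i> * complex_of_real r)) = cis (- r)" "exp (\<i> * complex_of_real r) = cis r"
      by (simp_all add: cis_conv_exp)
    then show ?thesis
      using r by (simp add: E_def complex_eq_iff Re_divide Im_divide field_simps power2_eq_square)
  qed
  finally show ?thesis by (simp add: r_def)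
qed

text \<open>
In polar coordinates the integrand is \<open>4 \<pi> r\<^sup>2 (4 \<pi> sin r / r)^4\<close>.
\<close>
lemma nn_integral_extension_one:
  "(\<integral>\<^sup>+\<xi>. ennreal ((norm (LINT x|\<sigma>. exp (- (\<i> * complex_of_real (x \<bullet> \<xi>))))) ^ 4) \<partial>lborel) = ennreal (256 * pi ^ 6)"
proof -
  define H where "H r = (if r = 0 then (4 * pi) ^ 4 else (4 * pi * sin r / r) ^ 4)" for r :: real
  have [measurable]: "H \<in> borel_measurable borel" unfolding H_def by measurable
  have "(norm (LINT x|\<sigma>. exp (- (\<i> * complex_of_real (x \<bullet> \<xi>))))) ^ 4 = H (norm \<xi>)" for \<xi> :: "real^3"
  proof (cases "\<xi> = 0")
    case True
    have "measure \<sigma> UNIV = 4 * pi" by (simp add: measure_def emeasure_\<sigma>_UNIV)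
    then show ?thesis using True by (simp add: H_def scaleR_conv_of_real)
  next
    case False
    have "H (norm \<xi>) = (4 * pi * sin (norm \<xi>) / norm \<xi>) ^ 4" using False by (simp add: H_def)
    then show ?thesis
      unfolding extension_one[OF False] norm_of_real by (simp only: power_even_abs even_numeral)
  qed
  then have "(\<integral>\<^sup>+\<xi>. ennreal ((norm (LINT x|\<sigma>. exp (- (\<i> * complex_of_real (x \<bullet> \<xi>))))) ^ 4) \<partial>lborel)
      = (\<integral>\<^sup>+\<xi>. ennreal (H (norm (\<xi> :: real^3))) \<partial>lborel)" by simp
  also have "\<dots> = (\<integral>\<^sup>+r. ennreal (4 * pi * r\<^sup>2) * indicator {0..} r * ennreal (H r) \<partial>lborel)"
    by (rule nn_integral_space_radial) measurable
  also have "\<dots> = (\<integral>\<^sup>+r. ennreal (1024 * pi ^ 5) * (ennreal ((sin r) ^ 4 / r\<^sup>2) * indicator {0..} r) \<partial>lborel)"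
  proof (rule nn_integral_cong)
    fix r :: real
    have "ennreal (4 * pi * r\<^sup>2) * ennreal (H r) = ennreal (4 * pi * r\<^sup>2 * H r)"
      by (rule ennreal_mult'[symmetric]) simp
    also have "4 * pi * r\<^sup>2 * H r = 1024 * pi ^ 5 * ((sin r) ^ 4 / r\<^sup>2)"
      by (cases "r = 0") (simp_all add: H_def field_simps eval_nat_numeral)
    also have "ennreal (1024 * pi ^ 5 * ((sin r) ^ 4 / r\<^sup>2)) = ennreal (1024 * pi ^ 5) * ennreal ((sin r) ^ 4 / r\<^sup>2)"
      by (rule ennreal_mult') simp
    finally show "ennreal (4 * pi * r\<^sup>2) * indicator {0..} r * ennreal (H r)
        = ennreal (1024 * pi ^ 5) * (ennreal ((sin r) ^ 4 / r\<^sup>2) * indicator {0..} r)"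
      by (simp split: split_indicator)
  qed
  also have "\<dots> = ennreal (1024 * pi ^ 5) * ennreal (pi / 4)"
    by (subst nn_integral_cmult) (measurable, simp only: nn_integral_sin4)
  also have "\<dots> = ennreal (1024 * pi ^ 5 * (pi / 4))"
    by (rule ennreal_mult'[symmetric]) simp
  finally show ?thesis by (simp add: eval_nat_numeral)
qed

section \<open>Existence of an extremizer\<close>

lemma powr_half_power4:
  fixes s :: real
  assumes "0 \<le> s"
  shows "(s powr (1 / 2)) ^ 4 = s\<^sup>2"
proof -
  have "(sqrt s) ^ 4 = ((sqrt s)\<^sup>2)\<^sup>2" by (simp only: power_mult[symmetric]) simp
  then show ?thesis using assms by (simp add: powr_half_sqrt)
qed

lemma eLp_norm_eq:
  assumes "(\<integral>\<^sup>+ x. ennreal (norm (f x) powr p) \<partial>M) = ennreal r" "0 \<le> r"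
  shows "eLp_norm p M f = ennreal (r powr (1 / p))"
  using assms by (simp add: eLp_norm_def Let_def)

text \<open>
This leads from functions that are measurable on the sphere only to Borel functions on the whole
space, for which the estimates above are formulated.
\<close>
lemma extend_by_zero_to_\<sigma>:
  fixes f :: "real^3 \<Rightarrow> complex"
  assumes f: "f \<in> borel_measurable sphere_measure"
  obtains g where "g \<in> borel_measurable borel"
    and "(\<integral>\<^sup>+x. ennreal ((norm (g x))\<^sup>2) \<partial>\<sigma>) = (\<integral>\<^sup>+x. ennreal ((norm (f x))\<^sup>2) \<partial>sphere_measure)"
    and "extension_op f = (\<lambda>\<xi>. LINT x|\<sigma>. exp (- (\<i> * complex_of_real (x \<bullet> \<xi>))) * g x)"
proof -
  define g where "g x = (if x \<in> sphere 0 1 then f x else 0)" for x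
  have g[measurable]: "g \<in> borel_measurable borel"
    using f unfolding g_def[abs_def]
    by (subst (asm) measurable_cong_sets[OF sets_sphere_measure refl], subst (asm) measurable_restrict_space_iff[where c = 0]) auto
  have "(\<integral>\<^sup>+x. ennreal ((norm (g x))\<^sup>2) \<partial>\<sigma>) = (\<integral>\<^sup>+x. ennreal ((norm (g x))\<^sup>2) \<partial>sphere_measure)"
    by (rule nn_integral_\<sigma>) measurable
  also have "\<dots> = (\<integral>\<^sup>+x. ennreal ((norm (f x))\<^sup>2) \<partial>sphere_measure)"
    by (rule nn_integral_cong) (simp add: g_def)
  finally have 1: "(\<integral>\<^sup>+x. ennreal ((norm (g x))\<^sup>2) \<partial>\<sigma>) = (\<integral>\<^sup>+x. ennreal ((norm (f x))\<^sup>2) \<partial>sphere_measure)" .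
  have "extension_op f \<xi> = (LINT x|\<sigma>. exp (- (\<i> * complex_of_real (x \<bullet> \<xi>))) * g x)" for \<xi>
  proof -
    have "extension_op f \<xi> = (LINT x|sphere_measure. exp (- (\<i> * complex_of_real (x \<bullet> \<xi>))) * g x)"
      unfolding extension_op_def by (rule Bochner_Integration.integral_cong) (simp_all add: g_def)
    also have "\<dots> = (LINT x|\<sigma>. exp (- (\<i> * complex_of_real (x \<bullet> \<xi>))) * g x)"
      unfolding \<sigma>_def by (rule integral_distr[OF measurable_sphere_id, symmetric]) measurable
    finally show ?thesis .
  qed
  then show ?thesis by (intro that[OF g 1]) auto
qed

lemma eLp_norm_extension_le:
  fixes f :: "real^3 \<Rightarrow> complex"
  assumes f: "f \<in> borel_measurable sphere_measure"
    and S: "(\<integral>\<^sup>+x. ennreal (norm (f x) powr 2) \<partial>sphere_measure) = ennreal s" and s: "0 \<le> s"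
  shows "eLp_norm 4 lborel (extension_op f) \<le> ennreal (2 * pi * s powr (1 / 2))"
proof -
  obtain g where g: "g \<in> borel_measurable borel"
    and gS: "(\<integral>\<^sup>+x. ennreal ((norm (g x))\<^sup>2) \<partial>\<sigma>) = (\<integral>\<^sup>+x. ennreal ((norm (f x))\<^sup>2) \<partial>sphere_measure)"
    and e: "extension_op f = (\<lambda>\<xi>. LINT x|\<sigma>. exp (- (\<i> * complex_of_real (x \<bullet> \<xi>))) * g x)"
    by (rule extend_by_zero_to_\<sigma>[OF f])
  have "(\<integral>\<^sup>+x. ennreal ((norm (g x))\<^sup>2) \<partial>\<sigma>) = ennreal s" using gS S by simp
  from nn_integral_extension_le[OF g this s]
  have le: "(\<integral>\<^sup>+\<xi>. ennreal (norm (extension_op f \<xi>) powr 4) \<partial>lborel) \<le> ennreal (16 * pi ^ 4 * s\<^sup>2)"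
    by (simp add: e)
  then obtain r where r: "(\<integral>\<^sup>+\<xi>. ennreal (norm (extension_op f \<xi>) powr 4) \<partial>lborel) = ennreal r" "0 \<le> r"
    by (cases "\<integral>\<^sup>+\<xi>. ennreal (norm (extension_op f \<xi>) powr 4) \<partial>lborel") (auto simp: top_unique)
  have "r \<le> 16 * pi ^ 4 * s\<^sup>2" using le r by simp
  also have "\<dots> = (2 * pi * s powr (1 / 2)) ^ 4"
    by (simp add: power_mult_distrib powr_half_power4[OF s])
  finally have "r powr (1 / 4) \<le> ((2 * pi * s powr (1 / 2)) ^ 4) powr (1 / 4)"
    using r by (intro powr_mono2) auto
  also have "\<dots> = ((2 * pi * s powr (1 / 2)) powr 4) powr (1 / 4)" by simp
  also have "\<dots> = 2 * pi * s powr (1 / 2)" by (subst powr_powr) simp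
  finally show ?thesis by (simp add: eLp_norm_eq[OF r] ennreal_leI)
qed

text \<open>
The constant function attains the bound \<open>2 \<pi>\<close> of \<open>eLp_norm_extension_le\<close>.
\<close>
theorem theorem1p1:
  shows "\<exists>f :: real^3 \<Rightarrow> complex. f \<in> nonzero_L2 sphere_measure \<and>
           eLp_norm 4 lborel (extension_op f) = restriction_const * eLp_norm 2 sphere_measure f"
proof -
  let ?one = "\<lambda>_ :: real^3. 1 :: complex"
  have n2: "eLp_norm 2 sphere_measure ?one = ennreal ((4 * pi) powr (1 / 2))"
    by (rule eLp_norm_eq) (simp_all add: emeasure_sphere_measure_R3)
  have n4: "eLp_norm 4 lborel (extension_op ?one) = ennreal (2 * pi * (4 * pi) powr (1 / 2))"
  proof -
    have "extension_op ?one \<xi> = (LINT x|\<sigma>. exp (- (\<i> * complex_of_real (x \<bullet> \<xi>))))" for \<xi>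
      unfolding extension_op_def \<sigma>_def mult_1_right by (rule integral_distr[OF measurable_sphere_id, symmetric]) measurable
    then have "(\<integral>\<^sup>+\<xi>. ennreal (norm (extension_op ?one \<xi>) powr 4) \<partial>lborel) = ennreal (256 * pi ^ 6)"
      using nn_integral_extension_one by simp
    then have "eLp_norm 4 lborel (extension_op ?one) = ennreal ((256 * pi ^ 6) powr (1 / 4))"
      by (rule eLp_norm_eq) simp
    also have "256 * pi ^ 6 = (2 * pi * (4 * pi) powr (1 / 2)) powr 4"
    proof -
      have "(2 * pi * (4 * pi) powr (1 / 2)) powr 4 = (2 * pi * (4 * pi) powr (1 / 2)) ^ 4" by simp
      also have "\<dots> = (2 * pi) ^ 4 * (4 * pi)\<^sup>2"
        unfolding power_mult_distrib[of _ "(4 * pi) powr (1 / 2)"] by (subst powr_half_power4) simp_all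
      also have "\<dots> = 256 * pi ^ 6" by (simp add: power_mult_distrib flip: power_add)
      finally show ?thesis ..
    qed
    also have "((2 * pi * (4 * pi) powr (1 / 2)) powr 4) powr (1 / 4) = 2 * pi * (4 * pi) powr (1 / 2)"
      by (subst powr_powr) simp
    finally show ?thesis .
  qed
  have nz: "?one \<in> nonzero_L2 sphere_measure"
  proof -
    have "\<not> (AE x in (sphere_measure :: (real^3) measure). False)"
    proof -
      have "sphere 0 1 \<in> sets (sphere_measure :: (real^3) measure)"
        using sets.top[of "sphere_measure :: (real^3) measure"] by simp
      moreover have "{x \<in> space (sphere_measure :: (real^3) measure). \<not> False} = sphere 0 1" by auto
      ultimately show ?thesis using AE_iff_measurable[of "sphere 0 1" "sphere_measure :: (real^3) measure" "\<lambda>_. False"]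
        by (simp add: emeasure_sphere_measure_R3)
    qed
    then show ?thesis by (simp add: nonzero_L2_def L2_space_def n2)
  qed
  have R: "restriction_const = ennreal (2 * pi)"
    unfolding restriction_const_def
  proof (rule antisym)
    show "(SUP g \<in> nonzero_L2 (sphere_measure :: (real^3) measure). eLp_norm 4 lborel (extension_op g) / eLp_norm 2 sphere_measure g) \<le> ennreal (2 * pi)"
    proof (rule SUP_least)
      fix g :: "real^3 \<Rightarrow> complex" assume g: "g \<in> nonzero_L2 sphere_measure"
      then have gm[measurable]: "g \<in> borel_measurable sphere_measure" and fin: "eLp_norm 2 sphere_measure g < \<infinity>"
        and nz: "\<not> (AE x in sphere_measure. g x = 0)" by (auto simp: nonzero_L2_def L2_space_def)
      let ?I = "\<integral>\<^sup>+x. ennreal (norm (g x) powr 2) \<partial>sphere_measure"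
      have "?I \<noteq> \<infinity>" using fin by (auto simp: eLp_norm_def Let_def split: if_splits)
      then obtain s where s: "?I = ennreal s" "0 \<le> s" by (cases ?I) auto
      have "?I \<noteq> 0"
        using nz by (subst nn_integral_0_iff_AE) auto
      then have s0: "0 < s" using s by (cases "s = 0") auto
      have "eLp_norm 4 lborel (extension_op g) / eLp_norm 2 sphere_measure g \<le> ennreal (2 * pi * s powr (1 / 2)) / ennreal (s powr (1 / 2))"
        unfolding eLp_norm_eq[OF s] by (intro divide_right_mono_ennreal eLp_norm_extension_le gm s)
      also have "\<dots> = ennreal (2 * pi)" using s0 by (subst divide_ennreal) auto
      finally show "eLp_norm 4 lborel (extension_op g) / eLp_norm 2 sphere_measure g \<le> ennreal (2 * pi)" .
    qed
    have "ennreal (2 * pi) = eLp_norm 4 lborel (extension_op ?one) / eLp_norm 2 sphere_measure ?one"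
      unfolding n2 n4 by (subst divide_ennreal) auto
    also have "\<dots> \<le> (SUP g \<in> nonzero_L2 (sphere_measure :: (real^3) measure). eLp_norm 4 lborel (extension_op g) / eLp_norm 2 sphere_measure g)"
      by (rule SUP_upper[OF nz])
    finally show "ennreal (2 * pi) \<le> \<dots>" .
  qed
  have "eLp_norm 4 lborel (extension_op ?one) = restriction_const * eLp_norm 2 sphere_measure ?one"
    unfolding n2 n4 R by (rule ennreal_mult') simp
  with nz show ?thesis by blast
qed

end
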